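(* Let $k\ge0$ be an integer and let $M$ be a compact oriented smooth Riemannian manifold without boundary of dimension $4k+1$. For every $\lambda\in\mathcal X(M)$ there exists an irreducible projective unitary representation $(\rho_\lambda,H_\lambda)$ of $\mathcal G^0(M)=A^{2k}(M)/A^{2k}(M)_{\mathbb Z}$ on a Hilbert space $H_\lambda$ with cocycle $e^{2\pi iS_M}$.
   Context: $A^{2k}(M)$ is the group of real smooth $2k$-forms on $M$, and $A^{2k}(M)_{\mathbb Z}$ the subgroup of closed integral ones (closed, with de Rham class in the image of $H^{2k}(M,\mathbb Z)\to H^{2k}(M,\mathbb R)$). $S_M:\mathcal G^0(M)\times\mathcal G^0(M)\to\mathbb R/\mathbb Z$ is $S_M(\alpha,\beta)=\int_M\alpha\wedge d\beta\bmod\mathbb Z$ (this is the restriction to $\mathcal G^0(M)$ of the cocycle $\int_Mf\cup g$ on the smooth Deligne cohomology group $H^{2k+1}(M,\mathbb Z(2k+1)^\infty_D)$, which contains $\mathcal G^0(M)$ as a subgroup). $\mathbb H^{2k}(M)$ is the space of harmonic $2k$-forms, $\mathbb H^{2k}(M)_{\mathbb Z}=\mathbb H^{2k}(M)\cap A^{2k}(M)_{\mathbb Z}$, and $\mathcal X(M)$ is the group of continuous homomorphisms $\lambda:\mathbb H^{2k}(M)/\mathbb H^{2k}(M)_{\mathbb Z}\to\mathbb R/\mathbb Z$. A projective unitary representation of an (additively written) group $G$ on a complex Hilbert space $H$ with cocycle $c:G\times G\to\mathbb T=\{z\in\mathbb C:|z|=1\}$ is a map $\rho$ from $G$ to the unitary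 operators of $H$ with $\rho(f)\rho(g)=c(f,g)\rho(f+g)$; it is irreducible if $H\neq0$ and there is no closed invariant subspace other than $0$ and $H$. *)

theory Defs
  imports
    "HOL-Analysis.Analysis"
    "HOL-Homology.Homology"
    "HOL-Combinatorics.Permutations"
    "HOL-Library.Function_Algebras"
begin

section \<open>Smooth maps\<close>

text \<open>The domain \<open>S\<close> is always an open set below.\<close>

primrec C_on :: "nat \<Rightarrow> 'v::real_normed_vector set \<Rightarrow> ('v \<Rightarrow> 'w::real_normed_vector) \<Rightarrow> bool" where
  "C_on 0 S f \<longleftrightarrow> continuous_on S f"
| "C_on (Suc m) S f \<longleftrightarrow>
     f differentiable_on S \<and> (\<forall>v. C_on m S (\<lambda>x. frechet_derivative f (at x) v))"

definition smooth_on :: "'v::real_normed_vector set \<Rightarrow> ('v \<Rightarrow> 'w::real_normed_vector) \<Rightarrow> bool" where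
  "smooth_on S f \<longleftrightarrow> (\<forall>m. C_on m S f)"

text \<open>
  Singular simplices in the library live on \<open>nat \<Rightarrow> real\<close>; smoothness in the finitely many
  coordinates \<open>I\<close> is expressed by iterated partial derivatives.
\<close>

definition partial :: "nat \<Rightarrow> ((nat \<Rightarrow> real) \<Rightarrow> 'w::real_normed_vector) \<Rightarrow> (nat \<Rightarrow> real) \<Rightarrow> 'w" where
  "partial i f t = vector_derivative (\<lambda>r. f (t(i := r))) (at (t i))"

primrec C_in_coords ::
  "nat \<Rightarrow> nat set \<Rightarrow> (nat \<Rightarrow> real) set \<Rightarrow> ((nat \<Rightarrow> real) \<Rightarrow> 'w::real_normed_vector) \<Rightarrow> bool" where
  "C_in_coords 0 I V f \<longleftrightarrow> continuous_on V f"
| "C_in_coords (Suc m) I V f \<longleftrightarrow> continuous_on V f \<and>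
     (\<forall>i\<in>I. (\<forall>t\<in>V. (\<lambda>r. f (t(i := r))) differentiable (at (t i))) \<and> C_in_coords m I V (partial i f))"

definition smooth_in_coords ::
  "nat set \<Rightarrow> (nat \<Rightarrow> real) set \<Rightarrow> ((nat \<Rightarrow> real) \<Rightarrow> 'w::real_normed_vector) \<Rightarrow> bool" where
  "smooth_in_coords I V f \<longleftrightarrow> (\<forall>m. C_in_coords m I V f)"


section \<open>Closed oriented Riemannian manifolds\<close>

text \<open>
  A chart is a pair of an open set \<open>U\<close> of the manifold and a coordinate map on \<open>U\<close>. The
  dimension is \<open>CARD('n)\<close>, and the order of the index type orders the coordinates. An orientation
  is given by an atlas whose coordinate changes have positive Jacobian determinant. The metric
  is given by its Gram matrix in each chart.
\<close>

type_synonym ('a, 'n) chart = "'a set \<times> ('a \<Rightarrow> real^'n)"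

record ('a, 'n::finite) riem_manifold =
  mtop :: "'a topology"
  atlas :: "('a, 'n) chart set"
  gram :: "('a, 'n) chart \<Rightarrow> real^'n \<Rightarrow> real^'n^'n"

definition chart_image :: "('a, 'n::finite) chart \<Rightarrow> (real^'n) set" where
  "chart_image c = snd c ` fst c"

definition chart_inv :: "('a, 'n::finite) chart \<Rightarrow> real^'n \<Rightarrow> 'a" where
  "chart_inv c = inv_into (fst c) (snd c)"

definition overlap :: "('a, 'n::finite) chart \<Rightarrow> ('a, 'n) chart \<Rightarrow> (real^'n) set" where
  "overlap c c' = snd c ` (fst c \<inter> fst c')"

definition transition :: "('a, 'n::finite) chart \<Rightarrow> ('a, 'n) chart \<Rightarrow> real^'n \<Rightarrow> real^'n" where
  "transition c c' = snd c' \<circ> chart_inv c"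

definition jacobian_map :: "('a, 'n::finite) chart \<Rightarrow> ('a, 'n) chart \<Rightarrow> real^'n \<Rightarrow> real^'n \<Rightarrow> real^'n" where
  "jacobian_map c c' x = frechet_derivative (transition c c') (at x)"

definition oriented_smooth_atlas :: "'a topology \<Rightarrow> ('a, 'n::finite) chart set \<Rightarrow> bool" where
  "oriented_smooth_atlas X A \<longleftrightarrow>
     (\<Union>c\<in>A. fst c) = topspace X \<and>
     (\<forall>c\<in>A. openin X (fst c) \<and> open (chart_image c) \<and>
        homeomorphic_map (subtopology X (fst c)) (top_of_set (chart_image c)) (snd c)) \<and>
     (\<forall>c\<in>A. \<forall>c'\<in>A. smooth_on (overlap c c') (transition c c') \<and>
        (\<forall>x\<in>overlap c c'. det (matrix (jacobian_map c c' x)) > 0))"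

definition riemannian_metric ::
  "('a, 'n::finite) chart set \<Rightarrow> (('a, 'n) chart \<Rightarrow> real^'n \<Rightarrow> real^'n^'n) \<Rightarrow> bool" where
  "riemannian_metric A g \<longleftrightarrow>
     (\<forall>c\<in>A. smooth_on (chart_image c) (g c) \<and>
        (\<forall>x\<in>chart_image c. transpose (g c x) = g c x \<and> (\<forall>v. v \<noteq> 0 \<longrightarrow> v \<bullet> (g c x *v v) > 0))) \<and>
     (\<forall>c\<in>A. \<forall>c'\<in>A. \<forall>x\<in>overlap c c'.
        g c x = transpose (matrix (jacobian_map c c' x)) ** g c' (transition c c' x)
                  ** matrix (jacobian_map c c' x))"

definition closed_oriented_riemannian_manifold :: "('a, 'n::finite) riem_manifold \<Rightarrow> bool" where
  "closed_oriented_riemannian_manifold M \<longleftrightarrow>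
     Hausdorff_space (mtop M) \<and> second_countable (mtop M) \<and> compact_space (mtop M) \<and>
     oriented_smooth_atlas (mtop M) (atlas M) \<and> riemannian_metric (atlas M) (gram M)"


section \<open>Differential forms\<close>

text \<open>
  A form is a family of local forms, one for each chart, compatible under coordinate changes. Its
  value at a point of a chart image is a function of a list of vectors, whose length is the degree.
  Off the charts of the atlas, off the chart images and on lists of the wrong length, forms are set
  to \<open>0\<close>, so that equality of forms is equality of functions.
\<close>

type_synonym ('a, 'n) form = "('a, 'n) chart \<Rightarrow> real^'n \<Rightarrow> (real^'n) list \<Rightarrow> real"

definition alternating :: "nat \<Rightarrow> ((real^'n) list \<Rightarrow> real) \<Rightarrow> bool" where
  "alternating p w \<longleftrightarrow>
     (\<forall>vs. length vs \<noteq> p \<longrightarrow> w vs = 0) \<and>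
     (\<forall>vs i. length vs = p \<and> i < p \<longrightarrow> linear (\<lambda>v. w (vs[i := v]))) \<and>
     (\<forall>vs i j. length vs = p \<and> i < j \<and> j < p \<and> vs ! i = vs ! j \<longrightarrow> w vs = 0)"

definition on_charts :: "('a, 'n::finite) riem_manifold \<Rightarrow> ('a, 'n) form \<Rightarrow> ('a, 'n) form" where
  "on_charts M \<omega> = (\<lambda>c x vs. if c \<in> atlas M \<and> x \<in> chart_image c then \<omega> c x vs else 0)"

definition forms :: "('a, 'n::finite) riem_manifold \<Rightarrow> nat \<Rightarrow> ('a, 'n) form set" where
  "forms M p = {\<omega>.
     on_charts M \<omega> = \<omega> \<and>
     (\<forall>c\<in>atlas M. \<forall>x\<in>chart_image c. alternating p (\<omega> c x)) \<and>
     (\<forall>c\<in>atlas M. \<forall>vs. smooth_on (chart_image c) (\<lambda>x. \<omega> c x vs)) \<and>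
     (\<forall>c\<in>atlas M. \<forall>c'\<in>atlas M. \<forall>x\<in>overlap c c'. \<forall>vs.
        \<omega> c x vs = \<omega> c' (transition c c' x) (map (jacobian_map c c' x) vs))}"

text \<open>
  \<open>d\<omega>(v\<^sub>0,\<dots>,v\<^sub>p) = \<Sum>\<^sub>i (-1)\<^sup>i D\<^sub>v\<^sub>i \<omega>(v\<^sub>0,\<dots>,v\<^sub>i\<^sub>-\<^sub>1,v\<^sub>i\<^sub>+\<^sub>1,\<dots>,v\<^sub>p)\<close> for
  constant vectors in a chart.
\<close>

definition ext_deriv :: "('a, 'n::finite) riem_manifold \<Rightarrow> ('a, 'n) form \<Rightarrow> ('a, 'n) form" where
  "ext_deriv M \<omega> = on_charts M (\<lambda>c x vs. \<Sum>i<length vs.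
     (-1) ^ i * frechet_derivative (\<lambda>y. \<omega> c y (take i vs @ drop (Suc i) vs)) (at x) (vs ! i))"

definition wedge ::
  "nat \<Rightarrow> nat \<Rightarrow> ('a, 'n::finite) form \<Rightarrow> ('a, 'n) form \<Rightarrow> ('a, 'n) form" where
  "wedge p q \<alpha> \<beta> = (\<lambda>c x vs. if length vs = p + q then
     (\<Sum>\<pi> | \<pi> permutes {..<p + q}. of_int (sign \<pi>) *
        \<alpha> c x (map (\<lambda>i. vs ! \<pi> i) [0..<p]) * \<beta> c x (map (\<lambda>i. vs ! \<pi> i) [p..<p + q]))
     / (fact p * fact q) else 0)"


subsection \<open>Integration of top-degree forms\<close>

definition smooth_function :: "('a, 'n::finite) riem_manifold \<Rightarrow> ('a \<Rightarrow> real) \<Rightarrow> bool" where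
  "smooth_function M f \<longleftrightarrow> (\<forall>c\<in>atlas M. smooth_on (chart_image c) (f \<circ> chart_inv c))"

definition partition_of_unity ::
  "('a, 'n::finite) riem_manifold \<Rightarrow> ('a, 'n) chart set \<Rightarrow> (('a, 'n) chart \<Rightarrow> 'a \<Rightarrow> real) \<Rightarrow> bool" where
  "partition_of_unity M F \<rho> \<longleftrightarrow>
     finite F \<and> F \<subseteq> atlas M \<and>
     (\<forall>c\<in>F. smooth_function M (\<rho> c) \<and> (\<forall>x\<in>topspace (mtop M). \<rho> c x \<ge> 0) \<and>
        mtop M closure_of {x \<in> topspace (mtop M). \<rho> c x \<noteq> 0} \<subseteq> fst c) \<and>
     (\<forall>x\<in>topspace (mtop M). (\<Sum>c\<in>F. \<rho> c x) = 1)"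

definition std_frame :: "(real^'n::{finite,wellorder}) list" where
  "std_frame = map (\<lambda>i. axis i 1) (sorted_list_of_set UNIV)"

text \<open>The integral does not depend on the partition of unity that is chosen.\<close>

definition form_integral :: "('a, 'n::{finite,wellorder}) riem_manifold \<Rightarrow> ('a, 'n) form \<Rightarrow> real" where
  "form_integral M \<omega> =
     (let (F, \<rho>) = (SOME (F, \<rho>). partition_of_unity M F \<rho>)
      in \<Sum>c\<in>F. integral (chart_image c) (\<lambda>x. \<rho> c (chart_inv c x) * \<omega> c x std_frame))"


subsection \<open>Harmonic forms\<close>

definition volume_form :: "('a, 'n::{finite,wellorder}) riem_manifold \<Rightarrow> ('a, 'n) form" where
  "volume_form M = on_charts M (\<lambda>c x vs. if length vs = CARD('n) then
     sqrt (det (gram M c x)) * det (\<chi> i. vs ! card {j. j < i}) else 0)"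

text \<open>
  \<open>(\<star>\<omega>)\<^sub>b = (1/p!) \<omega>\<^sup>a vol\<^sub>a\<^sub>b\<close>, where the multi-index \<open>a\<close> of length \<open>p\<close> is raised with the
  inverse of the metric. With this convention \<open>\<alpha> \<and> \<star>\<beta>\<close> is the pointwise inner product of \<open>\<alpha>\<close>
  and \<open>\<beta>\<close> times the volume form.
\<close>

definition hodge_star ::
  "('a, 'n::{finite,wellorder}) riem_manifold \<Rightarrow> nat \<Rightarrow> ('a, 'n) form \<Rightarrow> ('a, 'n) form" where
  "hodge_star M p \<omega> = on_charts M (\<lambda>c x vs. if p + length vs = CARD('n) then
     (\<Sum>a | length a = p. \<Sum>b | length b = p.
        (\<Prod>r<p. matrix_inv (gram M c x) $ (a ! r) $ (b ! r)) *
        \<omega> c x (map (\<lambda>j. axis j 1) b) *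
        volume_form M c x (map (\<lambda>j. axis j 1) a @ vs)) / fact p else 0)"

definition codiff ::
  "('a, 'n::{finite,wellorder}) riem_manifold \<Rightarrow> nat \<Rightarrow> ('a, 'n) form \<Rightarrow> ('a, 'n) form" where
  "codiff M p \<omega> = (\<lambda>c x vs. (-1) ^ (CARD('n) * (p + 1) + 1) *
     hodge_star M (CARD('n) + 1 - p) (ext_deriv M (hodge_star M p \<omega>)) c x vs)"

definition laplacian ::
  "('a, 'n::{finite,wellorder}) riem_manifold \<Rightarrow> nat \<Rightarrow> ('a, 'n) form \<Rightarrow> ('a, 'n) form" where
  "laplacian M p \<omega> = ext_deriv M (codiff M p \<omega>) + codiff M (p + 1) (ext_deriv M \<omega>)"

definition harmonic_forms :: "('a, 'n::{finite,wellorder}) riem_manifold \<Rightarrow> nat \<Rightarrow> ('a, 'n) form set" where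
  "harmonic_forms M p = {\<omega> \<in> forms M p. laplacian M p \<omega> = 0}"

definition L2_dist ::
  "('a, 'n::{finite,wellorder}) riem_manifold \<Rightarrow> nat \<Rightarrow> ('a, 'n) form \<Rightarrow> ('a, 'n) form \<Rightarrow> real" where
  "L2_dist M p \<alpha> \<beta> = (if \<alpha> \<in> forms M p \<and> \<beta> \<in> forms M p then
     sqrt (form_integral M (wedge p (CARD('n) - p) (\<alpha> - \<beta>) (hodge_star M p (\<alpha> - \<beta>)))) else 0)"

text \<open>
  By Hodge theory the space of harmonic forms is finite-dimensional, so its vector space topology
  is the one induced by the \<open>L\<^sup>2\<close> norm.
\<close>

definition harmonic_topology ::
  "('a, 'n::{finite,wellorder}) riem_manifold \<Rightarrow> nat \<Rightarrow> ('a, 'n) form topology" where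
  "harmonic_topology M p = Metric_space.mtopology (harmonic_forms M p) (L2_dist M p)"


section \<open>Integral cohomology classes\<close>

definition smooth_simplex :: "('a, 'n::finite) riem_manifold \<Rightarrow> nat \<Rightarrow> ((nat \<Rightarrow> real) \<Rightarrow> 'a) \<Rightarrow> bool" where
  "smooth_simplex M p \<sigma> \<longleftrightarrow> singular_simplex p (mtop M) \<sigma> \<and>
     (\<forall>x\<in>standard_simplex p. \<forall>c\<in>atlas M. \<sigma> x \<in> fst c \<longrightarrow>
        (\<exists>V f. open V \<and> x \<in> V \<and> smooth_in_coords {..p} V f \<and>
           (\<forall>y\<in>V \<inter> standard_simplex p. \<sigma> y \<in> fst c \<and> f y = snd c (\<sigma> y))))"

definition smooth_chain :: "('a, 'n::finite) riem_manifold \<Rightarrow> nat \<Rightarrow> 'a chain \<Rightarrow> bool" where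
  "smooth_chain M p b \<longleftrightarrow> Poly_Mapping.keys b \<subseteq> Collect (smooth_simplex M p)"

text \<open>
  The standard simplex is parametrized by \<open>t\<^sub>1,\<dots>,t\<^sub>p > 0\<close> with \<open>t\<^sub>1 + \<dots> + t\<^sub>p < 1\<close>, up to its
  boundary, a null set. For \<open>p = 0\<close> the product measure is the unit mass at a point.
\<close>

definition simplex_param :: "nat \<Rightarrow> (nat \<Rightarrow> real) \<Rightarrow> nat \<Rightarrow> real" where
  "simplex_param p t = (\<lambda>i. if i = 0 then 1 - (\<Sum>j=1..p. t j) else if i \<le> p then t i else 0)"

definition open_simplex :: "nat \<Rightarrow> (nat \<Rightarrow> real) set" where
  "open_simplex p = {t \<in> space (Pi\<^sub>M {1..p} (\<lambda>_. lborel)). (\<forall>i\<in>{1..p}. t i > 0) \<and> (\<Sum>i=1..p. t i) < 1}"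

definition chart_at :: "('a, 'n::finite) riem_manifold \<Rightarrow> 'a \<Rightarrow> ('a, 'n) chart" where
  "chart_at M x = (SOME c. c \<in> atlas M \<and> x \<in> fst c)"

definition simplex_integral ::
  "('a, 'n::finite) riem_manifold \<Rightarrow> nat \<Rightarrow> ('a, 'n) form \<Rightarrow> ((nat \<Rightarrow> real) \<Rightarrow> 'a) \<Rightarrow> real" where
  "simplex_integral M p \<omega> \<sigma> =
     (LINT t : open_simplex p | Pi\<^sub>M {1..p} (\<lambda>_. lborel).
        (let c = chart_at M (\<sigma> (simplex_param p t));
             u = (\<lambda>s. snd c (\<sigma> (simplex_param p s)))
         in \<omega> c (u t) (map (\<lambda>i. partial i u t) [1..<Suc p])))"

definition singular_cocycle :: "'a topology \<Rightarrow> nat \<Rightarrow> ('a chain \<Rightarrow> 'r::ab_group_add) \<Rightarrow> bool" where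
  "singular_cocycle X p z \<longleftrightarrow>
     (\<forall>a b. singular_chain p X a \<and> singular_chain p X b \<longrightarrow> z (a + b) = z a + z b) \<and>
     (\<forall>b. singular_chain (Suc p) X b \<longrightarrow> z (chain_boundary (Suc p) b) = 0)"

text \<open>
  The de Rham isomorphism sends the class of a closed form \<open>\<omega>\<close> to the class of the cochain
  \<open>\<sigma> \<mapsto> \<integral>\<^sub>\<sigma> \<omega>\<close> on smooth simplices, and restriction to smooth simplices identifies singular with
  smooth singular cohomology. So \<open>u\<close> represents the class of \<open>\<omega>\<close> iff on smooth simplices it differs
  from integration of \<open>\<omega>\<close> by the coboundary of a cochain \<open>v\<close> on smooth \<open>(p-1)\<close>-chains. For \<open>p = 0\<close>
  this coboundary vanishes because \<open>chain_boundary 0\<close> does.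
\<close>

definition de_Rham_represented_by ::
  "('a, 'n::finite) riem_manifold \<Rightarrow> nat \<Rightarrow> ('a, 'n) form \<Rightarrow> ('a chain \<Rightarrow> real) \<Rightarrow> bool" where
  "de_Rham_represented_by M p \<omega> u \<longleftrightarrow> singular_cocycle (mtop M) p u \<and>
     (\<exists>v :: 'a chain \<Rightarrow> real.
        (\<forall>a b. smooth_chain M (p - 1) a \<and> smooth_chain M (p - 1) b \<longrightarrow> v (a + b) = v a + v b) \<and>
        (\<forall>\<sigma>. smooth_simplex M p \<sigma> \<longrightarrow>
           simplex_integral M p \<omega> \<sigma> = u (frag_of \<sigma>) + v (chain_boundary p (frag_of \<sigma>))))"

definition closed_integral_forms :: "('a, 'n::finite) riem_manifold \<Rightarrow> nat \<Rightarrow> ('a, 'n) form set" where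
  "closed_integral_forms M p = {\<omega> \<in> forms M p. ext_deriv M \<omega> = 0 \<and>
     (\<exists>z :: 'a chain \<Rightarrow> int. singular_cocycle (mtop M) p z \<and>
        de_Rham_represented_by M p \<omega> (\<lambda>b. of_int (z b)))}"


section \<open>The groups and the cocycle\<close>

definition additive_group :: "'g::ab_group_add set \<Rightarrow> 'g monoid" where
  "additive_group A = \<lparr>carrier = A, monoid.mult = (+), one = 0\<rparr>"

definition G0 :: "('a, 'n::finite) riem_manifold \<Rightarrow> nat \<Rightarrow> ('a, 'n) form set monoid" where
  "G0 M k = additive_group (forms M (2 * k)) Mod closed_integral_forms M (2 * k)"

definition R_mod_Z :: "real set monoid" where
  "R_mod_Z = additive_group UNIV Mod \<int>"

definition to_R_mod_Z :: "real \<Rightarrow> real set" where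
  "to_R_mod_Z r = \<int> #>\<^bsub>additive_group UNIV\<^esub> r"

text \<open>
  All representatives give the same class in \<open>R/Z\<close>, which is therefore the union below.
\<close>

definition S_form ::
  "('a, 'n::{finite,wellorder}) riem_manifold \<Rightarrow> nat \<Rightarrow> ('a, 'n) form set \<Rightarrow> ('a, 'n) form set \<Rightarrow> real set" where
  "S_form M k A B = (\<Union>\<alpha>\<in>A. \<Union>\<beta>\<in>B.
     to_R_mod_Z (form_integral M (wedge (2 * k) (2 * k + 1) \<alpha> (ext_deriv M \<beta>))))"

text \<open>The map \<open>e\<^sup>2\<^sup>\<pi>\<^sup>i\<^sup>s\<close> on classes \<open>s\<close> in \<open>R/Z\<close>.\<close>

definition exp_2pi_i :: "real set \<Rightarrow> complex" where
  "exp_2pi_i s = the_elem ((\<lambda>r. exp (2 * of_real pi * \<i> * of_real r)) ` s)"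

definition quotient_topology :: "'x topology \<Rightarrow> ('x \<Rightarrow> 'y) \<Rightarrow> 'y topology" where
  "quotient_topology X q =
     topology (\<lambda>V. V \<subseteq> q ` topspace X \<and> openin X {x \<in> topspace X. q x \<in> V})"

lemma openin_quotient_topology:
  "openin (quotient_topology X q) V \<longleftrightarrow>
     V \<subseteq> q ` topspace X \<and> openin X {x \<in> topspace X. q x \<in> V}"
proof -
  let ?L = "\<lambda>V. V \<subseteq> q ` topspace X \<and> openin X {x \<in> topspace X. q x \<in> V}"
  have "?L (S \<inter> T)" if "?L S" "?L T" for S T
  proof -
    have "{x \<in> topspace X. q x \<in> S \<inter> T} = {x \<in> topspace X. q x \<in> S} \<inter> {x \<in> topspace X. q x \<in> T}"
      by blast
    moreover have "openin X ({x \<in> topspace X. q x \<in> S} \<inter> {x \<in> topspace X. q x \<in> T})"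
      using that by (intro openin_Int) simp_all
    ultimately show ?thesis using that by auto
  qed
  moreover have "?L (\<Union>\<K>)" if "\<forall>K\<in>\<K>. ?L K" for \<K>
  proof -
    have "{x \<in> topspace X. q x \<in> \<Union>\<K>} = (\<Union>K\<in>\<K>. {x \<in> topspace X. q x \<in> K})"
      by blast
    moreover have "openin X (\<Union>K\<in>\<K>. {x \<in> topspace X. q x \<in> K})"
      using that by (intro openin_Union) auto
    ultimately show ?thesis using that by (simp add: Sup_least)
  qed
  ultimately have "istopology ?L"
    unfolding istopology_def by blast
  then show ?thesis
    by (simp add: quotient_topology_def topology_inverse')
qed

lemma topspace_quotient_topology: "topspace (quotient_topology X q) = q ` topspace X"
proof -
  have "{x \<in> topspace X. q x \<in> q ` topspace X} = topspace X" by blast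
  then have "openin (quotient_topology X q) (q ` topspace X)"
    by (simp add: openin_quotient_topology)
  then show ?thesis
    by (metis openin_quotient_topology openin_subset openin_topspace subset_antisym)
qed

lemma quotient_map_quotient_topology: "quotient_map X (quotient_topology X q) q"
  by (simp add: quotient_map_def topspace_quotient_topology openin_quotient_topology)

text \<open>The group of continuous characters of the torus of harmonic forms modulo integral ones.\<close>

definition harmonic_characters ::
  "('a, 'n::{finite,wellorder}) riem_manifold \<Rightarrow> nat \<Rightarrow> (('a, 'n) form set \<Rightarrow> real set) set" where
  "harmonic_characters M k =
     (let H = additive_group (harmonic_forms M (2 * k));
          HZ = harmonic_forms M (2 * k) \<inter> closed_integral_forms M (2 * k)
      in {l \<in> hom (H Mod HZ) R_mod_Z \<inter> extensional (carrier (H Mod HZ)).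
            continuous_map
              (quotient_topology (harmonic_topology M (2 * k)) (\<lambda>\<omega>. HZ #>\<^bsub>H\<^esub> \<omega>))
              (quotient_topology euclideanreal to_R_mod_Z) l})"


section \<open>Projective unitary representations\<close>

definition complex_ring :: "complex ring" where
  "complex_ring = \<lparr>carrier = UNIV, monoid.mult = (*), one = 1, ring.zero = 0, add = (+)\<rparr>"

text \<open>The ring multiplication and unit inherited from the record \<open>module\<close> are not used.\<close>

record 'h cinner_space = "(complex, 'h) module" +
  cinner :: "'h \<Rightarrow> 'h \<Rightarrow> complex"

definition hdist :: "'h cinner_space \<Rightarrow> 'h \<Rightarrow> 'h \<Rightarrow> real" where
  "hdist H x y = (if x \<in> carrier H \<and> y \<in> carrier H then
     sqrt (Re (cinner H (x \<ominus>\<^bsub>H\<^esub> y) (x \<ominus>\<^bsub>H\<^esub> y))) else 0)"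

definition complex_hilbert_space :: "'h cinner_space \<Rightarrow> bool" where
  "complex_hilbert_space H \<longleftrightarrow>
     module complex_ring H \<and>
     (\<forall>x\<in>carrier H. \<forall>y\<in>carrier H. \<forall>z\<in>carrier H.
        cinner H x (y \<oplus>\<^bsub>H\<^esub> z) = cinner H x y + cinner H x z) \<and>
     (\<forall>a. \<forall>x\<in>carrier H. \<forall>y\<in>carrier H. cinner H x (a \<odot>\<^bsub>H\<^esub> y) = a * cinner H x y) \<and>
     (\<forall>x\<in>carrier H. \<forall>y\<in>carrier H. cinner H y x = cnj (cinner H x y)) \<and>
     (\<forall>x\<in>carrier H. x \<noteq> \<zero>\<^bsub>H\<^esub> \<longrightarrow> Re (cinner H x x) > 0) \<and>
     Metric_space.mcomplete (carrier H) (hdist H)"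

definition unitary_operator :: "'h cinner_space \<Rightarrow> ('h \<Rightarrow> 'h) \<Rightarrow> bool" where
  "unitary_operator H T \<longleftrightarrow>
     bij_betw T (carrier H) (carrier H) \<and>
     (\<forall>x\<in>carrier H. \<forall>y\<in>carrier H. T (x \<oplus>\<^bsub>H\<^esub> y) = T x \<oplus>\<^bsub>H\<^esub> T y) \<and>
     (\<forall>a. \<forall>x\<in>carrier H. T (a \<odot>\<^bsub>H\<^esub> x) = a \<odot>\<^bsub>H\<^esub> T x) \<and>
     (\<forall>x\<in>carrier H. \<forall>y\<in>carrier H. cinner H (T x) (T y) = cinner H x y)"

definition closed_subspace :: "'h cinner_space \<Rightarrow> 'h set \<Rightarrow> bool" where
  "closed_subspace H W \<longleftrightarrow>
     W \<subseteq> carrier H \<and> \<zero>\<^bsub>H\<^esub> \<in> W \<and>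
     (\<forall>x\<in>W. \<forall>y\<in>W. x \<oplus>\<^bsub>H\<^esub> y \<in> W) \<and> (\<forall>a. \<forall>x\<in>W. a \<odot>\<^bsub>H\<^esub> x \<in> W) \<and>
     closedin (Metric_space.mtopology (carrier H) (hdist H)) W"

definition projective_unitary_rep ::
  "'g monoid \<Rightarrow> ('g \<Rightarrow> 'g \<Rightarrow> complex) \<Rightarrow> 'h cinner_space \<Rightarrow> ('g \<Rightarrow> 'h \<Rightarrow> 'h) \<Rightarrow> bool" where
  "projective_unitary_rep G c H \<rho> \<longleftrightarrow>
     complex_hilbert_space H \<and>
     (\<forall>f\<in>carrier G. \<forall>g\<in>carrier G. cmod (c f g) = 1) \<and>
     (\<forall>g\<in>carrier G. unitary_operator H (\<rho> g)) \<and>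
     (\<forall>f\<in>carrier G. \<forall>g\<in>carrier G. \<forall>x\<in>carrier H.
        \<rho> f (\<rho> g x) = c f g \<odot>\<^bsub>H\<^esub> \<rho> (f \<otimes>\<^bsub>G\<^esub> g) x)"

text \<open>
  An irreducible projective representation of \<open>G\<close> is generated by the orbit of any nonzero vector,
  so its Hilbert dimension is at most the cardinality of \<open>G\<close>. Functions \<open>G \<Rightarrow> complex\<close> therefore
  suffice as underlying type when the existence of such a representation is asserted.
\<close>

definition irreducible_rep :: "'g monoid \<Rightarrow> 'h cinner_space \<Rightarrow> ('g \<Rightarrow> 'h \<Rightarrow> 'h) \<Rightarrow> bool" where
  "irreducible_rep G H \<rho> \<longleftrightarrow>
     carrier H \<noteq> {\<zero>\<^bsub>H\<^esub>} \<and>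
     (\<forall>W. closed_subspace H W \<and> (\<forall>g\<in>carrier G. \<rho> g ` W \<subseteq> W) \<longrightarrow>
        W = {\<zero>\<^bsub>H\<^esub>} \<or> W = carrier H)"

end

theory Submission
  imports Defs "HOL-Real_Asymp.Real_Asymp"
begin

text \<open>
  For \<open>\<alpha>\<close>, \<open>\<beta>\<close> of even degree \<open>2k\<close> on a closed manifold of dimension \<open>4k+1\<close>, Stokes' theorem makes
  \<open>s(\<alpha>,\<beta>) = \<integral> \<alpha> \<and> d\<beta>\<close> a skew-symmetric real bilinear form, whose radical contains all closed forms.
  Any such form has a maximal isotropic subset \<open>L\<close>, and maximality means that \<open>L\<close> is its own
  annihilator. The representation induced from the trivial character of \<open>L\<close> acts on
  \<open>l\<^sup>2\<close> of the cosets of \<open>L\<close>, where \<open>L\<close> acts diagonally. Since \<open>L\<close> equals its annihilator, it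
  acts by different characters on different cosets, so a nonzero closed invariant subspace
  contains a point mass; the whole group permutes the cosets transitively, so it contains all of them.
  Closed forms act trivially, hence the representation descends to the quotient by the closed
  integral ones, for every \<open>\<lambda>\<close>.
\<close>

section \<open>The Hilbert space of square-summable functions\<close>

text \<open>\<open>L\<close> is isotropic for the real-valued form, not merely modulo integers. Its
  annihilator equation is then real-linear, so \<open>L\<close> is closed under real scaling, and an
  element of \<open>L\<close> that tells two cosets apart can be rescaled until its eigenvalues
  there are opposite. Averaging then kills one coordinate outright. A projective representation
  carries no continuity condition here, so the cosets may get counting measure, which is what makes
  point masses vectors. The analytic obstacle is skew symmetry, because \<open>form_integral\<close>
  is a sum of chart integrals weighted by one chosen partition of unity \<rho>. With wedge products
  understood, \<alpha> d\<beta> + \<beta> d\<alpha> = d(\<alpha> \<beta>) in even degree, and in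
  each chart \<rho> d(\<alpha> \<beta>) = d(\<rho> \<alpha> \<beta>) - d\<rho> \<alpha> \<beta>. The
  exact term integrates to 0 in coordinates; the remaining terms cancel only after summation over
  all charts, which calls for the change of variables formula and the determinant law for top-degree
  forms.\<close>

definition l2 :: "'i set \<Rightarrow> ('i \<Rightarrow> complex) set" where
  "l2 X = {f. (\<forall>x. x \<notin> X \<longrightarrow> f x = 0) \<and> (\<lambda>x. (cmod (f x))\<^sup>2) summable_on X}"

definition l2_nsq :: "'i set \<Rightarrow> ('i \<Rightarrow> complex) \<Rightarrow> real" where
  "l2_nsq X f = (\<Sum>\<^sub>\<infinity>x\<in>X. (cmod (f x))\<^sup>2)"

definition l2_space :: "'i set \<Rightarrow> ('i \<Rightarrow> complex) cinner_space" where
  "l2_space X = \<lparr>carrier = l2 X, monoid.mult = (*), one = 1, ring.zero = 0, add = (+),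
     smult = (\<lambda>a f x. a * f x), cinner = (\<lambda>f g. \<Sum>\<^sub>\<infinity>x\<in>X. cnj (f x) * g x)\<rparr>"

lemma l2_space_simps [simp]:
  "carrier (l2_space X) = l2 X" "zero (l2_space X) = 0" "add (l2_space X) = (+)"
  "smult (l2_space X) = (\<lambda>a f x. a * f x)"
  "cinner (l2_space X) = (\<lambda>f g. \<Sum>\<^sub>\<infinity>x\<in>X. cnj (f x) * g x)"
  by (simp_all add: l2_space_def)

lemma l2_outside: "f \<in> l2 X \<Longrightarrow> x \<notin> X \<Longrightarrow> f x = 0"
  by (simp add: l2_def)

text \<open>Bounding all finite partial sums gives membership and the norm estimate together. Limit
  arguments below therefore take place on finite sets, where termwise limits and the inequalities
  for \<open>L2_set\<close> apply.\<close>

lemma l2_boundedI: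
  assumes "\<And>x. x \<notin> X \<Longrightarrow> f x = 0"
    and "\<And>F. finite F \<Longrightarrow> F \<subseteq> X \<Longrightarrow> (\<Sum>x\<in>F. (cmod (f x))\<^sup>2) \<le> B"
  shows "f \<in> l2 X" and "l2_nsq X f \<le> B"
proof -
  have "(\<lambda>x. (cmod (f x))\<^sup>2) summable_on X"
    using assms(2) by (intro nonneg_bdd_above_summable_on bdd_aboveI2[where M = B]) auto
  then show "f \<in> l2 X" "l2_nsq X f \<le> B"
    using assms by (auto simp: l2_def l2_nsq_def intro: infsum_le_finite_sums)
qed

lemma l2_finite_sum_le:
  assumes "f \<in> l2 X" "finite F" "F \<subseteq> X"
  shows "(\<Sum>x\<in>F. (cmod (f x))\<^sup>2) \<le> l2_nsq X f"
  using assms unfolding l2_nsq_def by (intro finite_sum_le_infsum) (auto simp: l2_def)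

lemma l2_nsq_nonneg: "0 \<le> l2_nsq X f"
  unfolding l2_nsq_def by (intro infsum_nonneg) simp

lemma l2_coord_le:
  assumes "f \<in> l2 X"
  shows "cmod (f x) \<le> sqrt (l2_nsq X f)"
proof (cases "x \<in> X")
  case True
  then show ?thesis
    using l2_finite_sum_le[OF assms, of "{x}"] real_le_rsqrt by auto
qed (use assms l2_nsq_nonneg in \<open>simp add: l2_outside\<close>)

text \<open>Minkowski's inequality holds for \<open>L2_set\<close> on every finite subset, with a
  bound that does not depend on the subset.\<close>

lemma l2_add:
  assumes f: "f \<in> l2 X" and g: "g \<in> l2 X"
  shows "f + g \<in> l2 X" and "sqrt (l2_nsq X (f + g)) \<le> sqrt (l2_nsq X f) + sqrt (l2_nsq X g)"
proof -
  let ?B = "sqrt (l2_nsq X f) + sqrt (l2_nsq X g)"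
  have B: "0 \<le> ?B"
    by (simp add: l2_nsq_nonneg)
  have sum: "(\<Sum>x\<in>F. (cmod ((f + g) x))\<^sup>2) \<le> ?B\<^sup>2" if "finite F" "F \<subseteq> X" for F
  proof -
    have "L2_set (\<lambda>x. cmod ((f + g) x)) F \<le> L2_set (\<lambda>x. cmod (f x) + cmod (g x)) F"
      by (intro L2_set_mono) (auto simp: norm_triangle_ineq)
    also have "\<dots> \<le> L2_set (\<lambda>x. cmod (f x)) F + L2_set (\<lambda>x. cmod (g x)) F"
      by (rule L2_set_triangle_ineq)
    also have "\<dots> \<le> ?B"
      using that f g by (intro add_mono) (auto simp: L2_set_def l2_finite_sum_le)
    finally show ?thesis
      by (simp add: L2_set_def sqrt_le_D)
  qed
  note * = l2_boundedI[of X "f + g" "?B\<^sup>2"]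
  show "f + g \<in> l2 X"
    using * sum f g by (auto simp: l2_outside)
  have "l2_nsq X (f + g) \<le> ?B\<^sup>2"
    using * sum f g by (auto simp: l2_outside)
  then show "sqrt (l2_nsq X (f + g)) \<le> ?B"
    using B by (metis real_sqrt_le_mono real_sqrt_abs abs_of_nonneg)
qed

lemma l2_scale:
  assumes "f \<in> l2 X"
  shows "(\<lambda>x. a * f x) \<in> l2 X"
  using assms by (auto simp: l2_def norm_mult power_mult_distrib intro: summable_on_cmult_right)

lemma l2_zero: "0 \<in> l2 X"
  by (simp add: l2_def)

lemma l2_uminus: "f \<in> l2 X \<Longrightarrow> - f \<in> l2 X"
  using l2_scale[of f X "-1"] by (simp add: fun_Compl_def)

lemma l2_diff: "f \<in> l2 X \<Longrightarrow> g \<in> l2 X \<Longrightarrow> f - g \<in> l2 X"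
  using l2_add(1)[of f X "- g"] l2_uminus[of g X] by simp

lemma l2_inner_summable:
  assumes "f \<in> l2 X" "g \<in> l2 X"
  shows "(\<lambda>x. cnj (f x) * g x) summable_on X"
proof (rule abs_summable_summable, rule summable_on_comparison_test)
  show "(\<lambda>x. (cmod (f x))\<^sup>2 + (cmod (g x))\<^sup>2) summable_on X"
    using assms by (intro summable_on_add) (auto simp: l2_def)
  show "cmod (cnj (f x) * g x) \<le> (cmod (f x))\<^sup>2 + (cmod (g x))\<^sup>2" for x
    \<comment> \<open>With a, b the two moduli, 2 a b \<le> a^2 + b^2, and a b \<ge> 0 lets the
      factor 2 be dropped.\<close>
    using sum_squares_bound[of "cmod (f x)" "cmod (g x)"] mult_nonneg_nonneg[of "cmod (f x)" "cmod (g x)"] 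
    by (simp add: norm_mult del: mult_nonneg_nonneg)
qed simp

lemma l2_inner_self:
  assumes "f \<in> l2 X"
  shows "(\<Sum>\<^sub>\<infinity>x\<in>X. cnj (f x) * f x) = of_real (l2_nsq X f)"
proof -
  have "(\<Sum>\<^sub>\<infinity>x\<in>X. cnj (f x) * f x) = (\<Sum>\<^sub>\<infinity>x\<in>X. of_real ((cmod (f x))\<^sup>2))"
    by (intro infsum_cong) (simp only: complex_norm_square mult.commute)
  then show ?thesis
    using assms unfolding l2_nsq_def l2_def
    by (simp only: mem_Collect_eq) (intro infsumI has_sum_of_real_iff[THEN iffD2] has_sum_infsum; simp)
qed

lemma l2_module: "module complex_ring (l2_space X)"
proof (rule moduleI)
  show "cring complex_ring"
    by (rule cringI; (rule abelian_groupI comm_monoidI)?)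
       (auto simp: complex_ring_def algebra_simps intro: exI[of _ "- x" for x] add.right_inverse)
  show "abelian_group (l2_space X)"
    by (rule abelian_groupI)
       (auto simp: l2_add l2_zero add_ac intro!: bexI[of _ "- x" for x] l2_uminus)
qed (auto simp: complex_ring_def l2_scale fun_eq_iff algebra_simps)

lemma l2_minus:
  assumes "f \<in> l2 X" "g \<in> l2 X"
  shows "f \<ominus>\<^bsub>l2_space X\<^esub> g = f - g"
proof -
  interpret M: module complex_ring "l2_space X"
    by (rule l2_module)
  have "\<ominus>\<^bsub>l2_space X\<^esub> g = - g"
    using assms by (intro M.minus_equality) (auto simp: l2_uminus)
  then show ?thesis
    by (simp add: a_minus_def)
qed

lemma l2_hdist:
  "hdist (l2_space X) f g = (if f \<in> l2 X \<and> g \<in> l2 X then sqrt (l2_nsq X (f - g)) else 0)"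
proof -
  have "Re (cinner (l2_space X) h h) = l2_nsq X h" if "h \<in> l2 X" for h
    using that by (simp add: l2_inner_self)
  then show ?thesis
    by (simp add: hdist_def l2_minus l2_diff del: l2_space_simps(5) fun_diff_def)
qed

lemma l2_nsq_eq_0: "f \<in> l2 X \<Longrightarrow> l2_nsq X f = 0 \<longleftrightarrow> f = 0"
  using l2_coord_le[of f X] by (auto simp: fun_eq_iff) (simp add: l2_nsq_def)

lemma l2_metric: "Metric_space (l2 X) (hdist (l2_space X))"
proof
  fix f g h
  show "0 \<le> hdist (l2_space X) f g"
    by (simp add: l2_hdist l2_nsq_nonneg)
  show "hdist (l2_space X) f g = hdist (l2_space X) g f"
    by (simp add: l2_hdist l2_nsq_def norm_minus_commute)
  show "hdist (l2_space X) f g = 0 \<longleftrightarrow> f = g" if "f \<in> l2 X" "g \<in> l2 X"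
    using that by (simp add: l2_hdist l2_nsq_eq_0 l2_diff del: fun_diff_def)
  show "hdist (l2_space X) f h \<le> hdist (l2_space X) f g + hdist (l2_space X) g h"
    if "f \<in> l2 X" "g \<in> l2 X" "h \<in> l2 X"
    using l2_add(2)[of "f - g" X "g - h"] that by (simp add: l2_hdist l2_diff del: fun_diff_def)
qed

text \<open>The limit is built coordinatewise, since a coordinate is bounded by the norm. The Cauchy
  estimate for \<open>\<sigma> n - \<sigma> m\<close> is restricted to a finite set before m tends
  to infinity, and \<open>l2_boundedI\<close> then restores the whole index set.\<close>

lemma l2_complete: "Metric_space.mcomplete (l2 X) (hdist (l2_space X))"
proof -
  interpret Metric_space "l2 X" "hdist (l2_space X)"
    by (rule l2_metric)
  have "\<exists>f. limitin mtopology \<sigma> f sequentially" if "MCauchy \<sigma>" for \<sigma>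
  proof -
    have \<sigma>: "\<sigma> n \<in> l2 X" for n
      using that by (auto simp: MCauchy_def)
    have C: "\<exists>N. \<forall>n\<ge>N. \<forall>m\<ge>N. sqrt (l2_nsq X (\<sigma> n - \<sigma> m)) < e" if "e > 0" for e
      using \<open>MCauchy \<sigma>\<close> that \<sigma> unfolding MCauchy_def l2_hdist by simp
    have "Cauchy (\<lambda>n. \<sigma> n x)" for x
    proof (rule metric_CauchyI)
      fix e :: real assume "e > 0"
      then obtain N where N: "\<forall>n\<ge>N. \<forall>m\<ge>N. sqrt (l2_nsq X (\<sigma> n - \<sigma> m)) < e"
        using C by blast
      have "dist (\<sigma> m x) (\<sigma> n x) < e" if "m \<ge> N" "n \<ge> N" for m n
        using l2_coord_le[OF l2_diff[OF \<sigma> \<sigma>], of m n x] N that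
        by (fastforce simp: dist_norm)
      then show "\<exists>N. \<forall>m\<ge>N. \<forall>n\<ge>N. dist (\<sigma> m x) (\<sigma> n x) < e"
        by blast
    qed
    then have "\<forall>x. \<exists>l. (\<lambda>n. \<sigma> n x) \<longlonglongrightarrow> l"
      using Cauchy_convergent convergent_def by blast
    then obtain f where f: "\<And>x. (\<lambda>n. \<sigma> n x) \<longlonglongrightarrow> f x"
      by metis
    have f0: "f x = 0" if "x \<notin> X" for x
      using f[of x] l2_outside[OF \<sigma> that] by (simp add: LIMSEQ_const_iff)
    have lim: "\<exists>N. \<forall>n\<ge>N. \<sigma> n - f \<in> l2 X \<and> sqrt (l2_nsq X (\<sigma> n - f)) \<le> e" if "e > 0" for e
    proof -
      obtain N where N: "\<forall>n\<ge>N. \<forall>m\<ge>N. sqrt (l2_nsq X (\<sigma> n - \<sigma> m)) < e"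
        using C[OF \<open>e > 0\<close>] by blast
      have "\<sigma> n - f \<in> l2 X \<and> l2_nsq X (\<sigma> n - f) \<le> e\<^sup>2" if n: "n \<ge> N" for n
      proof -
        have "(\<Sum>x\<in>F. (cmod ((\<sigma> n - f) x))\<^sup>2) \<le> e\<^sup>2" if F: "finite F" "F \<subseteq> X" for F
        proof (rule LIMSEQ_le_const2)
          show "(\<lambda>m. \<Sum>x\<in>F. (cmod ((\<sigma> n - \<sigma> m) x))\<^sup>2) \<longlonglongrightarrow> (\<Sum>x\<in>F. (cmod ((\<sigma> n - f) x))\<^sup>2)"
            using f by (auto intro!: tendsto_intros)
          have "(\<Sum>x\<in>F. (cmod ((\<sigma> n - \<sigma> m) x))\<^sup>2) \<le> e\<^sup>2" if "m \<ge> N" for m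
          proof -
            have "(\<Sum>x\<in>F. (cmod ((\<sigma> n - \<sigma> m) x))\<^sup>2) \<le> l2_nsq X (\<sigma> n - \<sigma> m)"
              using F \<sigma> by (intro l2_finite_sum_le l2_diff) auto
            also have "\<dots> \<le> e\<^sup>2"
              using N n that by (meson less_imp_le sqrt_le_D)
            finally show ?thesis .
          qed
          then show "\<exists>N. \<forall>m\<ge>N. (\<Sum>x\<in>F. (cmod ((\<sigma> n - \<sigma> m) x))\<^sup>2) \<le> e\<^sup>2"
            by blast
        qed
        then show ?thesis
          using l2_boundedI[of X "\<sigma> n - f" "e\<^sup>2"] f0 l2_outside[OF \<sigma>] by simp
      qed
      then show ?thesis
        using that by (intro exI[of _ N]) (auto intro: real_le_lsqrt)
    qed
    obtain n where "\<sigma> n - f \<in> l2 X"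
      using lim[of 1] by auto
    then have fl: "f \<in> l2 X"
      using l2_diff[OF \<sigma>[of n]] by (metis diff_diff_eq2 add_diff_cancel_left')
    have "limitin mtopology \<sigma> f sequentially"
      unfolding limitin_metric eventually_sequentially
    proof (intro conjI fl allI impI)
      fix e :: real assume "e > 0"
      then obtain N where "\<forall>n\<ge>N. sqrt (l2_nsq X (\<sigma> n - f)) \<le> e / 2"
        using lim[of "e / 2"] by auto
      then have "\<forall>n\<ge>N. \<sigma> n \<in> l2 X \<and> hdist (l2_space X) (\<sigma> n) f < e"
        using \<sigma> fl \<open>e > 0\<close> by (fastforce simp: l2_hdist)
      then show "\<exists>N. \<forall>n\<ge>N. \<sigma> n \<in> l2 X \<and> hdist (l2_space X) (\<sigma> n) f < e"
        by blast
    qed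
    then show ?thesis
      by blast
  qed
  then show ?thesis
    by (simp add: mcomplete_def)
qed

lemma l2_hilbert: "complex_hilbert_space (l2_space X)"
  unfolding complex_hilbert_space_def l2_space_simps
proof (intro conjI l2_module l2_complete ballI allI impI)
  fix f g h a assume f: "f \<in> l2 X" and g: "g \<in> l2 X"
  show "(\<Sum>\<^sub>\<infinity>x\<in>X. cnj (f x) * (g + h) x) = (\<Sum>\<^sub>\<infinity>x\<in>X. cnj (f x) * g x) + (\<Sum>\<^sub>\<infinity>x\<in>X. cnj (f x) * h x)"
    if h: "h \<in> l2 X"
    using f g h by (simp add: distrib_left infsum_add l2_inner_summable)
  show "(\<Sum>\<^sub>\<infinity>x\<in>X. cnj (f x) * (a * g x)) = a * (\<Sum>\<^sub>\<infinity>x\<in>X. cnj (f x) * g x)"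
    by (simp add: infsum_cmult_right' mult.left_commute)
  show "(\<Sum>\<^sub>\<infinity>x\<in>X. cnj (g x) * f x) = cnj (\<Sum>\<^sub>\<infinity>x\<in>X. cnj (f x) * g x)"
    by (simp add: infsum_cnj[symmetric] mult.commute)
next
  fix f assume "f \<in> l2 X" "f \<noteq> 0"
  then show "0 < Re (\<Sum>\<^sub>\<infinity>x\<in>X. cnj (f x) * f x)"
    using l2_nsq_eq_0[of f X] l2_nsq_nonneg[of X f] by (simp add: l2_inner_self)
qed

section \<open>Weighted permutation operators and closed invariant subspaces\<close>

definition l2_op :: "'i set \<Rightarrow> ('i \<Rightarrow> complex) \<Rightarrow> ('i \<Rightarrow> 'i) \<Rightarrow> ('i \<Rightarrow> complex) \<Rightarrow> 'i \<Rightarrow> complex" where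
  "l2_op X u p f = (\<lambda>x. if x \<in> X then u x * f (p x) else 0)"

lemma l2_op_closed:
  assumes "bij_betw p X X" "\<And>x. x \<in> X \<Longrightarrow> cmod (u x) = 1" "f \<in> l2 X"
  shows "l2_op X u p f \<in> l2 X"
proof -
  have "(\<lambda>x. (cmod (f (p x)))\<^sup>2) summable_on X"
    using assms(3) summable_on_reindex_bij_betw[OF assms(1), of "\<lambda>x. (cmod (f x))\<^sup>2"] by (simp add: l2_def)
  then have "(\<lambda>x. (cmod (l2_op X u p f x))\<^sup>2) summable_on X"
    by (rule summable_on_cong[THEN iffD1, rotated]) (simp add: l2_op_def norm_mult assms(2))
  then show ?thesis
    by (simp add: l2_def) (simp add: l2_op_def)
qed

lemma l2_op_unitary:
  assumes p: "bij_betw p X X" and u: "\<And>x. x \<in> X \<Longrightarrow> cmod (u x) = 1"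
  shows "unitary_operator (l2_space X) (l2_op X u p)"
  unfolding unitary_operator_def l2_space_simps
proof (intro conjI ballI allI)
  define q where "q = inv_into X p"
  have q: "bij_betw q X X"
    unfolding q_def by (rule bij_betw_inv_into[OF p])
  have pq: "p (q x) = x" "q (p x) = x" "p x \<in> X" "q x \<in> X" if "x \<in> X" for x
    using p q that by (auto simp: q_def bij_betw_inv_into_right bij_betw_inv_into_left bij_betw_apply)
  have uu: "cnj (u x) * u x = 1" if "x \<in> X" for x
    using u[OF that] by (metis complex_norm_square mult.commute of_real_1 power_one)
  show "bij_betw (l2_op X u p) (l2 X) (l2 X)"
  \<comment> \<open>The inverse pulls back along q, the inverse of p; at x it must undo the phase
    attached to \<open>q x\<close>, hence the conjugate of \<open>u (q x)\<close>.\<close>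
  proof (rule bij_betw_byWitness[where f' = "l2_op X (\<lambda>x. cnj (u (q x))) q"])
    show "\<forall>f\<in>l2 X. l2_op X (\<lambda>x. cnj (u (q x))) q (l2_op X u p f) = f"
      using pq uu by (auto simp: l2_op_def l2_outside fun_eq_iff mult.assoc[symmetric])
    show "\<forall>f\<in>l2 X. l2_op X u p (l2_op X (\<lambda>x. cnj (u (q x))) q f) = f"
      using pq uu by (auto simp: l2_op_def l2_outside fun_eq_iff mult.assoc[symmetric] mult.commute[of "u _"])
    show "l2_op X u p ` l2 X \<subseteq> l2 X" "l2_op X (\<lambda>x. cnj (u (q x))) q ` l2 X \<subseteq> l2 X"
      using l2_op_closed[OF p u] l2_op_closed[OF q, of "\<lambda>x. cnj (u (q x))"] u pq by auto
  qed
  fix f g a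
  show "l2_op X u p (f + g) = l2_op X u p f + l2_op X u p g"
    "l2_op X u p (\<lambda>x. a * f x) = (\<lambda>x. a * l2_op X u p f x)"
    by (auto simp: l2_op_def fun_eq_iff algebra_simps)
  have "cnj (u x * v) * (u x * w) = cnj v * w" if "x \<in> X" for x v w
    using uu[OF that] by (metis complex_cnj_mult mult.assoc mult.left_commute mult_1)
  then have "(\<Sum>\<^sub>\<infinity>x\<in>X. cnj (l2_op X u p f x) * l2_op X u p g x) = (\<Sum>\<^sub>\<infinity>x\<in>X. cnj (f (p x)) * g (p x))"
    by (intro infsum_cong) (simp add: l2_op_def)
  also have "\<dots> = (\<Sum>\<^sub>\<infinity>x\<in>X. cnj (f x) * g x)"
    by (rule infsum_reindex_bij_betw[OF p])
  finally show "(\<Sum>\<^sub>\<infinity>x\<in>X. cnj (l2_op X u p f x) * l2_op X u p g x) = (\<Sum>\<^sub>\<infinity>x\<in>X. cnj (f x) * g x)" .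
qed

text \<open>Closedness is given by open balls of the metric topology; this turns it into an
  approximation criterion in the squared norm, the quantity that finite sums control.\<close>

lemma l2_closed_approx:
  assumes W: "closed_subspace (l2_space X) W" and f: "f \<in> l2 X"
    and approx: "\<And>e. e > 0 \<Longrightarrow> \<exists>g\<in>W. l2_nsq X (f - g) \<le> e"
  shows "f \<in> W"
proof (rule ccontr)
  interpret Metric_space "l2 X" "hdist (l2_space X)"
    by (rule l2_metric)
  have cl: "closedin mtopology W" and sub: "W \<subseteq> l2 X"
    using W by (auto simp: closed_subspace_def)
  assume "f \<notin> W"
  then obtain r where r: "r > 0" "disjnt W (mball f r)"
    using cl f unfolding closedin_metric by blast
  \<comment> \<open>Radius r / 2 turns the non-strict estimate into membership in the open ball of
    radius r.\<close>
  obtain g where g: "g \<in> W" "l2_nsq X (f - g) \<le> (r / 2)\<^sup>2"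
    using approx[of "(r / 2)\<^sup>2"] r by auto
  then have "sqrt (l2_nsq X (f - g)) \<le> r / 2"
    using r by (intro real_le_lsqrt) auto
  then have "hdist (l2_space X) f g \<le> r / 2"
    using r by (simp add: l2_hdist)
  then have "g \<in> mball f r"
    using r sub f g by auto
  then show False
    using r g by (auto simp: disjnt_iff)
qed

text \<open>Choose F to carry all but e of the total mass. A finite G disjoint from F enlarges the
  partial sum, which still stays below the total.\<close>

lemma l2_tail_finite:
  assumes f: "f \<in> l2 X" and "e > 0"
  shows "\<exists>F. finite F \<and> F \<subseteq> X \<and> (\<forall>G. finite G \<longrightarrow> G \<subseteq> X - F \<longrightarrow> (\<Sum>x\<in>G. (cmod (f x))\<^sup>2) \<le> e)"
proof -
  obtain F where F: "finite F" "F \<subseteq> X" "dist (\<Sum>x\<in>F. (cmod (f x))\<^sup>2) (l2_nsq X f) \<le> e"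
    using infsum_finite_approximation[of "\<lambda>x. (cmod (f x))\<^sup>2" X e] assms
    unfolding l2_nsq_def l2_def by auto
  have "(\<Sum>x\<in>G. (cmod (f x))\<^sup>2) \<le> e" if G: "finite G" "G \<subseteq> X - F" for G
  proof -
    have "(\<Sum>x\<in>F. (cmod (f x))\<^sup>2) + (\<Sum>x\<in>G. (cmod (f x))\<^sup>2) = (\<Sum>x\<in>F \<union> G. (cmod (f x))\<^sup>2)"
      using F G by (intro sum.union_disjoint[symmetric]) auto
    also have "\<dots> \<le> l2_nsq X f"
      using F G by (intro l2_finite_sum_le f) auto
    finally show ?thesis
      using F(3) by (auto simp: dist_real_def)
  qed
  then show ?thesis
    using F by blast
qed

text \<open>Applied to two error terms g: that of truncation to F, and that of a vector damped by a
  multiplier of modulus at most 1. In both cases the error vanishes on the finite set and is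
  dominated by the tail of f elsewhere.\<close>

lemma l2_approx_off_finite:
  assumes "f \<in> l2 X" and "finite F" and g: "\<And>x. x \<notin> X \<Longrightarrow> g x = 0"
    and "\<And>x. x \<in> F \<Longrightarrow> g x = 0" "\<And>x. x \<in> X - F \<Longrightarrow> cmod (g x) \<le> cmod (f x)"
    and tail: "\<And>G. finite G \<Longrightarrow> G \<subseteq> X - F \<Longrightarrow> (\<Sum>x\<in>G. (cmod (f x))\<^sup>2) \<le> e"
  shows "l2_nsq X g \<le> e"
proof (rule l2_boundedI(2))
  fix G assume G: "finite G" "G \<subseteq> X"
  have "(\<Sum>x\<in>G. (cmod (g x))\<^sup>2) = (\<Sum>x\<in>G - F. (cmod (g x))\<^sup>2)"
    using G assms by (intro sum.mono_neutral_right) auto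
  also have "\<dots> \<le> (\<Sum>x\<in>G - F. (cmod (f x))\<^sup>2)"
    using G assms by (intro sum_mono power_mono) auto
  also have "\<dots> \<le> e"
    using G by (intro tail) auto
  finally show "(\<Sum>x\<in>G. (cmod (g x))\<^sup>2) \<le> e" .
qed (use g in auto)

definition l2_delta :: "'i \<Rightarrow> 'i \<Rightarrow> complex" where
  "l2_delta x = (\<lambda>y. if y = x then 1 else 0)"

lemma l2_delta_in: "x \<in> X \<Longrightarrow> l2_delta x \<in> l2 X"
  by (rule l2_boundedI(1)[where B = 1]) (auto simp: l2_delta_def if_distrib[of "\<lambda>z. (cmod z)\<^sup>2"] cong: if_cong)

lemma l2_full_subspace:
  assumes W: "closed_subspace (l2_space X) W" and d: "\<And>x. x \<in> X \<Longrightarrow> l2_delta x \<in> W"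
  shows "W = l2 X"
proof
  show "W \<subseteq> l2 X"
    using W by (simp add: closed_subspace_def)
  have fin: "(\<lambda>y. if y \<in> F then f y else 0) \<in> W" if "finite F" "F \<subseteq> X" for F f
    using that
  proof (induction rule: finite_induct)
    case empty
    then show ?case using W by (simp add: closed_subspace_def zero_fun_def)
  next
    case (insert x F)
    have "(\<lambda>y. f x * l2_delta x y) + (\<lambda>y. if y \<in> F then f y else 0) \<in> W"
      using insert W d[of x] by (simp add: closed_subspace_def)
    also have "(\<lambda>y. f x * l2_delta x y) + (\<lambda>y. if y \<in> F then f y else 0) = (\<lambda>y. if y \<in> insert x F then f y else 0)"
      using insert by (auto simp: l2_delta_def fun_eq_iff)
    finally show ?case .
  qed
  show "l2 X \<subseteq> W"
  proof
    fix f assume f: "f \<in> l2 X"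
    show "f \<in> W"
    proof (rule l2_closed_approx[OF W f])
      fix e :: real assume "e > 0"
      then obtain F where F: "finite F" "F \<subseteq> X"
        "\<And>G. finite G \<Longrightarrow> G \<subseteq> X - F \<Longrightarrow> (\<Sum>x\<in>G. (cmod (f x))\<^sup>2) \<le> e"
        using l2_tail_finite[OF f] by metis
      let ?g = "\<lambda>y. if y \<in> F then f y else 0"
      have "l2_nsq X (f - ?g) \<le> e"
        using F f by (intro l2_approx_off_finite[OF f F(1)]) (auto simp: l2_outside)
      then show "\<exists>g\<in>W. l2_nsq X (f - g) \<le> e"
        using fin[OF F(1,2)] by blast
    qed
  qed
qed

text \<open>
  If \<open>\<xi> y = - \<xi> x\<close>, averaging \<open>f\<close> with its multiple by \<open>\<xi> / \<xi> x\<close> keeps the coordinate at \<open>x\<close>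
  and kills the one at \<open>y\<close>, without increasing any other coordinate.
\<close>

lemma l2_irreducible:
  assumes W: "closed_subspace (l2_space X) W"
    and sep: "\<And>x y. x \<in> X \<Longrightarrow> y \<in> X \<Longrightarrow> x \<noteq> y \<Longrightarrow>
      \<exists>\<xi>. (\<forall>z\<in>X. cmod (\<xi> z) = 1) \<and> \<xi> y = - \<xi> x \<and> (\<forall>f\<in>W. (\<lambda>z. \<xi> z * f z) \<in> W)"
    and trans: "\<And>x y. x \<in> X \<Longrightarrow> y \<in> X \<Longrightarrow>
      \<exists>u p. (\<forall>z\<in>X. cmod (u z) = 1) \<and> inj_on p X \<and> p y = x \<and> l2_op X u p ` W \<subseteq> W"
  shows "W = {0} \<or> W = l2 X"
proof (cases "W = {0}")
  case False
  have 0: "0 \<in> W" and sub: "W \<subseteq> l2 X" and add: "\<And>f g. f \<in> W \<Longrightarrow> g \<in> W \<Longrightarrow> f + g \<in> W"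
    and scale: "\<And>a f. f \<in> W \<Longrightarrow> (\<lambda>x. a * f x) \<in> W"
    using W by (simp_all add: closed_subspace_def)
  obtain w x where w: "w \<in> W" "w x \<noteq> 0"
    using False 0 by (auto simp: fun_eq_iff) metis
  have wl: "w \<in> l2 X"
    using w sub by auto
  have x: "x \<in> X"
    using w wl l2_outside by metis
  \<comment> \<open>Multipliers preserving \<open>W\<close> replace projections: one averaging
    factor for each y in F gives a product that is 1 at x and 0 on F. The bound by 1 survives the
    induction, so the product cannot enlarge the tail of w however large F is.\<close>
  have mult: "\<exists>\<mu>. \<mu> x = 1 \<and> (\<forall>y\<in>F. \<mu> y = 0) \<and> (\<forall>z\<in>X. cmod (\<mu> z) \<le> 1) \<and> (\<forall>f\<in>W. (\<lambda>z. \<mu> z * f z) \<in> W)"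
    if "finite F" "F \<subseteq> X - {x}" for F
    using that
  proof (induction rule: finite_induct)
    case empty
    show ?case by (intro exI[of _ "\<lambda>_. 1"]) auto
  next
    case (insert y F)
    then obtain \<mu> where \<mu>: "\<mu> x = 1" "\<forall>y\<in>F. \<mu> y = 0" "\<forall>z\<in>X. cmod (\<mu> z) \<le> 1" "\<forall>f\<in>W. (\<lambda>z. \<mu> z * f z) \<in> W"
      by auto
    obtain \<xi> where \<xi>: "\<forall>z\<in>X. cmod (\<xi> z) = 1" "\<xi> y = - \<xi> x" "\<forall>f\<in>W. (\<lambda>z. \<xi> z * f z) \<in> W"
      using sep[of x y] x insert by auto
    have "\<xi> x \<noteq> 0"
      using \<xi>(1) x by force
    let ?\<nu> = "\<lambda>z. (1 + \<xi> z / \<xi> x) / 2 * \<mu> z"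
    have "cmod (?\<nu> z) \<le> 1" if "z \<in> X" for z
    proof -
      have "cmod ((1 + \<xi> z / \<xi> x) / 2) \<le> 1"
        using norm_triangle_ineq[of 1 "\<xi> z / \<xi> x"] \<xi>(1) x that by (simp add: norm_divide)
      then show ?thesis
        using \<mu>(3) that by (simp only: norm_mult mult_le_one norm_ge_zero)
    qed
    moreover have "(\<lambda>z. ?\<nu> z * f z) \<in> W" if "f \<in> W" for f
    proof -
      have "(\<lambda>z. 1/2 * (\<mu> z * f z)) + (\<lambda>z. 1 / (2 * \<xi> x) * (\<xi> z * (\<mu> z * f z))) \<in> W"
        using that \<mu>(4) \<xi>(3) by (intro add scale) auto
      also have "(\<lambda>z. 1/2 * (\<mu> z * f z)) + (\<lambda>z. 1 / (2 * \<xi> x) * (\<xi> z * (\<mu> z * f z))) = (\<lambda>z. ?\<nu> z * f z)"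
        using \<open>\<xi> x \<noteq> 0\<close> by (auto simp: fun_eq_iff field_simps)
      finally show ?thesis .
    qed
    ultimately show ?case
      using \<mu> \<xi> \<open>\<xi> x \<noteq> 0\<close> by (intro exI[of _ ?\<nu>]) auto
  qed
  have "(\<lambda>y. w x * l2_delta x y) \<in> W"
  proof (rule l2_closed_approx[OF W])
    show "(\<lambda>y. w x * l2_delta x y) \<in> l2 X"
      by (intro l2_scale l2_delta_in x)
    fix e :: real assume "e > 0"
    then obtain F where F: "finite F" "F \<subseteq> X"
      "\<And>G. finite G \<Longrightarrow> G \<subseteq> X - F \<Longrightarrow> (\<Sum>x\<in>G. (cmod (w x))\<^sup>2) \<le> e"
      using l2_tail_finite[OF wl] by metis
    obtain \<mu> where \<mu>: "\<mu> x = 1" "\<forall>y\<in>F - {x}. \<mu> y = 0" "\<forall>z\<in>X. cmod (\<mu> z) \<le> 1" "\<forall>f\<in>W. (\<lambda>z. \<mu> z * f z) \<in> W"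
      using mult[of "F - {x}"] F by auto
    \<comment> \<open>On \<open>insert x F\<close> both vectors agree, because \<open>\<mu>\<close>
      is 1 at x and 0 on the rest of F; elsewhere only the damped tail of w is left.\<close>
    have "l2_nsq X ((\<lambda>y. w x * l2_delta x y) - (\<lambda>z. \<mu> z * w z)) \<le> e"
    proof (rule l2_approx_off_finite[OF wl, of "insert x F"])
      show "cmod (((\<lambda>y. w x * l2_delta x y) - (\<lambda>z. \<mu> z * w z)) y) \<le> cmod (w y)" if "y \<in> X - insert x F" for y
        using that \<mu>(3) by (auto simp: l2_delta_def norm_mult mult_left_le_one_le)
      show "(\<Sum>x\<in>G. (cmod (w x))\<^sup>2) \<le> e" if "finite G" "G \<subseteq> X - insert x F" for G
        using that by (intro F(3)) auto
    qed (use F \<mu> wl x in \<open>auto simp: l2_delta_def l2_outside\<close>)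
    then show "\<exists>g\<in>W. l2_nsq X ((\<lambda>y. w x * l2_delta x y) - g) \<le> e"
      using \<mu>(4) w by blast
  qed
  from scale[OF this, of "1 / w x"] have dx: "l2_delta x \<in> W"
    using w by simp
  have "l2_delta y \<in> W" if y: "y \<in> X" for y
  proof -
    obtain u p where u: "\<forall>z\<in>X. cmod (u z) = 1" "inj_on p X" "p y = x" "l2_op X u p ` W \<subseteq> W"
      using trans[OF x y] by blast
    have "(\<lambda>z. 1 / u y * l2_op X u p (l2_delta x) z) \<in> W"
      using u dx by (intro scale) auto
    \<comment> \<open>Injectivity of p leaves y as the only point that p sends to x.\<close>
    also have "(\<lambda>z. 1 / u y * l2_op X u p (l2_delta x) z) = l2_delta y"
      using u y by (force simp: l2_op_def l2_delta_def fun_eq_iff inj_on_def)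
    finally show ?thesis .
  qed
  then show ?thesis
    using l2_full_subspace[OF W] by blast
qed simp

section \<open>Irreducible projective representations from skew forms\<close>

definition e2pi :: "real \<Rightarrow> complex" where
  "e2pi t = exp (2 * of_real pi * \<i> * of_real t)"

lemma e2pi_add: "e2pi (s + t) = e2pi s * e2pi t"
  by (simp add: e2pi_def distrib_left exp_add)

lemma norm_e2pi: "cmod (e2pi t) = 1"
  by (simp add: e2pi_def norm_exp_eq_Re)

lemma e2pi_half: "e2pi (1 / 2) = - 1"
  by (simp add: e2pi_def)

text \<open>Scaling is an explicit operation \<open>sc\<close> on a subset of an additive group.
  Linearity is asked in the first argument only; skew symmetry transports it to the second.\<close>

locale skew_form =
  fixes V :: "'g::ab_group_add set" and s :: "'g \<Rightarrow> 'g \<Rightarrow> real" and sc :: "real \<Rightarrow> 'g \<Rightarrow> 'g"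
  assumes zero_V: "0 \<in> V"
    and add_V: "a \<in> V \<Longrightarrow> b \<in> V \<Longrightarrow> a + b \<in> V"
    and uminus_V: "a \<in> V \<Longrightarrow> - a \<in> V"
    and sc_V: "a \<in> V \<Longrightarrow> sc t a \<in> V"
    and s_add: "a \<in> V \<Longrightarrow> b \<in> V \<Longrightarrow> c \<in> V \<Longrightarrow> s (a + b) c = s a c + s b c"
    and s_skew: "a \<in> V \<Longrightarrow> b \<in> V \<Longrightarrow> s a b = - s b a"
    and s_sc: "a \<in> V \<Longrightarrow> b \<in> V \<Longrightarrow> s (sc t a) b = t * s a b"
begin

lemma diff_V: "a \<in> V \<Longrightarrow> b \<in> V \<Longrightarrow> a - b \<in> V"
  using add_V[of a "- b"] uminus_V by simp

lemma s_self: "a \<in> V \<Longrightarrow> s a a = 0"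
  using s_skew[of a a] by linarith

lemma s_diff: "a \<in> V \<Longrightarrow> b \<in> V \<Longrightarrow> c \<in> V \<Longrightarrow> s (a - b) c = s a c - s b c"
  using s_add[of "a - b" b c] diff_V by simp

lemma s_add_right: "a \<in> V \<Longrightarrow> b \<in> V \<Longrightarrow> c \<in> V \<Longrightarrow> s c (a + b) = s c a + s c b"
  using s_add s_skew add_V by (metis minus_add_distrib)

text \<open>Zorn's lemma runs over isotropic subsets rather than subspaces, so unions of chains are
  immediate, and the linear structure is recovered afterwards from the annihilator equation. A
  vector orthogonal to \<open>L\<close> can be adjoined since skew symmetry makes it orthogonal to
  itself.\<close>

lemma maximal_isotropic: "\<exists>L\<subseteq>V. \<forall>a\<in>V. a \<in> L \<longleftrightarrow> (\<forall>b\<in>L. s a b = 0)"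
proof -
  define A where "A = {L. L \<subseteq> V \<and> (\<forall>a\<in>L. \<forall>b\<in>L. s a b = 0)}"
  have "\<exists>L\<in>A. \<forall>K\<in>A. L \<subseteq> K \<longrightarrow> K = L"
  proof (rule subset_Zorn')
    fix C assume C: "subset.chain A C"
    have "s a b = 0" if "a \<in> \<Union>C" "b \<in> \<Union>C" for a b
    proof -
      obtain K K' where "K \<in> C" "a \<in> K" "K' \<in> C" "b \<in> K'"
        using \<open>a \<in> \<Union>C\<close> \<open>b \<in> \<Union>C\<close> by blast
      moreover have "K \<subseteq> K' \<or> K' \<subseteq> K" "K \<in> A" "K' \<in> A"
        using C calculation by (auto simp: subset_chain_def)
      ultimately show ?thesis
        unfolding A_def by blast
    qed
    then show "\<Union>C \<in> A"
      using C by (auto simp: subset_chain_def A_def)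
  qed
  then obtain L where L: "L \<in> A" "\<And>K. K \<in> A \<Longrightarrow> L \<subseteq> K \<Longrightarrow> K = L"
    by blast
  have "a \<in> L" if "a \<in> V" "\<forall>b\<in>L. s a b = 0" for a
  proof -
    have "s b a = 0" if b: "b \<in> L" for b
      using L(1)[unfolded A_def] b \<open>a \<in> V\<close> \<open>\<forall>b\<in>L. s a b = 0\<close> s_skew[of b a] by auto
    then have "insert a L \<in> A"
      using that L(1) s_self by (auto simp: A_def)
    then show ?thesis
      using L(2) by blast
  qed
  then show ?thesis
    using L(1) unfolding A_def by blast
qed

end

section \<open>The induced representation on the cosets of a self-annihilating
  \<open>L\<close>\<close>

locale polarization = skew_form +
  fixes L
  assumes L_V: "L \<subseteq> V" and L_perp: "a \<in> V \<Longrightarrow> a \<in> L \<longleftrightarrow> (\<forall>b\<in>L. s a b = 0)"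
begin

definition coset :: "'a \<Rightarrow> 'a set" where
  "coset v = (+) v ` L"

definition cosets :: "'a set set" where
  "cosets = coset ` V"

text \<open>The choice of representatives is not additive; the defect always lies in
  \<open>L\<close>, and \<open>phase\<close> absorbs it.\<close>

definition repr :: "'a set \<Rightarrow> 'a" where
  "repr x = (SOME v. v \<in> V \<and> coset v = x)"

definition shift :: "'a \<Rightarrow> 'a set \<Rightarrow> 'a set" where
  "shift f x = coset (repr x + f)"

text \<open>
  The induced representation acts by \<open>(f \<phi>)(v) = e(s(v,f)) \<phi>(v + f)\<close> on functions with
  \<open>\<phi>(v + l) = e(s(v,l)) \<phi>(v)\<close> for \<open>l\<close> in \<open>L\<close>, where \<open>e(t)\<close> is \<open>e2pi t\<close>. Such a function is
  determined by its values at the chosen representatives of the cosets, which leads to this phase.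
\<close>

definition phase :: "'a set \<Rightarrow> 'a \<Rightarrow> real" where
  "phase x f = s (repr x) f + s (repr (shift f x)) (repr x + f)"

definition rep :: "'a \<Rightarrow> ('a set \<Rightarrow> complex) \<Rightarrow> 'a set \<Rightarrow> complex" where
  "rep f = l2_op cosets (\<lambda>x. e2pi (phase x f)) (shift f)"

lemma L_zero: "0 \<in> L"
proof -
  have "s 0 b = 0" if "b \<in> V" for b
    using s_add[of 0 0 b] zero_V that by simp
  then show ?thesis
    using L_V L_perp zero_V by blast
qed

lemma L_add: "a \<in> L \<Longrightarrow> b \<in> L \<Longrightarrow> a + b \<in> L"
  using L_perp[of a] L_perp[of b] L_perp[of "a + b"] L_V s_add[of a b] add_V by (simp add: subset_iff)

lemma L_diff: "a \<in> L \<Longrightarrow> b \<in> L \<Longrightarrow> a - b \<in> L"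
  using L_perp[of a] L_perp[of b] L_perp[of "a - b"] L_V s_diff[of a b] diff_V by (simp add: subset_iff)

text \<open>\<open>L_perp\<close> is an equation in the reals, not modulo integers, so it survives
  every real factor. The normalisation in \<open>rep_irreducible\<close> depends on this.\<close>

lemma L_sc: "a \<in> L \<Longrightarrow> sc t a \<in> L"
  using L_perp[of a] L_perp[of "sc t a"] L_V s_sc[of a] sc_V by (simp add: subset_iff)

lemma s_L: "a \<in> L \<Longrightarrow> b \<in> L \<Longrightarrow> s a b = 0"
  using L_perp L_V by blast

lemma coset_eq_iff: "v \<in> V \<Longrightarrow> w \<in> V \<Longrightarrow> coset v = coset w \<longleftrightarrow> v - w \<in> L"
proof
  assume "coset v = coset w"
  then have "v \<in> coset w"
    using L_zero by (force simp: coset_def)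
  then show "v - w \<in> L"
    by (auto simp: coset_def)
next
  have sub: "coset v \<subseteq> coset w" if "v - w \<in> L" for v w
  proof
    fix u assume "u \<in> coset v"
    then obtain l where "l \<in> L" "u = v + l"
      by (auto simp: coset_def)
    then have "u = w + ((v - w) + l)" "(v - w) + l \<in> L"
      using L_add that by auto
    then show "u \<in> coset w"
      unfolding coset_def by blast
  qed
  assume *: "v - w \<in> L"
  then have "w - v \<in> L"
    using L_diff[OF L_zero *] by simp
  then show "coset v = coset w"
    using sub * by blast
qed

lemma coset_in: "v \<in> V \<Longrightarrow> coset v \<in> cosets"
  by (simp add: cosets_def)

lemma repr:
  assumes "x \<in> cosets"
  shows "repr x \<in> V" "coset (repr x) = x"
proof -
  have "\<exists>v. v \<in> V \<and> coset v = x"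
    using assms by (auto simp: cosets_def)
  from someI_ex[OF this] show "repr x \<in> V" "coset (repr x) = x"
    by (simp_all add: repr_def)
qed

lemma repr_coset: "v \<in> V \<Longrightarrow> repr (coset v) - v \<in> L"
  using coset_eq_iff repr coset_in by metis

lemma shift_in: "f \<in> V \<Longrightarrow> x \<in> cosets \<Longrightarrow> shift f x \<in> cosets"
  unfolding shift_def by (intro coset_in add_V repr)

lemma repr_shift: "f \<in> V \<Longrightarrow> x \<in> cosets \<Longrightarrow> repr (shift f x) - (repr x + f) \<in> L"
  unfolding shift_def by (intro repr_coset add_V repr)

lemma shift_shift:
  assumes "f \<in> V" "g \<in> V" "x \<in> cosets"
  shows "shift g (shift f x) = shift (f + g) x"
proof -
  have "repr (shift f x) + g - (repr x + (f + g)) \<in> L"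
    using repr_shift[of f x] assms by (simp add: algebra_simps)
  then show ?thesis
    using assms repr shift_in add_V by (simp add: shift_def[of g] shift_def[of "f + g"] coset_eq_iff)
qed

lemma shift_L:
  assumes "l \<in> L" "x \<in> cosets"
  shows "shift l x = x"
proof -
  have "coset (repr x + l) = coset (repr x)"
    using assms repr L_V add_V by (subst coset_eq_iff) auto
  then show ?thesis
    using assms repr by (simp add: shift_def)
qed

lemma bij_shift: "f \<in> V \<Longrightarrow> bij_betw (shift f) cosets cosets"
proof (rule bij_betw_byWitness[where f' = "shift (- f)"])
  assume f: "f \<in> V"
  show "\<forall>x\<in>cosets. shift (- f) (shift f x) = x" "\<forall>x\<in>cosets. shift f (shift (- f) x) = x"
    using shift_shift[OF f uminus_V[OF f]] shift_shift[OF uminus_V[OF f] f] shift_L[OF L_zero] by simp_all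
  show "shift f ` cosets \<subseteq> cosets" "shift (- f) ` cosets \<subseteq> cosets"
    using shift_in[OF f] shift_in[OF uminus_V[OF f]] by blast+
qed

text \<open>The representatives after one and two shifts miss the true translates by l and m in
  \<open>L\<close>. After bilinear expansion the terms containing l or m cancel in skew pairs or
  vanish because \<open>s\<close> is 0 on \<open>L\<close>; the only term left is
  \<open>s f g\<close>.\<close>

lemma phase_cocycle:
  assumes f: "f \<in> V" and g: "g \<in> V" and x: "x \<in> cosets"
  shows "phase x f + phase (shift f x) g = s f g + phase x (f + g)"
proof -
  define a b c where "a = repr x" and "b = repr (shift f x)" and "c = repr (shift (f + g) x)"
  have V: "a \<in> V" "b \<in> V" "c \<in> V"
    using repr shift_in assms add_V by (auto simp: a_def b_def c_def)
  define l m where "l = b - (a + f)" and "m = c - (b + g)"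
  have l: "l \<in> L"
    using repr_shift[OF f x] by (simp add: l_def a_def b_def)
  have m: "m \<in> L"
    using repr_shift[OF g, of "shift f x"] assms shift_in by (simp add: m_def b_def c_def shift_shift)
  have lm: "l \<in> V" "m \<in> V"
    using l m L_V by auto
  have b: "b = a + f + l"
    by (simp add: l_def)
  have c: "c = b + g + m"
    by (simp add: m_def)
  have "s l m = 0" "s f f = 0" "s g g = 0" "s a a = 0" "s l l = 0"
    using s_L l m s_self assms V lm by auto
  moreover have "s l f = - s f l" "s l a = - s a l" "s g l = - s l g" "s g f = - s f g" "s g a = - s a g"
    "s m a = - s a m" "s m f = - s f m" "s m g = - s g m" "s m l = - s l m" "s f a = - s a f"
    by (rule s_skew; fact)+
  ultimately show ?thesis
    using assms V lm
    unfolding phase_def shift_shift[OF f g x] a_def[symmetric] b_def[symmetric] c_def[symmetric]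
    unfolding c b
    by (simp add: s_add s_add_right add_V)
qed

text \<open>Operators are pullbacks, so the outer one shifts first: the exponent to compare is
  \<open>phase x f + phase (shift f x) g\<close>.\<close>

lemma rep_compose:
  assumes "f \<in> V" "g \<in> V"
  shows "rep f (rep g \<psi>) = (\<lambda>x. e2pi (s f g) * rep (f + g) \<psi> x)"
proof
  fix x
  show "rep f (rep g \<psi>) x = e2pi (s f g) * rep (f + g) \<psi> x"
    using phase_cocycle[OF assms, of x] shift_shift[OF assms, of x] shift_in[OF assms(1)]
    by (simp add: rep_def l2_op_def mult.assoc[symmetric] e2pi_add[symmetric])
qed

text \<open>The operator sees f only through the functional \<open>s f\<close>. A difference in the
  radical lies in \<open>L\<close>, so it moves no coset, and the two phases agree as well. This is
  what lets the representation descend to a quotient.\<close>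

lemma rep_radical:
  assumes "f \<in> V" "g \<in> V" "\<forall>b\<in>V. s f b = s g b"
  shows "rep f = rep g"
proof -
  have fg: "f - g \<in> L"
    using L_perp[of "f - g"] assms s_diff L_V diff_V by auto
  have shift: "shift f x = shift g x" if "x \<in> cosets" for x
    using that assms fg repr add_V by (simp add: shift_def coset_eq_iff)
  have "s b f = s b g" if "b \<in> V" for b
    using assms s_skew that by metis
  then have "phase x f = phase x g" if "x \<in> cosets" for x
    using that assms repr shift_in by (simp add: phase_def shift s_add_right)
  then show ?thesis
    using shift by (auto simp: rep_def l2_op_def fun_eq_iff)
qed

text \<open>One summand \<open>s (repr x) l\<close> comes from the action itself, the other from
  returning from \<open>repr x + l\<close> to the representative; hence the factor 2.\<close>

lemma rep_L:
  assumes "l \<in> L" "x \<in> cosets"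
  shows "rep l \<psi> x = e2pi (2 * s (repr x) l) * \<psi> x"
  using assms L_V repr[of x] s_self[of "repr x"]
  by (simp add: rep_def l2_op_def phase_def shift_L subset_iff s_add_right)

lemma rep_irreducible:
  assumes W: "closed_subspace (l2_space cosets) W" and inv: "\<And>f. f \<in> V \<Longrightarrow> rep f ` W \<subseteq> W"
  shows "W = {0} \<or> W = l2 cosets"
proof (rule l2_irreducible[OF W])
  fix x y assume x: "x \<in> cosets" and y: "y \<in> cosets"
  show "\<exists>u p. (\<forall>z\<in>cosets. cmod (u z) = 1) \<and> inj_on p cosets \<and> p y = x \<and> l2_op cosets u p ` W \<subseteq> W"
  proof (intro exI conjI)
    let ?f = "repr x - repr y"
    have f: "?f \<in> V"
      using x y repr diff_V by auto
    show "inj_on (shift ?f) cosets"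
      using bij_shift[OF f] by (rule bij_betw_imp_inj_on)
    show "shift ?f y = x"
      using x repr by (simp add: shift_def)
    show "l2_op cosets (\<lambda>z. e2pi (phase z ?f)) (shift ?f) ` W \<subseteq> W"
      using inv[OF f] by (simp add: rep_def)
  qed (simp add: norm_e2pi)
  assume "x \<noteq> y"
  then have "repr y - repr x \<notin> L"
    using coset_eq_iff[of "repr y" "repr x"] repr x y by auto
  then obtain l where l: "l \<in> L" "s (repr y - repr x) l \<noteq> 0"
    using L_perp[of "repr y - repr x"] diff_V repr x y by blast
  \<comment> \<open>The eigenvalue of \<open>rep m\<close> at z is
    \<open>e2pi (2 * s (repr z) m)\<close>. A difference of 1/4 between y and x thus becomes 1/2 in
    the exponent, and the two eigenvalues are opposite.\<close>
  define m where "m = sc (1 / (4 * s (repr y - repr x) l)) l"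
  have m: "m \<in> L" "m \<in> V" "l \<in> V"
    using l L_sc L_V by (auto simp: m_def)
  have "s (repr y - repr x) m = - s m (repr y - repr x)"
    using m diff_V repr x y by (intro s_skew) auto
  also have "\<dots> = - (1 / (4 * s (repr y - repr x) l) * s l (repr y - repr x))"
    unfolding m_def using m diff_V repr x y by (subst s_sc) auto
  also have "s l (repr y - repr x) = - s (repr y - repr x) l"
    using m diff_V repr x y by (intro s_skew) auto
  finally have "s (repr y - repr x) m = 1 / 4"
    using l by simp
  then have half: "2 * s (repr y) m = 2 * s (repr x) m + 1 / 2"
    using s_diff[of "repr y" "repr x" m] repr x y m by simp
  show "\<exists>\<xi>. (\<forall>z\<in>cosets. cmod (\<xi> z) = 1) \<and> \<xi> y = - \<xi> x \<and> (\<forall>f\<in>W. (\<lambda>z. \<xi> z * f z) \<in> W)"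
  proof (intro exI conjI ballI)
    show "e2pi (2 * s (repr y) m) = - e2pi (2 * s (repr x) m)"
      unfolding half by (simp only: e2pi_add e2pi_half) simp
    fix f assume f: "f \<in> W"
    then have "f \<in> l2 cosets"
      using W by (auto simp: closed_subspace_def)
    then have "rep m f = (\<lambda>z. e2pi (2 * s (repr z) m) * f z)"
      using rep_L[OF m(1)] by (auto simp: fun_eq_iff l2_outside rep_def l2_op_def)
    then show "(\<lambda>z. e2pi (2 * s (repr z) m) * f z) \<in> W"
      using inv[OF m(2)] f by auto
  qed (simp add: norm_e2pi)
qed

lemma rep_unitary: "f \<in> V \<Longrightarrow> unitary_operator (l2_space cosets) (rep f)"
  unfolding rep_def by (intro l2_op_unitary bij_shift) (simp_all add: norm_e2pi)

lemma l2_cosets_nonzero: "l2 cosets \<noteq> {0}"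
proof -
  have "l2_delta (coset 0) \<in> l2 cosets" "l2_delta (coset 0) \<noteq> 0"
    using l2_delta_in[OF coset_in[OF zero_V]] by (auto simp: l2_delta_def fun_eq_iff)
  then show ?thesis
    by auto
qed

end

lemma exp_2pi_i_to_R_mod_Z: "exp_2pi_i (to_R_mod_Z r) = e2pi r"
proof -
  have "to_R_mod_Z r = (\<lambda>n. of_int n + r) ` UNIV"
    by (auto simp: to_R_mod_Z_def r_coset_def additive_group_def Ints_def)
  moreover have "e2pi (of_int n + r) = e2pi r" for n
    by (simp add: e2pi_add) (simp add: e2pi_def mult.commute mult.left_commute exp_integer_2pi)
  ultimately have "(\<lambda>r. exp (2 * of_real pi * \<i> * of_real r)) ` to_R_mod_Z r = {e2pi r}"
    by (auto simp: e2pi_def)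
  then show ?thesis
    by (simp add: exp_2pi_i_def)
qed

text \<open>Elements of the quotient and cosets of \<open>L\<close> are both subsets of
  \<open>V\<close>, so the \<open>l2\<close> space of the cosets has the required type. Since
  \<open>N\<close> lies in the radical of \<open>s\<close>, operators and cocycle depend only on the
  classes.\<close>

theorem (in skew_form) projective_rep_of_quotient:
  assumes N: "N \<subseteq> V" "N \<noteq> {}" "\<And>a b. a \<in> N \<Longrightarrow> b \<in> V \<Longrightarrow> s a b = 0"
  shows "\<exists>(H :: ('g set \<Rightarrow> complex) cinner_space) \<rho>.
    projective_unitary_rep (additive_group V Mod N)
      (\<lambda>A B. exp_2pi_i (\<Union>a\<in>A. \<Union>b\<in>B. to_R_mod_Z (s a b))) H \<rho> \<and>
    irreducible_rep (additive_group V Mod N) H \<rho>"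
proof -
  obtain L where "L \<subseteq> V" "\<forall>a\<in>V. a \<in> L \<longleftrightarrow> (\<forall>b\<in>L. s a b = 0)"
    using maximal_isotropic by blast
  then interpret P: polarization V s sc L
    by unfold_locales auto
  let ?G = "additive_group V Mod N"
  let ?c = "\<lambda>A B. exp_2pi_i (\<Union>a\<in>A. \<Union>b\<in>B. to_R_mod_Z (s a b))"
  \<comment> \<open>All members of A induce the same functional as a; membership of a in A is not
    part of it. This is enough to determine the operator and the cocycle, and it is compatible with
    products of sets.\<close>
  define represents where
    "represents A a \<longleftrightarrow> a \<in> V \<and> A \<noteq> {} \<and> A \<subseteq> V \<and> (\<forall>a'\<in>A. \<forall>b\<in>V. s a' b = s a b)" for A a
  define \<rho> where "\<rho> A = P.rep (SOME a. represents A a)" for A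
  have \<rho>: "\<rho> A = P.rep a" if "represents A a" for A a
  proof -
    define a' where "a' = (SOME a. represents A a)"
    have a': "represents A a'"
      unfolding a'_def using that by (rule someI)
    obtain a0 where "a0 \<in> A"
      using a' by (auto simp: represents_def)
    then have "s a' b = s a b" if "b \<in> V" for b
      using a' \<open>represents A a\<close> that by (simp add: represents_def) metis
    then have "P.rep a' = P.rep a"
      using a' that by (intro P.rep_radical) (auto simp: represents_def)
    then show ?thesis
      by (simp add: \<rho>_def a'_def)
  qed
  have coset: "represents (N #>\<^bsub>additive_group V\<^esub> a) a" if "a \<in> V" for a
    using that N add_V by (auto simp: represents_def r_coset_def additive_group_def s_add subset_iff)
  have carrier: "\<exists>a\<in>V. represents A a" if "A \<in> carrier ?G" for A
    using that coset by (auto simp: FactGroup_def RCOSETS_def additive_group_def)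
  have in_carrier: "\<exists>A\<in>carrier ?G. represents A a" if "a \<in> V" for a
    using that coset by (auto simp: FactGroup_def RCOSETS_def additive_group_def)
  have mult: "represents (A \<otimes>\<^bsub>?G\<^esub> B) (a + b)" if "represents A a" "represents B b" for A B a b
    using that add_V
    by (fastforce simp: represents_def FactGroup_def set_mult_def additive_group_def s_add subset_iff)
  have c: "?c A B = e2pi (s a b)" if "represents A a" "represents B b" for A B a b
  proof -
    have "s a' b' = s a b" if "a' \<in> A" "b' \<in> B" for a' b'
    proof -
      have *: "a \<in> V" "b \<in> V" "a' \<in> V" "b' \<in> V" "s a' b' = s a b'" "s b' a = s b a"
        using that \<open>represents A a\<close> \<open>represents B b\<close> by (auto simp: represents_def)
      then show ?thesis
        by (metis s_skew)
    qed
    then have "(\<Union>a\<in>A. \<Union>b\<in>B. to_R_mod_Z (s a b)) = to_R_mod_Z (s a b)"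
      using that by (auto simp: represents_def)
    then show ?thesis
      by (simp add: exp_2pi_i_to_R_mod_Z)
  qed
  have "projective_unitary_rep ?G ?c (l2_space P.cosets) \<rho>"
    unfolding projective_unitary_rep_def
  proof (intro conjI ballI l2_hilbert)
    fix A B assume "A \<in> carrier ?G" "B \<in> carrier ?G"
    then obtain a b where *: "a \<in> V" "b \<in> V" "represents A a" "represents B b"
      using carrier by metis
    then show "cmod (?c A B) = 1"
      by (simp add: c norm_e2pi)
    show "\<rho> A (\<rho> B x) = ?c A B \<odot>\<^bsub>l2_space P.cosets\<^esub> \<rho> (A \<otimes>\<^bsub>?G\<^esub> B) x" for x
      unfolding \<rho>[OF mult[OF *(3,4)]] \<rho>[OF *(3)] \<rho>[OF *(4)] c[OF *(3,4)] P.rep_compose[OF *(1,2)]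
      by simp
  next
    fix A assume "A \<in> carrier ?G"
    then show "unitary_operator (l2_space P.cosets) (\<rho> A)"
      using carrier[of A] \<rho>[of A] P.rep_unitary by auto
  qed
  moreover have "irreducible_rep ?G (l2_space P.cosets) \<rho>"
    unfolding irreducible_rep_def l2_space_simps
  proof (intro conjI allI impI P.l2_cosets_nonzero)
    fix W assume W: "closed_subspace (l2_space P.cosets) W \<and> (\<forall>A\<in>carrier ?G. \<rho> A ` W \<subseteq> W)"
    have "P.rep f ` W \<subseteq> W" if "f \<in> V" for f
      using in_carrier[OF that] W \<rho> by metis
    then show "W = {0} \<or> W = l2 P.cosets"
      using W P.rep_irreducible by blast
  qed
  ultimately show ?thesis
    by blast
qed

section \<open>Smooth functions\<close>

lemma frechet_derivative_cong_open:
  assumes "open S" "x \<in> S" "\<And>y. y \<in> S \<Longrightarrow> f y = g y"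
  shows "frechet_derivative f (at x) = frechet_derivative g (at x)"
proof -
  have "(f has_derivative D) (at x) \<longleftrightarrow> (g has_derivative D) (at x)" for D
    using assms has_derivative_transform_within_open by metis
  then show ?thesis
    by (simp add: frechet_derivative_def)
qed

lemma C_on_cong:
  assumes "open S" "\<And>x. x \<in> S \<Longrightarrow> f x = g x" "C_on m S f"
  shows "C_on m S g"
  using assms(2,3)
proof (induction m arbitrary: f g)
  case 0
  then show ?case by (simp cong: continuous_on_cong)
next
  case (Suc m)
  have "g differentiable (at x)" if x: "x \<in> S" for x
  proof -
    obtain D where "(f has_derivative D) (at x)"
      using Suc.prems(2) x \<open>open S\<close> by (auto simp: differentiable_on_eq_differentiable_at differentiable_def)
    then have "(g has_derivative D) (at x)"
      by (rule has_derivative_transform_within_open[OF _ \<open>open S\<close> x]) (use Suc.prems in auto)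
    then show ?thesis
      by (rule differentiableI)
  qed
  moreover have "C_on m S (\<lambda>x. frechet_derivative g (at x) v)" for v
  proof (rule Suc.IH)
    show "frechet_derivative f (at x) v = frechet_derivative g (at x) v" if "x \<in> S" for x
      using frechet_derivative_cong_open[OF \<open>open S\<close> that, of f g] Suc.prems(1) by simp
  qed (use Suc.prems in simp)
  ultimately show ?case
    by (simp add: differentiable_at_imp_differentiable_on)
qed

text \<open>Replaces \<open>frechet_derivative\<close> by an explicit formula, so that the closure
  properties below go by induction on m with the usual differentiation rules.\<close>

lemma C_on_SucI:
  assumes "\<And>x. x \<in> S \<Longrightarrow> (f has_derivative f' x) (at x)" "\<And>v. C_on m S (\<lambda>x. f' x v)" "open S"
  shows "C_on (Suc m) S f"
proof -
  have "f differentiable_on S"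
    using assms(1) by (meson differentiableI differentiable_at_imp_differentiable_on)
  moreover have "C_on m S (\<lambda>x. frechet_derivative f (at x) v)" for v
  proof (rule C_on_cong[OF \<open>open S\<close> _ assms(2)[of v]])
    show "f' x v = frechet_derivative f (at x) v" if "x \<in> S" for x
      using frechet_derivative_at[OF assms(1)[OF that]] by simp
  qed
  ultimately show ?thesis
    by simp
qed

lemma C_on_has_derivative:
  assumes "open S" "C_on (Suc m) S f" "x \<in> S"
  shows "(f has_derivative frechet_derivative f (at x)) (at x)"
  using assms by (simp add: differentiable_on_eq_differentiable_at frechet_derivative_works)

lemma C_on_Suc_imp: "C_on (Suc m) S f \<Longrightarrow> C_on m S f"
  by (induction m arbitrary: f) (auto intro: differentiable_imp_continuous_on)

text \<open>Derivatives are local, and the same neighbourhood serves one order lower. Meant for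
  functions glued from pieces, such as the bump functions.\<close>

lemma C_on_local:
  assumes "\<And>x. x \<in> S \<Longrightarrow> \<exists>U. open U \<and> x \<in> U \<and> C_on m U f"
  shows "C_on m S f"
  using assms
proof (induction m arbitrary: f)
  case 0
  have "isCont f x" if "x \<in> S" for x
    using 0[OF that] by (auto simp: continuous_on_eq_continuous_at)
  then show ?case
    by (simp add: continuous_at_imp_continuous_on)
next
  case (Suc m)
  have "f differentiable (at x)" if "x \<in> S" for x
    using Suc.prems[OF that] by (auto simp: differentiable_on_eq_differentiable_at)
  then have "f differentiable_on S"
    by (simp add: differentiable_at_imp_differentiable_on)
  moreover have "C_on m S (\<lambda>x. frechet_derivative f (at x) v)" for v
    using Suc.prems by (intro Suc.IH) (metis C_on.simps(2))
  ultimately show ?case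
    by simp
qed

lemma C_on_const: "open S \<Longrightarrow> C_on m S (\<lambda>x. c)"
  by (induction m arbitrary: c)
     (auto intro!: C_on_SucI[where f' = "\<lambda>x v. 0"] simp del: C_on.simps(2))

lemma C_on_bounded_linear:
  assumes "open S" "bounded_linear h" "C_on m S f"
  shows "C_on m S (\<lambda>x. h (f x))"
  using assms(3)
proof (induction m arbitrary: f)
  case 0
  then show ?case
    using assms(2) by (simp add: bounded_linear.continuous_on)
next
  case (Suc m)
  show ?case
  proof (rule C_on_SucI)
    fix x assume "x \<in> S"
    then show "((\<lambda>x. h (f x)) has_derivative (\<lambda>v. h (frechet_derivative f (at x) v))) (at x)"
      using C_on_has_derivative[OF assms(1) Suc.prems] bounded_linear.has_derivative[OF assms(2)] by blast
  qed (use Suc assms in auto)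
qed

lemma C_on_linear: "open S \<Longrightarrow> bounded_linear f \<Longrightarrow> C_on m S f"
proof (induction m)
  case 0
  then show ?case by (simp add: linear_continuous_on)
next
  case (Suc m)
  then show ?case
    by (intro C_on_SucI[where f' = "\<lambda>x. f"] bounded_linear_imp_has_derivative C_on_const)
qed

lemma C_on_add:
  assumes "open S" "C_on m S f" "C_on m S g"
  shows "C_on m S (\<lambda>x. f x + g x)"
  using assms(2,3)
proof (induction m arbitrary: f g)
  case 0
  then show ?case by (simp add: continuous_on_add)
next
  case (Suc m)
  show ?case
  proof (rule C_on_SucI)
    fix x assume "x \<in> S"
    then show "((\<lambda>x. f x + g x) has_derivative
        (\<lambda>v. frechet_derivative f (at x) v + frechet_derivative g (at x) v)) (at x)"
      using C_on_has_derivative[OF assms(1) Suc.prems(1)] C_on_has_derivative[OF assms(1) Suc.prems(2)]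
      by (intro has_derivative_add)
  qed (use Suc assms in auto)
qed

lemma C_on_sum:
  assumes "open S" "\<And>i. i \<in> I \<Longrightarrow> C_on m S (f i)"
  shows "C_on m S (\<lambda>x. \<Sum>i\<in>I. f i x)"
  using assms(2)
  by (induction I rule: infinite_finite_induct) (auto intro: C_on_const C_on_add assms(1))

lemma C_on_scaleR:
  fixes f :: "'a::real_normed_vector \<Rightarrow> real"
  assumes "open S" "C_on m S f" "C_on m S g"
  shows "C_on m S (\<lambda>x. f x *\<^sub>R g x)"
  using assms(2,3)
proof (induction m arbitrary: f g)
  case 0
  then show ?case by (simp add: continuous_on_scaleR)
next
  case (Suc m)
  show ?case
  proof (rule C_on_SucI)
    fix x assume "x \<in> S"
    then show "((\<lambda>x. f x *\<^sub>R g x) has_derivative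
        (\<lambda>v. f x *\<^sub>R frechet_derivative g (at x) v + frechet_derivative f (at x) v *\<^sub>R g x)) (at x)"
      using C_on_has_derivative[OF assms(1) Suc.prems(1)] C_on_has_derivative[OF assms(1) Suc.prems(2)]
      by (intro has_derivative_scaleR)
  next
    show "C_on m S (\<lambda>x. f x *\<^sub>R frechet_derivative g (at x) v + frechet_derivative f (at x) v *\<^sub>R g x)" for v
      using Suc.prems C_on_Suc_imp[OF Suc.prems(1)] C_on_Suc_imp[OF Suc.prems(2)]
      by (intro C_on_add Suc.IH assms(1)) auto
  qed (fact assms(1))
qed

lemma C_on_mult:
  fixes f :: "'a::real_normed_vector \<Rightarrow> real"
  assumes "open S" "C_on m S f" "C_on m S g"
  shows "C_on m S (\<lambda>x. f x * g x)"
  using C_on_scaleR[OF assms] by simp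

text \<open>In the chain rule the direction fed to the derivative of f moves with x, whereas
  \<open>C_on\<close> fixes directions. Expanding it in the standard basis leaves scalar functions
  times derivatives in fixed directions, to which the induction applies.\<close>

lemma C_on_compose:
  fixes f :: "'b::euclidean_space \<Rightarrow> 'c::real_normed_vector" and g :: "'a::real_normed_vector \<Rightarrow> 'b"
  assumes "open S" "open T" "g ` S \<subseteq> T" "C_on m T f" "C_on m S g"
  shows "C_on m S (\<lambda>x. f (g x))"
  using assms(4,5)
proof (induction m arbitrary: f)
  case 0
  then show ?case
    using assms(3) continuous_on_compose2 by fastforce
next
  case (Suc m)
  have gm: "C_on m S g"
    by (rule C_on_Suc_imp) fact
  show ?case
  proof (rule C_on_SucI)
    fix x assume x: "x \<in> S"
    let ?f = "frechet_derivative f (at (g x))" and ?g = "frechet_derivative g (at x)"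
    have f: "(f has_derivative ?f) (at (g x))"
      using x assms(3) by (intro C_on_has_derivative[OF assms(2) Suc.prems(1)]) auto
    have "((\<lambda>x. f (g x)) has_derivative (\<lambda>v. ?f (?g v))) (at x)"
      using has_derivative_compose[OF C_on_has_derivative[OF assms(1) Suc.prems(2) x] f] .
    moreover have "?f (?g v) = (\<Sum>b\<in>Basis. (?g v \<bullet> b) *\<^sub>R ?f b)" for v
    proof -
      have "linear ?f"
        using f has_derivative_linear by blast
      then have "?f (\<Sum>b\<in>Basis. (?g v \<bullet> b) *\<^sub>R b) = (\<Sum>b\<in>Basis. (?g v \<bullet> b) *\<^sub>R ?f b)"
        by (simp add: linear_sum linear_scale)
      then show ?thesis
        by (simp add: euclidean_representation)
    qed
    then have "(\<lambda>v. ?f (?g v)) = (\<lambda>v. \<Sum>b\<in>Basis. (?g v \<bullet> b) *\<^sub>R ?f b)"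
      by blast
    ultimately show "((\<lambda>x. f (g x)) has_derivative (\<lambda>v. \<Sum>b\<in>Basis. (?g v \<bullet> b) *\<^sub>R ?f b)) (at x)"
      by simp
  next
    show "C_on m S (\<lambda>x. \<Sum>b\<in>Basis. (frechet_derivative g (at x) v \<bullet> b) *\<^sub>R frechet_derivative f (at (g x)) b)" for v
      using Suc.prems gm
      by (intro C_on_sum C_on_scaleR Suc.IH C_on_bounded_linear[OF _ bounded_linear_inner_left] assms(1)) auto
  qed (fact assms(1))
qed

text \<open>The derivative is minus the square of the function itself, so products and the induction
  hypothesis suffice.\<close>

lemma C_on_inverse: "C_on m {0<..} (inverse :: real \<Rightarrow> real)"
proof (induction m)
  case (Suc m)
  show ?case
  proof (rule C_on_SucI)
    show "(inverse has_derivative (\<lambda>v. (- 1 * (inverse x * inverse x)) * v)) (at x)"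
      if "x \<in> {0<..}" for x :: real
      using that by (auto intro!: derivative_eq_intros)
    show "C_on m {0<..} (\<lambda>x::real. (- 1 * (inverse x * inverse x)) * v)" for v
      by (intro C_on_mult C_on_const Suc) auto
  qed auto
qed (auto intro!: continuous_intros)

text \<open>This family is closed under differentiation up to linear combinations, see \<open>flat_exp_deriv\<close>.\<close>

definition flat_exp :: "nat \<Rightarrow> real \<Rightarrow> real" where
  "flat_exp n t = (if t > 0 then inverse t ^ n * exp (- inverse t) else 0)"

lemma flat_exp_tendsto_0: "(flat_exp n \<longlongrightarrow> 0) (at 0)"
proof -
  have "((\<lambda>t::real. inverse t ^ n * exp (- inverse t)) \<longlongrightarrow> 0) (at_right 0)"
    by real_asymp
  then have "(flat_exp n \<longlongrightarrow> 0) (at_right 0)"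
    by (rule Lim_transform_eventually) (auto simp: flat_exp_def eventually_at_right_field intro!: exI[of _ 1])
  moreover have "(flat_exp n \<longlongrightarrow> 0) (at_left 0)"
    by (rule tendsto_eventually) (auto simp: flat_exp_def eventually_at_left_field intro!: exI[of _ "-1"])
  ultimately show ?thesis
    by (simp add: filterlim_at_split)
qed

lemma flat_exp_deriv:
  "(flat_exp n has_real_derivative flat_exp (n + 2) t - n * flat_exp (n + 1) t) (at t)"
proof -
  consider "t > 0" | "t < 0" | "t = 0" by linarith
  then show ?thesis
  proof cases
    case 1
    \<comment> \<open>For n = 0 the exponent \<open>n - 1\<close> is cut off at 0, but the factor n
      vanishes.\<close>
    have eq: "real n * (inverse t ^ (n - 1) * (inverse t)\<^sup>2) = real n * inverse t ^ (n + 1)"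
      by (cases n) (auto simp: power2_eq_square)
    have "((\<lambda>t. inverse t ^ n * exp (- inverse t)) has_real_derivative
        inverse t ^ n * ((inverse t)\<^sup>2 * exp (- inverse t))
          - real n * (inverse t ^ (n - 1) * (inverse t)\<^sup>2) * exp (- inverse t)) (at t)"
      using 1 by (auto intro!: derivative_eq_intros simp: power2_eq_square algebra_simps)
    then have "((\<lambda>t. inverse t ^ n * exp (- inverse t)) has_real_derivative
        flat_exp (n + 2) t - n * flat_exp (n + 1) t) (at t)"
      using 1 unfolding eq by (simp add: flat_exp_def power_add power2_eq_square algebra_simps)
    then show ?thesis
      by (rule has_field_derivative_transform_within_open[of _ _ _ "{0<..}"]) (use 1 in \<open>auto simp: flat_exp_def\<close>)
  next
    case 2
    have "((\<lambda>t. 0) has_real_derivative flat_exp (n + 2) t - n * flat_exp (n + 1) t) (at t)"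
      using 2 by (simp add: flat_exp_def)
    then show ?thesis
      by (rule has_field_derivative_transform_within_open[of _ _ _ "{..<0}"]) (use 2 in \<open>auto simp: flat_exp_def\<close>)
  next
    case 3
    \<comment> \<open>At 0 the difference quotient of \<open>flat_exp n\<close> is
      \<open>flat_exp (n + 1)\<close>: dividing by h raises the power of 1/h by one.\<close>
    have "((\<lambda>h. (flat_exp n (0 + h) - flat_exp n 0) / h) \<longlongrightarrow> 0) (at 0)"
      by (rule Lim_transform_eventually[OF flat_exp_tendsto_0[of "n + 1"]])
         (auto simp: flat_exp_def field_simps eventually_at_filter)
    then show ?thesis
      by (simp add: 3 DERIV_def) (simp add: flat_exp_def)
  qed
qed

lemma C_on_flat_exp: "C_on m UNIV (flat_exp n)"
proof (induction m arbitrary: n)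
  case 0
  then show ?case
    by (auto intro!: continuous_at_imp_continuous_on DERIV_isCont[OF flat_exp_deriv])
next
  case (Suc m)
  show ?case
  proof (rule C_on_SucI)
    show "(flat_exp n has_derivative (\<lambda>v. (flat_exp (n + 2) t + (- real n) * flat_exp (n + 1) t) * v)) (at t)" for t
      using flat_exp_deriv[of n t] by (simp add: has_field_derivative_def)
    show "C_on m UNIV (\<lambda>t. (flat_exp (n + 2) t + (- real n) * flat_exp (n + 1) t) * v)" for v
      by (intro C_on_mult C_on_add C_on_const Suc) auto
  qed auto
qed

section \<open>Integrals of compactly supported derivatives\<close>

lemma integrable_lborel_continuous_compact_support:
  fixes f :: "'a::euclidean_space \<Rightarrow> real"
  assumes "continuous_on UNIV f" "compact K" "\<And>x. x \<notin> K \<Longrightarrow> f x = 0"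
  shows "integrable lborel f"
proof -
  have "integrable lborel (\<lambda>x. indicator K x *\<^sub>R f x)"
    using assms continuous_on_subset by (intro borel_integrable_compact) blast+
  also have "(\<lambda>x. indicator K x *\<^sub>R f x) = f"
    using assms(3) by (auto simp: fun_eq_iff indicator_def)
  finally show ?thesis .
qed

lemma integral_lborel_shift:
  fixes f :: "'a::euclidean_space \<Rightarrow> real"
  assumes "f \<in> borel_measurable borel"
  shows "integral\<^sup>L lborel (\<lambda>x. f (c + x)) = integral\<^sup>L lborel f"
proof -
  have "integral\<^sup>L (distr lborel borel ((+) c)) f = integral\<^sup>L lborel (\<lambda>x. f (c + x))"
    by (rule integral_distr) (use assms in auto)
  then show ?thesis
    by (simp add: lborel_distr_plus)
qed

text \<open>
  The integrals of the difference quotients of \<open>f\<close> vanish by translation invariance, and they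
  converge to the integral of the directional derivative by dominated convergence.
\<close>

lemma integral_directional_derivative_zero:
  fixes f :: "'a::euclidean_space \<Rightarrow> real"
  assumes d: "\<And>x. (f has_derivative f' x) (at x)"
    and c: "continuous_on UNIV (\<lambda>x. f' x v)"
    and K: "compact K" "\<And>x. x \<notin> K \<Longrightarrow> f x = 0"
  shows "integral\<^sup>L lborel (\<lambda>x. f' x v) = 0"
proof -
  have cf: "continuous_on UNIV f"
    using d has_derivative_continuous by (metis continuous_at_imp_continuous_on)
  obtain R where R: "\<And>x. x \<in> K \<Longrightarrow> norm x \<le> R"
    using compact_imp_bounded[OF K(1)] bounded_iff by blast
  \<comment> \<open>A step of length at most \<open>norm v\<close> from a point outside this ball
    stays outside K, so every difference quotient vanishes there. For x in the ball the mean value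
    point lies within \<open>R + 2 * norm v\<close> of the origin, which is why the derivative is
    bounded on that larger ball.\<close>
  let ?B = "cball (0::'a) (R + norm v)"
  have "compact ((\<lambda>x. f' x v) ` cball 0 (R + 2 * norm v))"
    by (intro compact_continuous_image continuous_on_subset[OF c]) auto
  then have "bounded ((\<lambda>x. f' x v) ` cball 0 (R + 2 * norm v))"
    by (rule compact_imp_bounded)
  then obtain C where C: "\<And>x. norm x \<le> R + 2 * norm v \<Longrightarrow> \<bar>f' x v\<bar> \<le> C"
    by (fastforce simp: bounded_iff)
  have line: "((\<lambda>t. f (x + t *\<^sub>R v)) has_real_derivative f' (x + t *\<^sub>R v) v) (at t)" for x t
  proof -
    have "((\<lambda>t. f (x + t *\<^sub>R v)) has_derivative (\<lambda>h. f' (x + t *\<^sub>R v) (h *\<^sub>R v))) (at t)"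
      by (rule has_derivative_compose[OF _ d, of "\<lambda>t. x + t *\<^sub>R v" "\<lambda>h. h *\<^sub>R v"])
         (auto intro!: derivative_eq_intros)
    moreover have "f' y (h *\<^sub>R v) = f' y v * h" for y h
      using has_derivative_linear[OF d] by (simp add: linear_scale)
    ultimately show ?thesis
      by (simp add: has_field_derivative_def)
  qed
  define q where "q m x = (f (x + inverse (Suc m) *\<^sub>R v) - f x) * Suc m" for m x
  have q_cont: "continuous_on UNIV (q m)" for m
    unfolding q_def by (intro continuous_intros continuous_on_compose2[OF cf]) auto
  have out: "q m x = 0" if "x \<notin> ?B" for m x
  proof -
    have v: "norm (inverse (Suc m) *\<^sub>R v) \<le> norm v"
      by (simp add: mult_left_le_one_le inverse_le_1_iff)
    have "x \<notin> K"
      using that R[of x] norm_ge_zero[of v] by (auto simp del: norm_ge_zero)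
    moreover have "x + inverse (Suc m) *\<^sub>R v \<notin> K"
      using that R[of "x + inverse (Suc m) *\<^sub>R v"] v norm_diff_ineq[of x "inverse (Suc m) *\<^sub>R v"]
      by (auto simp del: of_nat_Suc norm_scaleR)
    ultimately show ?thesis
      using K(2) by (simp add: q_def)
  qed
  have bound: "\<bar>q m x\<bar> \<le> indicator ?B x * C" for m x
  proof (cases "x \<in> ?B")
    case True
    define g where "g t = f (x + t *\<^sub>R v)" for t
    have "(g has_real_derivative f' (x + t *\<^sub>R v) v) (at t)" for t
      unfolding g_def by (rule line)
    then obtain t where t: "0 < t" "t < inverse (Suc m)"
      "g (inverse (Suc m)) - g 0 = (inverse (Suc m) - 0) * f' (x + t *\<^sub>R v) v"
      using MVT2[of 0 "inverse (real (Suc m))" g "\<lambda>t. f' (x + t *\<^sub>R v) v"] by auto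
    have "inverse (real (Suc m)) \<le> 1"
      by (simp add: inverse_le_1_iff del: of_nat_Suc)
    then have "t \<le> 1"
      using t(2) by linarith
    then have "norm (x + t *\<^sub>R v) \<le> R + 2 * norm v"
      using True t(1) norm_triangle_ineq[of x "t *\<^sub>R v"] mult_right_mono[of t 1 "norm v"] by auto
    moreover have "q m x = f' (x + t *\<^sub>R v) v"
      using t(3) by (simp add: q_def g_def field_simps del: of_nat_Suc)
    ultimately show ?thesis
      using C True by simp
  qed (simp add: out)
  have lim: "(\<lambda>m. q m x) \<longlonglongrightarrow> f' x v" for x
  proof -
    have "((\<lambda>t. (f (x + t *\<^sub>R v) - f x) / t) \<longlongrightarrow> f' x v) (at 0)"
      using line[of x 0] by (simp add: DERIV_def)
    moreover have "filterlim (\<lambda>m. inverse (real (Suc m))) (at 0) sequentially"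
      by real_asymp
    ultimately have "(\<lambda>m. (f (x + inverse (real (Suc m)) *\<^sub>R v) - f x) / inverse (real (Suc m))) \<longlonglongrightarrow> f' x v"
      by (rule filterlim_compose)
    then show ?thesis
      by (simp add: q_def divide_inverse del: of_nat_Suc)
  qed
  have int_f: "integrable lborel f"
    using cf K by (rule integrable_lborel_continuous_compact_support)
  have "integral\<^sup>L lborel (q m) = 0" for m
  proof -
    let ?c = "inverse (real (Suc m)) *\<^sub>R v"
    have meas: "f \<in> borel_measurable borel"
      using cf by (rule borel_measurable_continuous_onI)
    have "integrable (distr lborel borel ((+) ?c)) f"
      using int_f by (simp add: lborel_distr_plus)
    then have int_s: "integrable lborel (\<lambda>x. f (?c + x))"
      by (subst (asm) integrable_distr_eq) (use meas in auto)
    have "integral\<^sup>L lborel (q m) = (integral\<^sup>L lborel (\<lambda>x. f (?c + x)) - integral\<^sup>L lborel f) * Suc m"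
      unfolding q_def using int_f int_s by (simp add: add.commute del: of_nat_Suc)
    then show ?thesis
      by (simp add: integral_lborel_shift[OF meas])
  qed
  moreover have "(\<lambda>m. integral\<^sup>L lborel (q m)) \<longlonglongrightarrow> integral\<^sup>L lborel (\<lambda>x. f' x v)"
  proof (rule integral_dominated_convergence[where w = "\<lambda>x. indicator ?B x * C"])
    show "(\<lambda>x. f' x v) \<in> borel_measurable lborel" "\<And>m. q m \<in> borel_measurable lborel"
      using c q_cont by (simp_all add: borel_measurable_continuous_onI)
    show "integrable lborel (\<lambda>x. indicator ?B x * C)"
      using emeasure_bounded_finite[OF bounded_cball, of "0::'a" "R + norm v"]
      by (intro integrable_mult_left integrable_real_indicator) (auto simp: less_top)
  qed (use lim bound in auto)
  ultimately show ?thesis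
    by (simp add: LIMSEQ_const_iff)
qed

text \<open>U and the complement of K form an open cover on which the extension is f and 0
  respectively.\<close>

lemma continuous_on_extend_by_zero:
  fixes f :: "'a::euclidean_space \<Rightarrow> real"
  assumes "open U" "compact K" "K \<subseteq> U" "continuous_on U f" "\<And>x. x \<in> U - K \<Longrightarrow> f x = 0"
  shows "continuous_on UNIV (\<lambda>x. if x \<in> U then f x else 0)"
proof -
  have "continuous_on (U \<union> (- K)) (\<lambda>x. if x \<in> U then f x else 0)"
  proof (rule continuous_on_open_Un)
    show "continuous_on U (\<lambda>x. if x \<in> U then f x else 0)"
      using assms(4) by (rule continuous_on_eq) simp
    show "continuous_on (- K) (\<lambda>x. if x \<in> U then f x else 0)"
      using assms(5) by (intro continuous_on_eq[OF continuous_on_const[of _ 0]]) auto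
  qed (use assms compact_imp_closed in auto)
  moreover have "U \<union> (- K) = UNIV"
    using assms(3) by auto
  ultimately show ?thesis
    by simp
qed

lemma absolutely_integrable_compact_support:
  fixes f :: "'a::euclidean_space \<Rightarrow> real"
  assumes "open U" "compact K" "K \<subseteq> U" "continuous_on U f" "\<And>x. x \<in> U - K \<Longrightarrow> f x = 0"
  shows "f absolutely_integrable_on U"
proof -
  have "integrable lborel (\<lambda>x. if x \<in> U then f x else 0)"
    using assms(2,3,5)
    by (intro integrable_lborel_continuous_compact_support[OF continuous_on_extend_by_zero[OF assms]]) auto
  then have "integrable lebesgue (\<lambda>x. if x \<in> U then f x else 0)"
    by (simp add: integrable_completion)
  moreover have "(\<lambda>x. if x \<in> U then f x else 0) = (\<lambda>x. indicator U x *\<^sub>R f x)"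
    by auto
  ultimately show ?thesis
    by (simp add: set_integrable_def)
qed

lemma derivative_zero_off_support:
  assumes "open U" "closed K" "\<And>x. x \<in> U - K \<Longrightarrow> u x = 0" "x \<in> U - K" "(u has_derivative u') (at x)"
  shows "u' v = 0"
proof -
  have "((\<lambda>x. 0) has_derivative u') (at x)"
    by (rule has_derivative_transform_within_open[OF assms(5), of "U - K"]) (use assms in auto)
  then have "u' = (\<lambda>_. 0)"
    using has_derivative_const has_derivative_unique by blast
  then show ?thesis
    by simp
qed

text \<open>The local form of Stokes' theorem. Extension by 0 stays differentiable at points outside
  U because it vanishes on the complement of K, an open set.\<close>

lemma integral_derivative_compact_support:
  fixes u :: "'a::euclidean_space \<Rightarrow> real"
  assumes U: "open U" and K: "compact K" "K \<subseteq> U" and u0: "\<And>x. x \<in> U - K \<Longrightarrow> u x = 0"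
    and d: "\<And>x. x \<in> U \<Longrightarrow> (u has_derivative u' x) (at x)" and c: "continuous_on U (\<lambda>x. u' x v)"
  shows "integral U (\<lambda>x. u' x v) = 0"
proof -
  let ?g = "\<lambda>x. if x \<in> U then u x else 0" and ?g' = "\<lambda>x v. if x \<in> U then u' x v else 0"
  have u'0: "u' x v = 0" if "x \<in> U - K" for x v
    by (rule derivative_zero_off_support[where u = u, OF U compact_imp_closed[OF K(1)] u0 that d])
       (use that in auto)
  have c': "continuous_on UNIV (\<lambda>x. ?g' x v)"
    by (rule continuous_on_extend_by_zero[OF U K c]) (rule u'0)
  have "(?g has_derivative ?g' x) (at x)" for x
  proof (cases "x \<in> U")
    case True
    then have "(?g has_derivative u' x) (at x)"
      by (intro has_derivative_transform_within_open[OF d U]) auto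
    then show ?thesis
      using True by simp
  next
    case False
    have "(?g has_derivative (\<lambda>v. 0)) (at x)"
      by (rule has_derivative_transform_within_open[OF has_derivative_const[of 0], of "- K"])
         (use False K u0 compact_imp_closed in auto)
    then show ?thesis
      using False by simp
  qed
  then have "integral\<^sup>L lborel (\<lambda>x. ?g' x v) = 0"
    using integral_directional_derivative_zero[where f = ?g and f' = ?g' and v = v and K = K] c' K u0 by auto
  moreover have "integrable lborel (\<lambda>x. ?g' x v)"
    by (rule integrable_lborel_continuous_compact_support[OF c' K(1)]) (use u'0 in auto)
  ultimately have "integral UNIV (\<lambda>x. ?g' x v) = 0"
    by (simp add: integral_lborel)
  then show ?thesis
    by (simp add: integral_restrict_UNIV)
qed

section \<open>Exterior algebra in top degree\<close>

text \<open>The cycle that moves p to p + i and lowers p + 1, ..., p + i by one. Building it from i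
  transpositions gives its sign by induction.\<close>

primrec block_cycle :: "nat \<Rightarrow> nat \<Rightarrow> nat \<Rightarrow> nat" where
  "block_cycle p 0 = id"
| "block_cycle p (Suc i) = Transposition.transpose (p + i) (p + Suc i) \<circ> block_cycle p i"

lemma block_cycle_apply:
  "block_cycle p i x = (if x = p then p + i else if p < x \<and> x \<le> p + i then x - 1 else x)"
  by (induction i) (auto simp: Transposition.transpose_def)

lemma block_cycle_permutes: "i \<le> q \<Longrightarrow> block_cycle p i permutes {..<p + q + 1}"
proof (induction i)
  case (Suc i)
  then show ?case
    unfolding block_cycle.simps by (intro permutes_compose permutes_swap_id) auto
qed (simp add: permutes_id)

lemma sign_block_cycle: "sign (block_cycle p i) = (- 1) ^ i"
proof (induction i)
  case (Suc i)
  have "permutation (block_cycle p i)"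
    using block_cycle_permutes[of i i p] finite_lessThan permutation_permutes by blast
  then show ?case
    using Suc by (simp only: block_cycle.simps sign_compose permutation_swap_id sign_swap_id) simp
qed simp

text \<open>After p steps this exchanges the blocks of length p before and after the middle index p,
  which it fixes.\<close>

primrec block_swap :: "nat \<Rightarrow> nat \<Rightarrow> nat \<Rightarrow> nat" where
  "block_swap p 0 = id"
| "block_swap p (Suc i) = Transposition.transpose i (p + 1 + i) \<circ> block_swap p i"

lemma block_swap_apply:
  "i \<le> p \<Longrightarrow> block_swap p i x =
    (if x < i then p + 1 + x else if p < x \<and> x < p + 1 + i then x - (p + 1) else x)"
  by (induction i) (auto simp: Transposition.transpose_def)

lemma block_swap_permutes: "i \<le> p \<Longrightarrow> block_swap p i permutes {..<p + p + 1}"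
proof (induction i)
  case (Suc i)
  then show ?case
    unfolding block_swap.simps by (intro permutes_compose permutes_swap_id) auto
qed (simp add: permutes_id)

lemma sign_block_swap: "i \<le> p \<Longrightarrow> sign (block_swap p i) = (- 1) ^ i"
proof (induction i)
  case (Suc i)
  have "permutation (block_swap p i)"
    using block_swap_permutes[of i p] Suc.prems finite_lessThan permutation_permutes by fastforce
  then show ?case
    using Suc by (simp only: block_swap.simps sign_compose permutation_swap_id sign_swap_id) simp
qed simp

lemma sum_permutations_reindex:
  fixes f :: "('i \<Rightarrow> 'i) \<Rightarrow> real"
  assumes "finite S" "\<sigma> permutes S"
  shows "(\<Sum>\<pi> | \<pi> permutes S. of_int (sign \<pi>) * f \<pi>)
    = of_int (sign \<sigma>) * (\<Sum>\<pi> | \<pi> permutes S. of_int (sign \<pi>) * f (\<pi> \<circ> \<sigma>))"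
proof -
  have "(\<Sum>\<pi> | \<pi> permutes S. of_int (sign \<pi>) * f \<pi>)
      = (\<Sum>\<pi> | \<pi> permutes S. of_int (sign (\<pi> \<circ> \<sigma>)) * f (\<pi> \<circ> \<sigma>))"
    by (rule sum_permutations_compose_right[OF assms(2)])
  also have "\<dots> = (\<Sum>\<pi> | \<pi> permutes S. of_int (sign \<sigma>) * (of_int (sign \<pi>) * f (\<pi> \<circ> \<sigma>)))"
  proof (intro sum.cong refl)
    fix \<pi> assume "\<pi> \<in> {\<pi>. \<pi> permutes S}"
    then have "permutation \<pi>" "permutation \<sigma>"
      using assms permutation_permutes by auto
    then show "of_int (sign (\<pi> \<circ> \<sigma>)) * f (\<pi> \<circ> \<sigma>)
        = of_int (sign \<sigma>) * (of_int (sign \<pi>) * f (\<pi> \<circ> \<sigma>))"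
      by (simp only: sign_compose of_int_mult) simp
  qed
  finally show ?thesis
    by (simp add: sum_distrib_left)
qed

text \<open>Reindexing by \<open>block_cycle p i\<close> brings the differentiated slot p + i to p,
  and its sign cancels the (- 1) ^ i of the exterior derivative. All q + 1 terms thus agree.\<close>

lemma wedge_exterior_sum:
  fixes a :: "'v list \<Rightarrow> real" and Db :: "'v list \<Rightarrow> 'v \<Rightarrow> real"
  shows "(\<Sum>\<pi> | \<pi> permutes {..<p + q + 1}. of_int (sign \<pi>) * (a (map (e \<circ> \<pi>) [0..<p]) *
      (\<Sum>i<q + 1. (- 1) ^ i * Db (map (e \<circ> \<pi>) ([p..<p + i] @ [p + i + 1..<p + q + 1])) (e (\<pi> (p + i))))))
    = real (q + 1) * (\<Sum>\<pi> | \<pi> permutes {..<p + q + 1}. of_int (sign \<pi>) *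
        (a (map (e \<circ> \<pi>) [0..<p]) * Db (map (e \<circ> \<pi>) [p + 1..<p + q + 1]) (e (\<pi> p))))"
    (is "?L = _ * ?R")
proof -
  let ?t = "\<lambda>i \<pi>. a (map (e \<circ> \<pi>) [0..<p]) *
    Db (map (e \<circ> \<pi>) ([p..<p + i] @ [p + i + 1..<p + q + 1])) (e (\<pi> (p + i)))"
  have "?L = (\<Sum>i<q + 1. \<Sum>\<pi> | \<pi> permutes {..<p + q + 1}. (- 1) ^ i * (of_int (sign \<pi>) * ?t i \<pi>))"
    by (subst sum.swap) (simp only: sum_distrib_left mult.assoc mult.left_commute[of "(- 1) ^ _"])
  also have "\<dots> = (\<Sum>i<q + 1. ?R)"
  proof (rule sum.cong)
    fix i assume "i \<in> {..<q + 1}"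
    then have i: "i \<le> q" by simp
    let ?c = "block_cycle p i"
    have list: "map (e \<circ> (\<pi> \<circ> ?c)) [p + 1..<p + q + 1] = map (e \<circ> \<pi>) ([p..<p + i] @ [p + i + 1..<p + q + 1])" for \<pi>
      using i by (intro nth_equalityI) (auto simp: block_cycle_apply nth_append simp del: upt_Suc)
    have list0: "map (e \<circ> (\<pi> \<circ> ?c)) [0..<p] = map (e \<circ> \<pi>) [0..<p]" for \<pi>
      by (auto simp: block_cycle_apply)
    have top: "(\<pi> \<circ> ?c) p = \<pi> (p + i)" for \<pi> :: "nat \<Rightarrow> nat"
      by (simp add: block_cycle_apply)
    have "?R = of_int (sign ?c) * (\<Sum>\<pi> | \<pi> permutes {..<p + q + 1}. of_int (sign \<pi>) * ?t i \<pi>)"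
      by (subst sum_permutations_reindex[OF finite_lessThan block_cycle_permutes[OF i]])
         (simp only: list list0 top)
    then show "(\<Sum>\<pi> | \<pi> permutes {..<p + q + 1}. (- 1) ^ i * (of_int (sign \<pi>) * ?t i \<pi>)) = ?R"
      by (simp only: sign_block_cycle sum_distrib_left of_int_power of_int_minus of_int_1)
  qed simp
  finally show ?thesis
    by simp
qed

text \<open>Exchanging the outer blocks costs (- 1) ^ p. This is where even degree enters: an odd p
  would turn skew symmetry of the integral into symmetry.\<close>

lemma block_swap_sum:
  fixes b :: "'v list \<Rightarrow> real" and Da :: "'v list \<Rightarrow> 'v \<Rightarrow> real"
  assumes "even p"
  shows "(\<Sum>\<pi> | \<pi> permutes {..<p + p + 1}. of_int (sign \<pi>) *
      (b (map (e \<circ> \<pi>) [0..<p]) * Da (map (e \<circ> \<pi>) [p + 1..<p + p + 1]) (e (\<pi> p))))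
    = (\<Sum>\<pi> | \<pi> permutes {..<p + p + 1}. of_int (sign \<pi>) *
      (b (map (e \<circ> \<pi>) [p + 1..<p + p + 1]) * Da (map (e \<circ> \<pi>) [0..<p]) (e (\<pi> p))))"
proof -
  let ?c = "block_swap p p"
  have list: "map (e \<circ> (\<pi> \<circ> ?c)) [p + 1..<p + p + 1] = map (e \<circ> \<pi>) [0..<p]" for \<pi>
    by (intro nth_equalityI) (auto simp: block_swap_apply simp del: upt_Suc)
  have list0: "map (e \<circ> (\<pi> \<circ> ?c)) [0..<p] = map (e \<circ> \<pi>) [p + 1..<p + p + 1]" for \<pi>
    by (intro nth_equalityI) (auto simp: block_swap_apply simp del: upt_Suc)
  have top: "(\<pi> \<circ> ?c) p = \<pi> p" for \<pi> :: "nat \<Rightarrow> nat"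
    by (simp add: block_swap_apply)
  show ?thesis
    by (subst sum_permutations_reindex[OF finite_lessThan block_swap_permutes[OF order_refl]])
       (simp only: list list0 top, simp add: sign_block_swap assms)
qed

section \<open>Determinants and alternating multilinear functions\<close>

text \<open>The claim for all B at once is stable under products in A, so only the matrices of
  \<open>induct_matrix_elementary\<close> remain: a zero row, diagonal matrices, row swaps and row
  additions.\<close>

lemma alternating_rows_mult:
  fixes w :: "real^'n::finite^'n \<Rightarrow> real"
  assumes lin: "\<And>B i. linear (\<lambda>v. w (\<chi> j. if j = i then v else B $ j))"
    and swap: "\<And>B m n. m \<noteq> n \<Longrightarrow> w (\<chi> j. B $ Transposition.transpose m n j) = - w B"
  shows "w (A ** B) = det A * w B"
proof -
  have eq0: "w B = 0" if "m \<noteq> n" "B $ m = B $ n" for B m n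
  proof -
    have "(\<chi> j. B $ Transposition.transpose m n j) = B"
      using that by (auto simp: vec_eq_iff Transposition.transpose_def)
    then show ?thesis
      using swap[OF that(1), of B] by simp
  qed
  have upd: "(\<chi> j. if j = i then B $ i else B $ j) = B" for B :: "real^'n^'n" and i
    by (simp add: vec_eq_iff)
  have "\<forall>B. w (A ** B) = det A * w B"
  proof (induction A rule: induct_matrix_elementary)
    case (1 A B)
    note mult = this
    then show ?case
      by (simp add: det_mul matrix_mul_assoc[symmetric])
  next
    case (2 A i)
    note zero_row = this
    show ?case
    proof
      fix B :: "real^'n^'n"
      have row0: "(A ** B) $ i = 0"
        using zero_row by (simp add: vec_eq_iff matrix_matrix_mult_def row_def)
      then have "w (A ** B) = 0"
        using linear_0[OF lin[of i "A ** B"]] upd[of i "A ** B", unfolded row0] by metis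
      then show "w (A ** B) = det A * w B"
        using det_zero_row(1)[OF zero_row] by simp
    qed
  next
    case (3 A)
    note diagonal = this
    \<comment> \<open>S collects the rows already scaled; linearity in one row adds the
      next.\<close>
    have scale: "w (\<chi> j. if j \<in> S then A $ j $ j *\<^sub>R B $ j else B $ j) = (\<Prod>j\<in>S. A $ j $ j) * w B" for S and B :: "real^'n^'n"
      using finite[of S]
    proof (induction S rule: finite_induct)
      case (insert i S)
      let ?B = "\<chi> j. if j \<in> S then A $ j $ j *\<^sub>R B $ j else B $ j"
      have "(\<chi> j. if j \<in> insert i S then A $ j $ j *\<^sub>R B $ j else B $ j)
          = (\<chi> j. if j = i then A $ i $ i *\<^sub>R B $ i else ?B $ j)"
        by (simp add: vec_eq_iff)
      then have "w (\<chi> j. if j \<in> insert i S then A $ j $ j *\<^sub>R B $ j else B $ j)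
          = A $ i $ i * w (\<chi> j. if j = i then B $ i else ?B $ j)"
        using linear_scale[OF lin[of i ?B]] by simp
      also have "(\<chi> j. if j = i then B $ i else ?B $ j) = ?B"
        using insert by (simp add: vec_eq_iff)
      finally show ?case
        using insert by simp
    qed simp
    show ?case
    proof
      fix B :: "real^'n^'n"
      have "A ** B = (\<chi> j. if j \<in> UNIV then A $ j $ j *\<^sub>R B $ j else B $ j)"
      proof -
        have "(\<Sum>k\<in>UNIV. A $ i $ k * B $ k $ j) = (\<Sum>k\<in>UNIV. if k = i then A $ i $ i * B $ i $ j else 0)" for i j
          using diagonal by (intro sum.cong) auto
        then show ?thesis
          by (simp add: vec_eq_iff matrix_matrix_mult_def)
      qed
      then show "w (A ** B) = det A * w B"
        using scale[of UNIV B] det_diagonal[OF diagonal] by simp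
    qed
  next
    case (4 m n)
    note swap1 = this
    show ?case
    proof
      fix B :: "real^'n^'n"
      let ?P = "(\<chi> i j. mat 1 $ i $ Transposition.transpose m n j) :: real^'n^'n"
      have "(\<Sum>k\<in>UNIV. ?P $ i $ k * B $ k $ j) = B $ Transposition.transpose m n i $ j" for i j
      proof -
        have "(\<Sum>k\<in>UNIV. ?P $ i $ k * B $ k $ j)
            = (\<Sum>k\<in>UNIV. if k = Transposition.transpose m n i then B $ k $ j else 0)"
          by (intro sum.cong) (auto simp: mat_def Transposition.transpose_def)
        then show ?thesis by simp
      qed
      then have "?P ** B = (\<chi> i. B $ Transposition.transpose m n i)"
        by (simp add: vec_eq_iff matrix_matrix_mult_def)
      moreover have "det ?P = - 1"
        using det_permute_columns[of "Transposition.transpose m n" "mat 1 :: real^'n^'n"] swap1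
        by (simp add: permutes_swap_id sign_swap_id)
      ultimately show "w (?P ** B) = det ?P * w B"
        using swap[OF swap1, of B] by simp
    qed
  next
    case (5 m n c)
    note idplus = this
    show ?case
    proof
      fix B :: "real^'n^'n"
      let ?P = "(\<chi> i j. if i = m \<and> j = n then c else of_bool (i = j)) :: real^'n^'n"
      have rowm: "?P ** B = (\<chi> i. if i = m then B $ m + c *\<^sub>R B $ n else B $ i)" for B :: "real^'n^'n"
      proof -
        have "(\<Sum>k\<in>UNIV. (if i = m \<and> k = n then c else of_bool (i = k)) * B $ k $ j)
            = (\<Sum>k\<in>UNIV. (if k = i then B $ k $ j else 0) + (if k = n then (if i = m then c * B $ k $ j else 0) else 0))" for i j
          using idplus by (intro sum.cong) auto
        also have "\<dots> i j = B $ i $ j + (if i = m then c * B $ n $ j else 0)" for i j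
          by (simp add: sum.distrib)
        finally show ?thesis
          by (simp add: vec_eq_iff matrix_matrix_mult_def)
      qed
      have "w (?P ** B) = w (\<chi> i. if i = m then B $ m else B $ i) + c * w (\<chi> i. if i = m then B $ n else B $ i)"
        unfolding rowm using linear_add[OF lin[of m B]] linear_scale[OF lin[of m B]] by simp
      \<comment> \<open>Rows m and n of this matrix coincide.\<close>
      also have "w (\<chi> i. if i = m then B $ n else B $ i) = 0"
        by (rule eq0[OF idplus]) (use idplus in auto)
      finally have "w (?P ** B) = w B"
        by (simp add: upd)
      moreover have "det ?P = 1"
      proof -
        have "?P = (\<chi> k. if k = m then row m (mat 1) + c *s row n (mat 1) else row k (mat 1))"
          using idplus by (auto simp: vec_eq_iff row_def mat_def)
        then show ?thesis
          using det_row_operation[OF idplus, of "mat 1 :: real^'n^'n" c] by simp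
      qed
      ultimately show "w (?P ** B) = det ?P * w B"
        by simp
    qed
  qed
  then show ?thesis ..
qed

abbreviation frame_vec :: "nat \<Rightarrow> real^'n::{finite,wellorder}" where
  "frame_vec i \<equiv> std_frame ! i"

lemma length_std_frame: "length (std_frame :: (real^'n::{finite,wellorder}) list) = CARD('n)"
  by (simp add: std_frame_def)

text \<open>\<open>alternating_rows_mult\<close> speaks of the rows of a matrix. Encoding the
  arguments of T as rows turns the application of J to the frame into multiplication of the identity
  by \<open>transpose J\<close>, whose determinant is that of J.\<close>

lemma antisymmetrized_multilinear_det:
  fixes T :: "(nat \<Rightarrow> real^'n::{finite,wellorder}) \<Rightarrow> real"
  assumes lin: "\<And>f i. i < CARD('n) \<Longrightarrow> linear (\<lambda>v. T (f(i := v)))"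
    and cong: "\<And>f g. (\<And>i. i < CARD('n) \<Longrightarrow> f i = g i) \<Longrightarrow> T f = T g"
  shows "(\<Sum>\<pi> | \<pi> permutes {..<CARD('n)}. of_int (sign \<pi>) * T (\<lambda>i. J *v frame_vec (\<pi> i)))
    = det J * (\<Sum>\<pi> | \<pi> permutes {..<CARD('n)}. of_int (sign \<pi>) * T (\<lambda>i. frame_vec (\<pi> i)))"
proof -
  let ?n = "CARD('n)"
  \<comment> \<open>The numbering of coordinates behind \<open>std_frame\<close>; it translates
    between positions below n and the index type.\<close>
  define ix :: "nat \<Rightarrow> 'n" where "ix i = sorted_list_of_set UNIV ! i" for i
  have bij: "bij_betw ix {..<?n} UNIV"
    unfolding ix_def by (rule bij_betw_nth) auto
  define ixi where "ixi = inv_into {..<?n} ix"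
  have ixi: "ix (ixi i) = i" "ixi i < ?n" for i
    using bij bij_betw_inv_into_right[OF bij] bij_betw_inv_into[OF bij]
    by (auto simp: ixi_def bij_betw_def)
  have ixi': "ixi (ix k) = k" if "k < ?n" for k
    using bij_betw_inv_into_left[OF bij] that by (simp add: ixi_def)
  have frame: "frame_vec i = axis (ix i) 1" if "i < ?n" for i
    using that by (simp add: std_frame_def ix_def)
  define w where "w B = (\<Sum>\<pi> | \<pi> permutes {..<?n}. of_int (sign \<pi>) * T (\<lambda>i. B $ ix (\<pi> i)))"
    for B :: "((real, 'n) vec, 'n) vec"
  have lt: "\<pi> k < ?n" if "\<pi> permutes {..<?n}" "k < ?n" for \<pi> k
    using permutes_in_image[OF that(1)] that(2) by auto
  have "w (transpose J ** mat 1) = det (transpose J) * w (mat 1)"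
  proof (rule alternating_rows_mult)
    fix B :: "((real, 'n) vec, 'n) vec" and i
    have "linear (\<lambda>v. T (\<lambda>k. (\<chi> j. if j = i then v else B $ j) $ ix (\<pi> k)))" if \<pi>: "\<pi> permutes {..<?n}" for \<pi>
    proof -
      \<comment> \<open>Row i enters T at exactly one position, the preimage under
        \<open>\<pi>\<close> of the number of i.\<close>
      let ?k = "inv_into UNIV \<pi> (ixi i)"
      have k: "?k < ?n" "\<pi> ?k = ixi i"
        using lt[OF permutes_inv[OF \<pi>] ixi(2)] permutes_inverses(1)[OF \<pi>] by auto
      have "T (\<lambda>k. (\<chi> j. if j = i then v else B $ j) $ ix (\<pi> k)) = T ((\<lambda>k. B $ ix (\<pi> k))(?k := v))" for v
      proof (rule cong)
        fix l assume l: "l < ?n"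
        have "ix (\<pi> l) = i \<longleftrightarrow> l = ?k"
          using ixi' ixi(1) lt[OF \<pi> l] k(2) permutes_inverses(2)[OF \<pi>] by metis
        then show "(\<chi> j. if j = i then v else B $ j) $ ix (\<pi> l) = ((\<lambda>k. B $ ix (\<pi> k))(?k := v)) l"
          by simp
      qed
      then show ?thesis
        using lin[OF k(1)] by simp
    qed
    then have "linear (\<lambda>v. of_int (sign \<pi>) *\<^sub>R T (\<lambda>k. (\<chi> j. if j = i then v else B $ j) $ ix (\<pi> k)))"
      if "\<pi> permutes {..<?n}" for \<pi>
      using that by (intro linear_compose_scale_right)
    then show "linear (\<lambda>v. w (\<chi> j. if j = i then v else B $ j))"
      unfolding w_def real_scaleR_def by (intro linear_compose_sum) simp
  next
    fix B :: "((real, 'n) vec, 'n) vec" and m n :: 'n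
    assume "m \<noteq> n"
    let ?\<tau> = "Transposition.transpose (ixi m) (ixi n)"
    have \<tau>: "?\<tau> permutes {..<?n}"
      using ixi(2) by (intro permutes_swap_id) auto
    have ne: "ixi m \<noteq> ixi n"
      using \<open>m \<noteq> n\<close> ixi(1) by metis
    \<comment> \<open>Swapping rows m and n composes every \<open>\<pi>\<close> on the left with the
      transposition of their numbers, which flips its sign.\<close>
    have "w (\<chi> j. B $ Transposition.transpose m n j)
        = (\<Sum>\<pi> | \<pi> permutes {..<?n}. - (of_int (sign (?\<tau> \<circ> \<pi>)) * T (\<lambda>i. B $ ix ((?\<tau> \<circ> \<pi>) i))))"
      unfolding w_def
    proof (intro sum.cong refl)
      fix \<pi> assume "\<pi> \<in> {\<pi>. \<pi> permutes {..<?n}}"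
      then have \<pi>: "\<pi> permutes {..<?n}" by simp
      have "T (\<lambda>i. (\<chi> j. B $ Transposition.transpose m n j) $ ix (\<pi> i)) = T (\<lambda>i. B $ ix ((?\<tau> \<circ> \<pi>) i))"
      proof (rule cong)
        fix i assume "i < ?n"
        then have "\<pi> i < ?n" by (rule lt[OF \<pi>])
        then have "Transposition.transpose m n (ix (\<pi> i)) = ix (?\<tau> (\<pi> i))"
          using ixi ixi' by (auto simp: Transposition.transpose_def)
        then show "(\<chi> j. B $ Transposition.transpose m n j) $ ix (\<pi> i) = B $ ix ((?\<tau> \<circ> \<pi>) i)"
          by simp
      qed
      moreover have "permutation \<pi>" "permutation ?\<tau>"
        using \<pi> \<tau> permutation_permutes finite_lessThan by blast+
      ultimately show "of_int (sign \<pi>) * T (\<lambda>i. (\<chi> j. B $ Transposition.transpose m n j) $ ix (\<pi> i))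
          = - (of_int (sign (?\<tau> \<circ> \<pi>)) * T (\<lambda>i. B $ ix ((?\<tau> \<circ> \<pi>) i)))"
        using ne by (simp only: sign_compose sign_swap_id) simp
    qed
    also have "\<dots> = - w B"
      unfolding w_def sum_negf
      using setum_permutations_compose_left[OF \<tau>, of "\<lambda>\<pi>. of_int (sign \<pi>) * T (\<lambda>i. B $ ix (\<pi> i))"] by simp
    finally show "w (\<chi> j. B $ Transposition.transpose m n j) = - w B" .
  qed
  moreover have "w (transpose J ** mat 1)
      = (\<Sum>\<pi> | \<pi> permutes {..<?n}. of_int (sign \<pi>) * T (\<lambda>i. J *v frame_vec (\<pi> i)))"
    unfolding w_def
    by (intro sum.cong refl arg_cong2[where f = "(*)"] cong)
       (simp add: frame lt matrix_vector_mult_basis column_def transpose_def vec_eq_iff)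
  moreover have "w (mat 1) = (\<Sum>\<pi> | \<pi> permutes {..<?n}. of_int (sign \<pi>) * T (\<lambda>i. frame_vec (\<pi> i)))"
    unfolding w_def
    by (intro sum.cong refl arg_cong2[where f = "(*)"] cong)
       (auto simp: frame lt mat_def axis_def vec_eq_iff)
  ultimately show ?thesis
    by (simp add: det_transpose)
qed

text \<open>For alternating a, b and linear u this is \<open>(fact p)^2\<close> times the value on f
  of the wedge product of a, u and b in that order. The 1-form u occupies the middle slot, the one
  along which \<open>wedge_d_coeff\<close> differentiates.\<close>

definition theta ::
  "nat \<Rightarrow> (real^'n \<Rightarrow> real) \<Rightarrow> ((real^'n) list \<Rightarrow> real) \<Rightarrow> ((real^'n) list \<Rightarrow> real) \<Rightarrow> (nat \<Rightarrow> real^'n) \<Rightarrow> real" where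
  "theta p u a b f = (\<Sum>\<pi> | \<pi> permutes {..<p + p + 1}. of_int (sign \<pi>) *
     (u (f (\<pi> p)) * (a (map (f \<circ> \<pi>) [0..<p]) * b (map (f \<circ> \<pi>) [p + 1..<p + p + 1]))))"

text \<open>The product under the permutation sum is linear in each of its 2p + 1 arguments, since
  every slot belongs to exactly one factor.\<close>

lemma theta_det:
  fixes u :: "real^'n::{finite,wellorder} \<Rightarrow> real"
  assumes "CARD('n) = p + p + 1" and u: "linear u" and a: "alternating p a" and b: "alternating p b"
  shows "theta p u a b (\<lambda>i. J *v frame_vec i) = det J * theta p u a b frame_vec"
proof -
  define T where "T f = u (f p) * (a (map f [0..<p]) * b (map f [p + 1..<p + p + 1]))" for f :: "nat \<Rightarrow> (real, 'n) vec"
  have "(\<Sum>\<pi> | \<pi> permutes {..<CARD('n)}. of_int (sign \<pi>) * T (\<lambda>i. J *v frame_vec (\<pi> i)))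
    = det J * (\<Sum>\<pi> | \<pi> permutes {..<CARD('n)}. of_int (sign \<pi>) * T (\<lambda>i. frame_vec (\<pi> i)))"
  proof (rule antisymmetrized_multilinear_det)
    fix f :: "nat \<Rightarrow> (real, 'n) vec" and i assume i: "i < CARD('n)"
    consider "i < p" | "i = p" | "p < i" by linarith
    then show "linear (\<lambda>v. T (f(i := v)))"
    proof cases
      case 1
      have "map (f(i := v)) [0..<p] = (map f [0..<p])[i := v]" for v
        using 1 by (intro nth_equalityI) (auto simp: nth_list_update)
      moreover have "map (f(i := v)) [p + 1..<p + p + 1] = map f [p + 1..<p + p + 1]" for v
        using 1 by (intro map_cong) auto
      ultimately have "T (f(i := v)) = (u (f p) * b (map f [p + 1..<p + p + 1])) *\<^sub>R a ((map f [0..<p])[i := v])" for v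
        using 1 unfolding T_def by simp
      moreover have "linear (\<lambda>v. a ((map f [0..<p])[i := v]))"
        using a 1 unfolding alternating_def by simp
      ultimately show ?thesis
        by (simp only: linear_compose_scale_right)
    next
      case 2
      have "map (f(i := v)) [p + 1..<p + p + 1] = map f [p + 1..<p + p + 1]"
        "map (f(i := v)) [0..<p] = map f [0..<p]" for v
        using 2 by (intro map_cong; auto)+
      then have "T (f(i := v)) = (a (map f [0..<p]) * b (map f [p + 1..<p + p + 1])) *\<^sub>R u v" for v
        using 2 unfolding T_def by simp
      then show ?thesis
        using u by (simp only: linear_compose_scale_right)
    next
      case 3
      have "map (f(i := v)) [p + 1..<p + p + 1] = (map f [p + 1..<p + p + 1])[i - (p + 1) := v]" for v
        using 3 i by (intro nth_equalityI) (auto simp: nth_list_update simp del: upt_Suc)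
      moreover have "map (f(i := v)) [0..<p] = map f [0..<p]" for v
        using 3 by (intro map_cong) auto
      ultimately have "T (f(i := v)) = (u (f p) * a (map f [0..<p])) *\<^sub>R b ((map f [p + 1..<p + p + 1])[i - (p + 1) := v])" for v
        using 3 unfolding T_def by simp
      moreover have "linear (\<lambda>v. b ((map f [p + 1..<p + p + 1])[i - (p + 1) := v]))"
        using b 3 i assms(1) unfolding alternating_def by (simp del: upt_Suc)
      ultimately show ?thesis
        by (simp only: linear_compose_scale_right)
    qed
  next
    fix f g :: "nat \<Rightarrow> (real, 'n) vec" assume "\<And>i. i < CARD('n) \<Longrightarrow> f i = g i"
    then have "map f [0..<p] = map g [0..<p]" "map f [p + 1..<p + p + 1] = map g [p + 1..<p + p + 1]" "f p = g p"
      using assms(1) by auto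
    then show "T f = T g"
      unfolding T_def by metis
  qed
  then show ?thesis
    unfolding theta_def T_def assms(1) by (simp only: o_def)
qed

section \<open>The coefficient of \<alpha> d\<beta> and the Leibniz rule\<close>

text \<open>The factor 1 / (fact p)^2 is left out, so that the product rule acts on bare permutation
  sums; \<open>wedge_ext_deriv_frame\<close> restores it.\<close>

definition wedge_d_coeff ::
  "nat \<Rightarrow> ('a, 'n::{finite,wellorder}) form \<Rightarrow> ('a, 'n) form \<Rightarrow> ('a, 'n) chart \<Rightarrow> (real, 'n) vec \<Rightarrow> real" where
  "wedge_d_coeff p \<alpha> \<beta> c x = (\<Sum>\<pi> | \<pi> permutes {..<p + p + 1}. of_int (sign \<pi>) *
     (\<alpha> c x (map (frame_vec \<circ> \<pi>) [0..<p]) *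
      frechet_derivative (\<lambda>y. \<beta> c y (map (frame_vec \<circ> \<pi>) [p + 1..<p + p + 1])) (at x) (frame_vec (\<pi> p))))"

text \<open>The p + 1 equal terms of \<open>wedge_exterior_sum\<close> reduce the normalisation by
  p! (p + 1)! to one by the square of p!.\<close>

lemma wedge_ext_deriv_frame:
  fixes M :: "('a, 'n::{finite,wellorder}) riem_manifold"
  assumes "CARD('n) = p + p + 1" "c \<in> atlas M" "x \<in> chart_image c"
  shows "wedge p (p + 1) \<alpha> (ext_deriv M \<beta>) c x std_frame = wedge_d_coeff p \<alpha> \<beta> c x / (fact p)\<^sup>2"
proof -
  let ?D = "\<lambda>vs. frechet_derivative (\<lambda>y. \<beta> c y vs) (at x)"
  have d: "ext_deriv M \<beta> c x (map (frame_vec \<circ> \<pi>) [p..<p + p + 1]) =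
      (\<Sum>i<p + 1. (- 1) ^ i * ?D (map (frame_vec \<circ> \<pi>) ([p..<p + i] @ [p + i + 1..<p + p + 1])) (frame_vec (\<pi> (p + i))))"
    for \<pi>
  proof -
    define vs :: "(real, 'n) vec list" where "vs = map (frame_vec \<circ> \<pi>) [p..<p + p + 1]"
    have len: "length vs = p + 1"
      by (simp add: vs_def del: upt_Suc)
    have "ext_deriv M \<beta> c x vs = (\<Sum>i<p + 1. (- 1) ^ i * ?D (take i vs @ drop (Suc i) vs) (vs ! i))"
      unfolding ext_deriv_def on_charts_def len using assms(2,3) by simp
    also have "\<dots> = (\<Sum>i<p + 1. (- 1) ^ i *
        ?D (map (frame_vec \<circ> \<pi>) ([p..<p + i] @ [p + i + 1..<p + p + 1])) (frame_vec (\<pi> (p + i))))"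
    proof (intro sum.cong refl)
      fix i assume "i \<in> {..<p + 1}"
      then have "take i vs @ drop (Suc i) vs = map (frame_vec \<circ> \<pi>) ([p..<p + i] @ [p + i + 1..<p + p + 1])"
        "vs ! i = frame_vec (\<pi> (p + i))"
        unfolding vs_def by (simp_all add: take_map drop_map del: upt_Suc)
      then show "(- 1) ^ i * ?D (take i vs @ drop (Suc i) vs) (vs ! i) = (- 1) ^ i *
          ?D (map (frame_vec \<circ> \<pi>) ([p..<p + i] @ [p + i + 1..<p + p + 1])) (frame_vec (\<pi> (p + i)))"
        by (simp only:)
    qed
    finally show ?thesis
      by (simp only: vs_def)
  qed
  have "wedge p (p + 1) \<alpha> (ext_deriv M \<beta>) c x std_frame =
     (\<Sum>\<pi> | \<pi> permutes {..<p + p + 1}. of_int (sign \<pi>) * (\<alpha> c x (map (frame_vec \<circ> \<pi>) [0..<p]) *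
        ext_deriv M \<beta> c x (map (frame_vec \<circ> \<pi>) [p..<p + p + 1]))) / (fact p * fact (p + 1))"
    unfolding wedge_def using assms(1) by (simp add: length_std_frame o_def mult.assoc del: upt_Suc)
  also have "\<dots> = real (p + 1) * wedge_d_coeff p \<alpha> \<beta> c x / (fact p * fact (p + 1))"
    unfolding d wedge_d_coeff_def
    by (subst wedge_exterior_sum[where q = p and Db = ?D]) (rule refl)
  also have "\<dots> = wedge_d_coeff p \<alpha> \<beta> c x / (fact p)\<^sup>2"
  proof -
    have "r * w / (f * (r * f)) = w / f\<^sup>2" if "r \<noteq> 0" for r w f :: real
      using that by (simp add: power2_eq_square)
    moreover have "fact (p + 1) = real (p + 1) * fact p" "real (p + 1) \<noteq> 0"
      by simp_all
    ultimately show ?thesis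
      by (simp only: not_False_eq_True)
  qed
  finally show ?thesis .
qed

text \<open>After \<open>block_swap_sum\<close> both sums differentiate along slot p and keep
  \<alpha> on the first block and \<beta> on the last, so the product rule applies termwise.\<close>

lemma wedge_d_coeff_symmetrized:
  assumes "even p" and "\<And>vs. (\<lambda>y. \<alpha> c y vs) differentiable (at x)" "\<And>vs. (\<lambda>y. \<beta> c y vs) differentiable (at x)"
  shows "wedge_d_coeff p \<alpha> \<beta> c x + wedge_d_coeff p \<beta> \<alpha> c x =
    (\<Sum>\<pi> | \<pi> permutes {..<p + p + 1}. of_int (sign \<pi>) *
      frechet_derivative (\<lambda>y. \<alpha> c y (map (frame_vec \<circ> \<pi>) [0..<p]) * \<beta> c y (map (frame_vec \<circ> \<pi>) [p + 1..<p + p + 1]))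
        (at x) (frame_vec (\<pi> p)))"
proof -
  have "frechet_derivative (\<lambda>y. \<alpha> c y v * \<beta> c y w) (at x) h =
      \<alpha> c x v * frechet_derivative (\<lambda>y. \<beta> c y w) (at x) h + \<beta> c x w * frechet_derivative (\<lambda>y. \<alpha> c y v) (at x) h" for v w h
  proof -
    have "((\<lambda>y. \<alpha> c y v * \<beta> c y w) has_derivative
       (\<lambda>h. \<alpha> c x v * frechet_derivative (\<lambda>y. \<beta> c y w) (at x) h + frechet_derivative (\<lambda>y. \<alpha> c y v) (at x) h * \<beta> c x w)) (at x)"
      using assms(2,3) by (intro has_derivative_mult) (auto simp: frechet_derivative_works)
    then show ?thesis
      by (simp add: frechet_derivative_at[symmetric] mult.commute)
  qed
  moreover have "wedge_d_coeff p \<beta> \<alpha> c x = (\<Sum>\<pi> | \<pi> permutes {..<p + p + 1}. of_int (sign \<pi>) *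
     (\<beta> c x (map (frame_vec \<circ> \<pi>) [p + 1..<p + p + 1]) *
      frechet_derivative (\<lambda>y. \<alpha> c y (map (frame_vec \<circ> \<pi>) [0..<p])) (at x) (frame_vec (\<pi> p))))"
    unfolding wedge_d_coeff_def
    by (rule block_swap_sum[OF assms(1), where Da = "\<lambda>vs. frechet_derivative (\<lambda>y. \<alpha> c y vs) (at x)"])
  ultimately show ?thesis
    by (simp only: wedge_d_coeff_def[of p \<alpha> \<beta>] sum.distrib[symmetric] distrib_left)
qed

section \<open>Charts and partitions of unity\<close>

locale closed_manifold =
  fixes M :: "('a, 'n::finite) riem_manifold"
  assumes closed_M: "closed_oriented_riemannian_manifold M"
begin

lemma Hausdorff_M: "Hausdorff_space (mtop M)" and compact_M: "compact_space (mtop M)"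
  and smooth_atlas: "oriented_smooth_atlas (mtop M) (atlas M)"
  using closed_M by (auto simp: closed_oriented_riemannian_manifold_def)

context
  fixes c assumes c: "c \<in> atlas M"
begin

lemma open_chart_domain: "openin (mtop M) (fst c)"
  and open_chart_image: "open (chart_image c)"
  and chart_homeomorphic_map:
    "homeomorphic_map (subtopology (mtop M) (fst c)) (top_of_set (chart_image c)) (snd c)"
  using smooth_atlas c by (auto simp: oriented_smooth_atlas_def)

lemma chart_domain_subset: "fst c \<subseteq> topspace (mtop M)"
  using open_chart_domain openin_subset by blast

lemma inj_on_chart: "inj_on (snd c) (fst c)"
  using homeomorphic_imp_injective_map[OF chart_homeomorphic_map] chart_domain_subset
  by (simp add: Int_absorb1)

lemma chart_inv_chart: "y \<in> fst c \<Longrightarrow> chart_inv c (snd c y) = y"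
  by (simp add: chart_inv_def inj_on_chart)

lemma chart_chart_inv: "x \<in> chart_image c \<Longrightarrow> snd c (chart_inv c x) = x"
  by (simp add: chart_inv_def chart_image_def f_inv_into_f)

lemma chart_inv_in: "x \<in> chart_image c \<Longrightarrow> chart_inv c x \<in> fst c"
  by (simp add: chart_inv_def chart_image_def inv_into_into)

lemma chart_in: "y \<in> fst c \<Longrightarrow> snd c y \<in> chart_image c"
  by (simp add: chart_image_def)

lemma open_chart_preimage:
  assumes "openin (mtop M) W"
  shows "open {x \<in> chart_image c. chart_inv c x \<in> W}"
proof -
  have "openin (subtopology (mtop M) (fst c)) (fst c \<inter> W)"
    using assms by (simp add: openin_subtopology_Int2)
  then have "openin (top_of_set (chart_image c)) (snd c ` (fst c \<inter> W))"
    using homeomorphic_imp_open_map[OF chart_homeomorphic_map] by (auto simp: open_map_def)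
  then have "open (snd c ` (fst c \<inter> W))"
    using open_chart_image openin_open_trans by blast
  also have "snd c ` (fst c \<inter> W) = {x \<in> chart_image c. chart_inv c x \<in> W}"
    using chart_inv_chart chart_chart_inv chart_inv_in by (force simp: chart_image_def)
  finally show ?thesis .
qed

text \<open>Compactness of M makes C compact; supports inside a chart thus become compact sets of
  coordinates, as the local Stokes formula requires.\<close>

lemma compact_chart_support:
  assumes "closedin (mtop M) C" "C \<subseteq> fst c"
  shows "compact (snd c ` C)" "snd c ` C \<subseteq> chart_image c"
proof -
  have "compactin (mtop M) C"
    using assms(1) compact_M closedin_compact_space by blast
  then have "compactin (subtopology (mtop M) (fst c)) C"
    using assms(2) by (simp add: compactin_subtopology)
  then have "compactin (top_of_set (chart_image c)) (snd c ` C)"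
    using image_compactin homeomorphic_imp_continuous_map[OF chart_homeomorphic_map] by blast
  then show "compact (snd c ` C)" "snd c ` C \<subseteq> chart_image c"
    by (auto simp: compactin_subtopology)
qed

text \<open>Compact sets are closed in M because M is Hausdorff. This makes the support of a bump
  closed in all of M, not only in its chart.\<close>

lemma closedin_chart_preimage:
  assumes "compact K" "K \<subseteq> chart_image c"
  shows "closedin (mtop M) {y \<in> fst c. snd c y \<in> K}"
proof -
  obtain g where g: "homeomorphic_maps (subtopology (mtop M) (fst c)) (top_of_set (chart_image c)) (snd c) g"
    using chart_homeomorphic_map homeomorphic_map_maps by blast
  have "compactin (top_of_set (chart_image c)) K"
    using assms by (simp add: compactin_subtopology)
  then have "compactin (subtopology (mtop M) (fst c)) (g ` K)"
    using g image_compactin by (fastforce simp: homeomorphic_maps_def)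
  then have "compactin (mtop M) (g ` K)"
    by (simp add: compactin_subtopology)
  moreover have "g ` K = {y \<in> fst c. snd c y \<in> K}"
  proof -
    have "g (snd c y) = y" if "y \<in> fst c" for y
      using g that chart_domain_subset by (auto simp: homeomorphic_maps_def)
    moreover have "snd c (g x) = x" "g x \<in> fst c" if "x \<in> K" for x
      using g that assms(2) by (auto simp: homeomorphic_maps_def continuous_map_def)
    ultimately show ?thesis
      by force
  qed
  ultimately show ?thesis
    using Hausdorff_M compactin_imp_closedin by metis
qed

end

lemma overlap_iff:
  assumes "c \<in> atlas M"
  shows "x \<in> overlap c c' \<longleftrightarrow> x \<in> chart_image c \<and> chart_inv c x \<in> fst c'"
  unfolding overlap_def
  using chart_inv_chart[OF assms] chart_chart_inv[OF assms] chart_inv_in[OF assms] chart_in[OF assms] by force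

context
  fixes c c' assumes c: "c \<in> atlas M" and c': "c' \<in> atlas M"
begin

lemma open_overlap: "open (overlap c c')"
proof -
  have "overlap c c' = {x \<in> chart_image c. chart_inv c x \<in> fst c'}"
    by (auto simp: overlap_iff[OF c])
  then show ?thesis
    using open_chart_preimage[OF c open_chart_domain[OF c']] by simp
qed

lemma overlap_subset: "overlap c c' \<subseteq> chart_image c"
  using overlap_iff[OF c] by blast

lemma smooth_transition: "smooth_on (overlap c c') (transition c c')"
  and det_jacobian_pos: "x \<in> overlap c c' \<Longrightarrow> det (matrix (jacobian_map c c' x)) > 0"
  using smooth_atlas c c' unfolding oriented_smooth_atlas_def by blast+

lemma transition_in:
  assumes "x \<in> overlap c c'"
  shows "transition c c' x \<in> overlap c' c" "chart_inv c' (transition c c' x) = chart_inv c x"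
  using assms chart_inv_chart[OF c'] chart_in[OF c'] chart_inv_in[OF c]
  by (auto simp: overlap_iff[OF c] overlap_iff[OF c'] transition_def)

lemma transition_transition: "x \<in> overlap c c' \<Longrightarrow> transition c' c (transition c c' x) = x"
  using transition_in(2) chart_chart_inv[OF c] by (auto simp: transition_def overlap_iff[OF c])

lemma transition_has_derivative:
  assumes "x \<in> overlap c c'"
  shows "(transition c c' has_derivative jacobian_map c c' x) (at x)"
  unfolding jacobian_map_def
  using smooth_transition assms by (intro C_on_has_derivative[OF open_overlap]) (auto simp: smooth_on_def)

end

lemma bij_betw_transition:
  assumes "c \<in> atlas M" "c' \<in> atlas M"
  shows "bij_betw (transition c c') (overlap c c') (overlap c' c)"
  by (rule bij_betw_byWitness[where f' = "transition c' c"])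
     (auto simp: transition_transition transition_in assms)

end

section \<open>Bump functions and partitions of unity\<close>

text \<open>The squared norm is polynomial in the coordinates, hence smooth also at the centre. For
  r > 0 the composite is positive exactly inside the ball of radius r.\<close>

lemma C_on_ball_profile:
  fixes x0 :: "'a::euclidean_space"
  shows "C_on m UNIV (\<lambda>x. flat_exp 0 (r\<^sup>2 - (norm (x - x0))\<^sup>2))"
proof (rule C_on_compose[OF open_UNIV open_UNIV _ C_on_flat_exp])
  have "C_on m UNIV (\<lambda>x. r\<^sup>2 + - 1 * (\<Sum>b\<in>Basis. (x \<bullet> b + - (x0 \<bullet> b)) * (x \<bullet> b + - (x0 \<bullet> b))))"
    by (intro C_on_add C_on_const C_on_sum C_on_mult C_on_linear bounded_linear_inner_left) auto
  also have "(\<lambda>x. r\<^sup>2 + - 1 * (\<Sum>b\<in>Basis. (x \<bullet> b + - (x0 \<bullet> b)) * (x \<bullet> b + - (x0 \<bullet> b))))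
      = (\<lambda>x. r\<^sup>2 - (norm (x - x0))\<^sup>2)"
    unfolding power2_norm_eq_inner euclidean_inner[of "x - x0" "x - x0" for x]
    by (simp add: fun_eq_iff inner_diff_left)
  finally show "C_on m UNIV (\<lambda>x. r\<^sup>2 - (norm (x - x0))\<^sup>2)" .
qed simp

context closed_manifold
begin

lemma smooth_function_sum:
  "(\<And>i. i \<in> I \<Longrightarrow> smooth_function M (f i)) \<Longrightarrow> smooth_function M (\<lambda>y. \<Sum>i\<in>I. f i y)"
  unfolding smooth_function_def smooth_on_def o_def by (intro ballI allI C_on_sum open_chart_image) auto

lemma smooth_function_mult:
  "smooth_function M f \<Longrightarrow> smooth_function M g \<Longrightarrow> smooth_function M (\<lambda>y. f y * g y)"
  unfolding smooth_function_def smooth_on_def o_def by (intro ballI allI C_on_mult open_chart_image) auto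

lemma smooth_function_inverse:
  assumes "smooth_function M f" "\<And>y. y \<in> topspace (mtop M) \<Longrightarrow> f y > 0"
  shows "smooth_function M (\<lambda>y. inverse (f y))"
  unfolding smooth_function_def smooth_on_def o_def
proof (intro ballI allI)
  fix c m assume c: "c \<in> atlas M"
  show "C_on m (chart_image c) (\<lambda>x. inverse (f (chart_inv c x)))"
  proof (rule C_on_compose[OF open_chart_image[OF c] open_greaterThan _ C_on_inverse])
    show "(\<lambda>x. f (chart_inv c x)) ` chart_image c \<subseteq> {0<..}"
      using assms(2) chart_inv_in[OF c] chart_domain_subset[OF c] by auto
    show "C_on m (chart_image c) (\<lambda>x. f (chart_inv c x))"
      using assms(1) c by (simp add: smooth_function_def smooth_on_def o_def)
  qed
qed

lemma bump_function:
  assumes "y0 \<in> topspace (mtop M)"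
  shows "\<exists>c b W C. c \<in> atlas M \<and> smooth_function M b \<and> (\<forall>y. b y \<ge> 0) \<and>
    openin (mtop M) W \<and> y0 \<in> W \<and> (\<forall>y\<in>W. b y > 0) \<and>
    closedin (mtop M) C \<and> C \<subseteq> fst c \<and> (\<forall>y. y \<notin> C \<longrightarrow> b y = 0)"
proof -
  obtain c where c: "c \<in> atlas M" "y0 \<in> fst c"
    using assms smooth_atlas unfolding oriented_smooth_atlas_def by blast
  define x0 where "x0 = snd c y0"
  obtain r where r: "r > 0" "cball x0 r \<subseteq> chart_image c"
    using open_chart_image[OF c(1)] chart_in[OF c(1) c(2)] open_contains_cball by (metis x0_def)
  define b where "b y = (if y \<in> fst c then flat_exp 0 (r\<^sup>2 - (norm (snd c y - x0))\<^sup>2) else 0)" for y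
  define W where "W = {y \<in> fst c. snd c y \<in> ball x0 r}"
  define C where "C = {y \<in> fst c. snd c y \<in> cball x0 r}"
  have "openin (subtopology (mtop M) (fst c)) {y \<in> topspace (subtopology (mtop M) (fst c)). snd c y \<in> ball x0 r}"
  proof (rule openin_continuous_map_preimage)
    show "continuous_map (subtopology (mtop M) (fst c)) (top_of_set (chart_image c)) (snd c)"
      by (rule homeomorphic_imp_continuous_map[OF chart_homeomorphic_map[OF c(1)]])
    show "openin (top_of_set (chart_image c)) (ball x0 r)"
      using r(2) ball_subset_cball open_subset open_ball by (metis order_trans)
  qed
  moreover have "{y \<in> topspace (subtopology (mtop M) (fst c)). snd c y \<in> ball x0 r} = W"
    using chart_domain_subset[OF c(1)] by (auto simp: W_def)
  ultimately have W: "openin (mtop M) W"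
    using open_chart_domain[OF c(1)] openin_trans_full by metis
  have C: "closedin (mtop M) C"
    unfolding C_def by (rule closedin_chart_preimage[OF c(1) compact_cball r(2)])
  have b0: "b y = 0" if "y \<notin> C" for y
  proof (cases "y \<in> fst c")
    case True
    then have "r < norm (snd c y - x0)"
      using that by (auto simp: C_def dist_norm norm_minus_commute)
    then have "r\<^sup>2 < (norm (snd c y - x0))\<^sup>2"
      using r(1) by (intro power_strict_mono) auto
    then show ?thesis
      by (simp add: b_def flat_exp_def)
  qed (simp add: b_def)
  have bpos: "b y > 0" if "y \<in> W" for y
  proof -
    have "norm (snd c y - x0) < r"
      using that by (auto simp: W_def dist_norm norm_minus_commute)
    then have "(norm (snd c y - x0))\<^sup>2 < r\<^sup>2"
      by (intro power_strict_mono) auto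
    then show ?thesis
      using that by (simp add: b_def flat_exp_def W_def)
  qed
  have "smooth_function M b"
    unfolding smooth_function_def smooth_on_def o_def
  proof (intro ballI allI C_on_local)
    fix c' m x assume c': "c' \<in> atlas M" and x: "x \<in> chart_image c'"
    \<comment> \<open>On the overlap with c the defining formula is smooth. At a point outside the
      domain of c the function vanishes nearby, because the complement of the closed set C is
      open.\<close>
    show "\<exists>U. open U \<and> x \<in> U \<and> C_on m U (\<lambda>x. b (chart_inv c' x))"
    proof (cases "chart_inv c' x \<in> fst c")
      case True
      have "C_on m (overlap c' c) (\<lambda>z. flat_exp 0 (r\<^sup>2 - (norm (transition c' c z - x0))\<^sup>2))"
        using smooth_transition[OF c' c(1)]
        by (intro C_on_compose[OF open_overlap[OF c' c(1)] open_UNIV _ C_on_ball_profile])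
           (auto simp: smooth_on_def)
      then have "C_on m (overlap c' c) (\<lambda>x. b (chart_inv c' x))"
        by (rule C_on_cong[OF open_overlap[OF c' c(1)], rotated])
           (auto simp: b_def transition_def overlap_iff[OF c'])
      then show ?thesis
        using True x open_overlap[OF c' c(1)] overlap_iff[OF c'] by blast
    next
      case False
      let ?U = "{z \<in> chart_image c'. chart_inv c' z \<in> topspace (mtop M) - C}"
      have U: "open ?U"
        by (rule open_chart_preimage[OF c']) (use C in blast)
      moreover have "x \<in> ?U"
        using False x chart_inv_in[OF c' x] chart_domain_subset[OF c'] by (auto simp: C_def)
      moreover have "C_on m ?U (\<lambda>x. b (chart_inv c' x))"
        by (rule C_on_cong[OF U _ C_on_const[OF U, of _ 0]]) (auto simp: b0)
      ultimately show ?thesis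
        by blast
    qed
  qed
  moreover have "b y \<ge> 0" for y
    by (simp add: b_def flat_exp_def)
  moreover have "y0 \<in> W"
    using c(2) r(1) by (simp add: W_def x0_def)
  moreover have "C \<subseteq> fst c"
    by (auto simp: C_def)
  ultimately show ?thesis
    using c(1) W C b0 bpos by blast
qed

theorem partition_of_unity_exists: "\<exists>F \<rho>. partition_of_unity M F \<rho>"
proof -
  let ?X = "topspace (mtop M)"
  obtain c b W C where bump: "\<And>y. y \<in> ?X \<Longrightarrow> c y \<in> atlas M \<and> smooth_function M (b y) \<and> (\<forall>z. b y z \<ge> 0) \<and>
    openin (mtop M) (W y) \<and> y \<in> W y \<and> (\<forall>z\<in>W y. b y z > 0) \<and>
    closedin (mtop M) (C y) \<and> C y \<subseteq> fst (c y) \<and> (\<forall>z. z \<notin> C y \<longrightarrow> b y z = 0)"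
    using bump_function by metis
  have "compactin (mtop M) ?X"
    using compact_M by (simp add: compact_space_def)
  moreover have "openin (mtop M) U" if "U \<in> W ` ?X" for U
    using that bump by auto
  moreover have "?X \<subseteq> \<Union>(W ` ?X)"
    using bump by blast
  ultimately obtain \<F> where \<F>: "finite \<F>" "\<F> \<subseteq> W ` ?X" "?X \<subseteq> \<Union>\<F>"
    using compactinD by metis
  obtain Y where Y: "Y \<subseteq> ?X" "finite Y" "\<F> = W ` Y"
    using finite_subset_image[OF \<F>(1,2)] by blast
  have cover: "?X \<subseteq> (\<Union>y\<in>Y. W y)"
    using \<F>(3) Y(3) by simp
  define S where "S z = (\<Sum>y\<in>Y. b y z)" for z
  \<comment> \<open>Different points may have received the same chart, whereas the partition is
    indexed by charts; so bumps with the same chart are added up.\<close>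
  define \<rho> where "\<rho> d z = (\<Sum>y\<in>{y \<in> Y. c y = d}. b y z) * inverse (S z)" for d z
  have S: "S z > 0" if z: "z \<in> ?X" for z
  proof -
    obtain y where "y \<in> Y" "z \<in> W y"
      using cover z by blast
    then show ?thesis
      unfolding S_def using Y bump by (intro sum_pos2[of _ y]) auto
  qed
  have "partition_of_unity M (c ` Y) \<rho>"
    unfolding partition_of_unity_def
  proof (intro conjI ballI)
    show "finite (c ` Y)" "c ` Y \<subseteq> atlas M"
      using Y bump by auto
    fix d
    show "smooth_function M (\<rho> d)"
      unfolding \<rho>_def using Y bump S
      by (intro smooth_function_mult smooth_function_inverse) (auto simp: S_def intro!: smooth_function_sum)
    show "\<rho> d z \<ge> 0" if "z \<in> ?X" for z
      unfolding \<rho>_def using Y bump S[OF that] by (intro mult_nonneg_nonneg sum_nonneg) auto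
    have "closedin (mtop M) (\<Union>y\<in>{y \<in> Y. c y = d}. C y)"
      using Y bump by (intro closedin_Union) auto
    moreover have "\<rho> d z = 0" if "z \<notin> (\<Union>y\<in>{y \<in> Y. c y = d}. C y)" for z
    proof -
      have "b y z = 0" if "y \<in> Y" "c y = d" for y
        using that bump[of y] Y(1) \<open>z \<notin> _\<close> by auto
      then show ?thesis
        by (simp add: \<rho>_def)
    qed
    ultimately have "mtop M closure_of {z \<in> ?X. \<rho> d z \<noteq> 0} \<subseteq> (\<Union>y\<in>{y \<in> Y. c y = d}. C y)"
      by (intro closure_of_minimal) auto
    also have "\<dots> \<subseteq> fst d"
      using Y bump by auto
    finally show "mtop M closure_of {z \<in> ?X. \<rho> d z \<noteq> 0} \<subseteq> fst d" .
  next
    fix z assume z: "z \<in> ?X"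
    have "(\<Sum>d\<in>c ` Y. \<Sum>y\<in>{y \<in> Y. c y = d}. b y z) = S z"
      unfolding S_def using sum.image_gen[OF Y(2), of "\<lambda>y. b y z" c] by simp
    then show "(\<Sum>d\<in>c ` Y. \<rho> d z) = 1"
      unfolding \<rho>_def sum_distrib_right[symmetric] using S[OF z] by simp
  qed
  then show ?thesis
    by blast
qed

end

section \<open>Skew symmetry of the integral\<close>

text \<open>Real integrands are carried through \<open>real^1\<close>, and the single component is
  read off at the end.\<close>

lemma integral_change_of_variables_real:
  fixes f :: "real^'n::{finite,wellorder} \<Rightarrow> real"
  assumes S: "S \<in> sets lebesgue" and d: "\<And>x. x \<in> S \<Longrightarrow> (g has_derivative g' x) (at x within S)"
    and inj: "inj_on g S" and f: "f absolutely_integrable_on g ` S"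
  shows "integral (g ` S) f = integral S (\<lambda>x. \<bar>det (matrix (g' x))\<bar> * f (g x))"
proof -
  have lin: "bounded_linear (\<lambda>r :: real. (vec r :: real^1))"
    by (intro linear_conv_bounded_linear[THEN iffD1] linearI) (auto simp: vec_eq_iff)
  have F: "(\<lambda>x. vec (f x) :: real^1) absolutely_integrable_on g ` S"
    using absolutely_integrable_linear[OF f lin] by (simp add: o_def)
  moreover have "(\<lambda>x. vec (f x) :: real^1) absolutely_integrable_on g ` S \<longleftrightarrow>
      (\<lambda>x. \<bar>det (matrix (g' x))\<bar> *\<^sub>R (vec (f (g x)) :: real^1)) absolutely_integrable_on S"
    by (rule absolutely_integrable_change_of_variables[OF S d inj])
  ultimately have G: "(\<lambda>x. \<bar>det (matrix (g' x))\<bar> *\<^sub>R (vec (f (g x)) :: real^1)) absolutely_integrable_on S"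
    by blast
  have "integral (g ` S) f = integral (g ` S) (\<lambda>x. vec (f x) :: real^1) $ 1"
    using integral_linear[OF set_lebesgue_integral_eq_integral(1)[OF F] bounded_linear_vec_nth[of 1]]
    by (simp add: o_def)
  also have "integral (g ` S) (\<lambda>x. vec (f x) :: real^1)
      = integral S (\<lambda>x. \<bar>det (matrix (g' x))\<bar> *\<^sub>R (vec (f (g x)) :: real^1))"
    using F by (intro integral_change_of_variables[OF S d inj]) auto
  also have "\<dots> $ 1 = integral S (\<lambda>x. \<bar>det (matrix (g' x))\<bar> * f (g x))"
    using integral_linear[OF set_lebesgue_integral_eq_integral(1)[OF G] bounded_linear_vec_nth[of 1]]
    by (simp add: o_def)
  finally show ?thesis .
qed

locale partitioned_manifold = closed_manifold M
  for M :: "('a, 'n::{finite,wellorder}) riem_manifold" +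
  fixes F :: "('a, 'n) chart set" and \<rho> :: "('a, 'n) chart \<Rightarrow> 'a \<Rightarrow> real" and p :: nat
  assumes partition: "partition_of_unity M F \<rho>" and dim: "CARD('n) = p + p + 1"
begin

lemma finite_F: "finite F" and F_atlas: "c \<in> F \<Longrightarrow> c \<in> atlas M"
  using partition by (auto simp: partition_of_unity_def)

text \<open>The first index names the member of the partition, the second the chart whose
  coordinates are used; the rearrangement in \<open>sum_integral_\<Theta>\<close> varies them
  separately.\<close>

definition loc :: "('a, 'n) chart \<Rightarrow> ('a, 'n) chart \<Rightarrow> (real, 'n) vec \<Rightarrow> real" where
  "loc d c x = \<rho> d (chart_inv c x)"

definition dloc :: "('a, 'n) chart \<Rightarrow> ('a, 'n) chart \<Rightarrow> (real, 'n) vec \<Rightarrow> (real, 'n) vec \<Rightarrow> real" where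
  "dloc d c x = frechet_derivative (loc d c) (at x)"

definition supp :: "('a, 'n) chart \<Rightarrow> 'a set" where
  "supp d = mtop M closure_of {y \<in> topspace (mtop M). \<rho> d y \<noteq> 0}"

lemma loc_smooth: "d \<in> F \<Longrightarrow> c \<in> atlas M \<Longrightarrow> C_on m (chart_image c) (loc d c)"
  using partition by (auto simp: partition_of_unity_def smooth_function_def smooth_on_def loc_def[abs_def] o_def)

lemma loc_has_derivative:
  "d \<in> F \<Longrightarrow> c \<in> atlas M \<Longrightarrow> x \<in> chart_image c \<Longrightarrow> (loc d c has_derivative dloc d c x) (at x)"
  unfolding dloc_def by (rule C_on_has_derivative[OF open_chart_image loc_smooth])

lemma dloc_continuous: "d \<in> F \<Longrightarrow> c \<in> atlas M \<Longrightarrow> continuous_on (chart_image c) (\<lambda>x. dloc d c x v)"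
  unfolding dloc_def using loc_smooth[of d c 1] by simp

lemma loc_continuous: "d \<in> F \<Longrightarrow> c \<in> atlas M \<Longrightarrow> continuous_on (chart_image c) (loc d c)"
  using loc_smooth[of d c 0] by simp

lemma supp_subset: "d \<in> F \<Longrightarrow> supp d \<subseteq> fst d"
  using partition by (auto simp: partition_of_unity_def supp_def)

lemma closed_supp: "closedin (mtop M) (supp d)"
  by (simp add: supp_def)

lemma off_supp: "y \<in> topspace (mtop M) \<Longrightarrow> y \<notin> supp d \<Longrightarrow> \<rho> d y = 0"
  using closure_of_subset[of "{y \<in> topspace (mtop M). \<rho> d y \<noteq> 0}" "mtop M"] by (auto simp: supp_def)

lemma loc_zero:
  assumes c: "c \<in> atlas M" and d: "d \<in> F" and x: "x \<in> chart_image c" "chart_inv c x \<notin> supp d"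
  shows "loc d c x = 0" "dloc d c x v = 0"
proof -
  have top: "chart_inv c z \<in> topspace (mtop M)" if "z \<in> chart_image c" for z
    using chart_inv_in[OF c that] chart_domain_subset[OF c] by blast
  let ?U = "{z \<in> chart_image c. chart_inv c z \<in> topspace (mtop M) - supp d}"
  have U: "open ?U" "x \<in> ?U"
    using open_chart_preimage[OF c] closed_supp x top by blast+
  have zero: "loc d c z = 0" if "z \<in> ?U" for z
    using that off_supp by (simp add: loc_def)
  show "loc d c x = 0"
    using zero U by blast
  show "dloc d c x v = 0"
    by (rule derivative_zero_off_support[OF U(1) closed_empty _ _ loc_has_derivative[OF d c x(1)]])
       (use zero U in auto)
qed

lemma loc_sum: "c \<in> atlas M \<Longrightarrow> x \<in> chart_image c \<Longrightarrow> (\<Sum>d\<in>F. loc d c x) = 1"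
  using partition chart_inv_in chart_domain_subset unfolding partition_of_unity_def loc_def by blast

lemma dloc_sum:
  assumes c: "c \<in> atlas M" and x: "x \<in> chart_image c"
  shows "(\<Sum>d\<in>F. dloc d c x v) = 0"
proof -
  have "((\<lambda>x. \<Sum>d\<in>F. loc d c x) has_derivative (\<lambda>v. \<Sum>d\<in>F. dloc d c x v)) (at x)"
    using loc_has_derivative c x by (intro has_derivative_sum) auto
  then have "((\<lambda>x. 1) has_derivative (\<lambda>v. \<Sum>d\<in>F. dloc d c x v)) (at x)"
    by (rule has_derivative_transform_within_open[OF _ open_chart_image[OF c] x]) (rule loc_sum[OF c])
  then have "(\<lambda>v. \<Sum>d\<in>F. dloc d c x v) = (\<lambda>_. 0)"
    using has_derivative_const has_derivative_unique by blast
  then show ?thesis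
    by meson
qed

lemma absolutely_integrable_chart:
  fixes f :: "(real, 'n) vec \<Rightarrow> real"
  assumes c: "c \<in> F" and f: "continuous_on (chart_image c) f"
    and zero: "\<And>x. x \<in> chart_image c \<Longrightarrow> chart_inv c x \<notin> supp c \<Longrightarrow> f x = 0"
  shows "f absolutely_integrable_on chart_image c"
proof (rule absolutely_integrable_compact_support)
  let ?K = "snd c ` supp c"
  show "open (chart_image c)"
    by (rule open_chart_image[OF F_atlas[OF c]])
  show "compact ?K" "?K \<subseteq> chart_image c"
    by (rule compact_chart_support[OF F_atlas[OF c] closed_supp supp_subset[OF c]])+
  show "f x = 0" if "x \<in> chart_image c - ?K" for x
  proof (rule zero)
    show "x \<in> chart_image c" "chart_inv c x \<notin> supp c"
      using that chart_chart_inv[OF F_atlas[OF c], of x] image_eqI[of x "snd c" "chart_inv c x" "supp c"] by auto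
  qed
qed (fact f)

context
  fixes \<alpha> \<beta> :: "('a, 'n) form"
  assumes \<alpha>: "\<alpha> \<in> forms M p" and \<beta>: "\<beta> \<in> forms M p"
begin

lemma form_smooth:
  assumes "\<omega> \<in> forms M p" "c \<in> atlas M"
  shows "C_on m (chart_image c) (\<lambda>x. \<omega> c x vs)"
  using assms by (auto simp: forms_def smooth_on_def)

lemma form_continuous:
  assumes "\<omega> \<in> forms M p" "c \<in> atlas M"
  shows "continuous_on (chart_image c) (\<lambda>x. \<omega> c x vs)"
    "continuous_on (chart_image c) (\<lambda>x. frechet_derivative (\<lambda>y. \<omega> c y vs) (at x) v)"
  using form_smooth[OF assms, of 0 vs] form_smooth[OF assms, of 1 vs] by simp_all

lemma form_has_derivative:
  assumes "\<omega> \<in> forms M p" "c \<in> atlas M" "x \<in> chart_image c"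
  shows "((\<lambda>y. \<omega> c y vs) has_derivative frechet_derivative (\<lambda>y. \<omega> c y vs) (at x)) (at x)"
  by (rule C_on_has_derivative[OF open_chart_image[OF assms(2)] form_smooth[OF assms(1,2)] assms(3)])

text \<open>Up to the factor \<open>(fact p)^2\<close>, the coefficient in chart c of the top-degree
  form \<alpha> d\<rho> \<beta>, where \<rho> is the member d of the partition.\<close>

definition \<Theta> :: "('a, 'n) chart \<Rightarrow> ('a, 'n) chart \<Rightarrow> (real, 'n) vec \<Rightarrow> real" where
  "\<Theta> d c x = theta p (dloc d c x) (\<alpha> c x) (\<beta> c x) frame_vec"

lemma \<Theta>_continuous: "d \<in> F \<Longrightarrow> c \<in> atlas M \<Longrightarrow> continuous_on (chart_image c) (\<Theta> d c)"
  unfolding \<Theta>_def theta_def using \<alpha> \<beta>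
  by (intro continuous_intros dloc_continuous form_continuous) auto

lemma \<Theta>_zero:
  "c \<in> atlas M \<Longrightarrow> d \<in> F \<Longrightarrow> x \<in> chart_image c \<Longrightarrow> chart_inv c x \<notin> supp d \<Longrightarrow> \<Theta> d c x = 0"
  by (simp add: \<Theta>_def theta_def loc_zero)

lemma \<Theta>_sum: "c \<in> atlas M \<Longrightarrow> x \<in> chart_image c \<Longrightarrow> (\<Sum>d\<in>F. \<Theta> d c x) = 0"
  unfolding \<Theta>_def theta_def
  by (subst sum.swap) (simp add: sum_distrib_left[symmetric] sum_distrib_right[symmetric] dloc_sum)

text \<open>The chain rule for the partition function and the compatibility of \<alpha> and \<beta>
  express the left side by the Jacobian applied to the frame; \<open>theta_det\<close> extracts its
  determinant.\<close>

lemma \<Theta>_transition: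
  assumes c: "c \<in> atlas M" and d: "d \<in> atlas M" and e: "e \<in> F" and x: "x \<in> overlap c d"
  shows "\<Theta> e c x = det (matrix (jacobian_map c d x)) * \<Theta> e d (transition c d x)"
proof -
  let ?J = "jacobian_map c d x" and ?y = "transition c d x"
  have xc: "x \<in> chart_image c" and yd: "?y \<in> chart_image d"
    using x overlap_subset[OF c d] overlap_subset[OF d c] transition_in[OF c d x] by auto
  have J: "(transition c d has_derivative ?J) (at x)"
    by (rule transition_has_derivative[OF c d x])
  then have lin: "linear ?J"
    by (rule has_derivative_linear)
  have "((\<lambda>x. loc e d (transition c d x)) has_derivative (\<lambda>v. dloc e d ?y (?J v))) (at x)"
    by (rule has_derivative_compose[OF J loc_has_derivative[OF e d yd]])
  then have "(loc e c has_derivative (\<lambda>v. dloc e d ?y (?J v))) (at x)"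
    by (rule has_derivative_transform_within_open[OF _ open_overlap[OF c d] x])
       (simp add: loc_def transition_in[OF c d])
  then have dl: "dloc e c x = (\<lambda>v. dloc e d ?y (?J v))"
    using loc_has_derivative[OF e c xc] has_derivative_unique by blast
  have form: "\<omega> c x vs = \<omega> d ?y (map ?J vs)" if "\<omega> \<in> forms M p" for \<omega> vs
    using that c d x unfolding forms_def by blast
  have "\<Theta> e c x = theta p (dloc e d ?y) (\<alpha> d ?y) (\<beta> d ?y) (\<lambda>i. ?J (frame_vec i))"
    unfolding \<Theta>_def theta_def dl form[OF \<alpha>] form[OF \<beta>] by (simp add: o_def)
  also have "\<dots> = theta p (dloc e d ?y) (\<alpha> d ?y) (\<beta> d ?y) (\<lambda>i. matrix ?J *v frame_vec i)"
    by (simp only: fun_cong[OF matrix_vector_mul(2)[OF lin]])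
  also have "\<dots> = det (matrix ?J) * theta p (dloc e d ?y) (\<alpha> d ?y) (\<beta> d ?y) frame_vec"
    using dim has_derivative_linear[OF loc_has_derivative[OF e d yd]] \<alpha> \<beta> d yd
    by (intro theta_det) (auto simp: forms_def)
  finally show ?thesis
    by (simp add: \<Theta>_def)
qed

text \<open>Both integrands live on the overlap: \<open>loc d\<close> vanishes off the domain of d,
  and \<open>\<Theta> c\<close> off the domain of c. There the determinant is positive by
  orientation, so it equals the absolute value in the change of variables.\<close>

lemma integral_\<Theta>_transition:
  assumes c: "c \<in> F" and d: "d \<in> F"
  shows "integral (chart_image c) (\<lambda>x. loc d c x * \<Theta> c c x) = integral (chart_image d) (\<lambda>x. loc d d x * \<Theta> c d x)"
proof -
  note ca = F_atlas[OF c] and da = F_atlas[OF d]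
  let ?f = "\<lambda>x. loc d d x * \<Theta> c d x" and ?t = "transition c d"
  have img: "?t ` overlap c d = overlap d c" and inj: "inj_on ?t (overlap c d)"
    using bij_betw_transition[OF ca da] by (auto simp: bij_betw_def)
  have "?f absolutely_integrable_on chart_image d"
    using ca da d loc_continuous \<Theta>_continuous c
    by (intro absolutely_integrable_chart continuous_intros) (auto simp: loc_zero)
  then have f: "?f absolutely_integrable_on overlap d c"
    by (rule set_integrable_subset)
       (use open_overlap[OF da ca] overlap_subset[OF da ca] in \<open>auto simp: borel_open\<close>)
  have "integral (chart_image c) (\<lambda>x. loc d c x * \<Theta> c c x) = integral (overlap c d) (\<lambda>x. loc d c x * \<Theta> c c x)"
  proof (rule integral_spike_set[OF empty_imp_negligible negligible_subset[OF negligible_empty]], goal_cases)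
    case 1
    have "loc d c x = 0" if "x \<in> chart_image c" "x \<notin> overlap c d" for x
      using that overlap_iff[OF ca] supp_subset[OF d] by (intro loc_zero[OF ca d]) auto
    then show ?case by auto
  next
    case 2
    then show ?case
      using overlap_subset[OF ca da] by auto
  qed
  also have "\<dots> = integral (overlap c d) (\<lambda>x. \<bar>det (matrix (jacobian_map c d x))\<bar> * ?f (?t x))"
  proof (rule integral_cong)
    fix x assume x: "x \<in> overlap c d"
    have "loc d c x = loc d d (?t x)"
      using transition_in(2)[OF ca da x] by (simp add: loc_def)
    then show "loc d c x * \<Theta> c c x = \<bar>det (matrix (jacobian_map c d x))\<bar> * ?f (?t x)"
      using \<Theta>_transition[OF ca da c x] det_jacobian_pos[OF ca da x] by simp
  qed
  also have "\<dots> = integral (?t ` overlap c d) ?f"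
  proof (rule integral_change_of_variables_real[symmetric])
    show "overlap c d \<in> sets lebesgue"
      using open_overlap[OF ca da] by (simp add: borel_open)
    show "(?t has_derivative jacobian_map c d x) (at x within overlap c d)" if "x \<in> overlap c d" for x
      using transition_has_derivative[OF ca da that] has_derivative_at_withinI by blast
  qed (use inj f img in auto)
  also have "\<dots> = integral (overlap d c) ?f"
    by (simp only: img)
  also have "\<dots> = integral (chart_image d) ?f"
  proof (rule integral_spike_set[OF empty_imp_negligible negligible_subset[OF negligible_empty]], goal_cases)
    case 1
    then show ?case
      using overlap_subset[OF da ca] by auto
  next
    case 2
    have "\<Theta> c d x = 0" if "x \<in> chart_image d" "x \<notin> overlap d c" for x
      using that overlap_iff[OF da] supp_subset[OF c] by (intro \<Theta>_zero[OF da c]) auto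
    then show ?case by auto
  qed
  finally show ?thesis .
qed

text \<open>
  Inserting \<open>1 = \<Sum>\<^sub>d \<rho>\<^sub>d\<close> and moving the \<open>d\<close>-th summand to the chart \<open>d\<close> turns the sum of the
  forms built from \<open>d\<rho>\<^sub>c\<close> into one built from \<open>d(\<Sum>\<^sub>c \<rho>\<^sub>c) = 0\<close>.
\<close>

lemma sum_integral_\<Theta>: "(\<Sum>c\<in>F. integral (chart_image c) (\<Theta> c c)) = 0"
proof -
  \<comment> \<open>One factor must belong to c itself: the support of that partition function is
    the one that lies compactly inside chart c.\<close>
  have int: "(\<lambda>x. loc d c x * \<Theta> e c x) integrable_on chart_image c"
    if "c \<in> F" "d \<in> F" "e \<in> F" "d = c \<or> e = c" for c d e
  proof (intro set_lebesgue_integral_eq_integral(1) absolutely_integrable_chart continuous_intros that(1)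
      loc_continuous \<Theta>_continuous F_atlas that(2,3))
    fix x assume "x \<in> chart_image c" "chart_inv c x \<notin> supp c"
    then show "loc d c x * \<Theta> e c x = 0"
      using that(4) loc_zero(1)[OF F_atlas[OF that(1)] that(1)] \<Theta>_zero[OF F_atlas[OF that(1)] that(1)] by auto
  qed
  have "integral (chart_image c) (\<Theta> c c) = (\<Sum>d\<in>F. integral (chart_image d) (\<lambda>x. loc d d x * \<Theta> c d x))"
    if c: "c \<in> F" for c
  proof -
    have "integral (chart_image c) (\<Theta> c c) = integral (chart_image c) (\<lambda>x. \<Sum>d\<in>F. loc d c x * \<Theta> c c x)"
      using loc_sum[OF F_atlas[OF c]] by (intro integral_cong) (simp add: sum_distrib_right[symmetric])
    also have "\<dots> = (\<Sum>d\<in>F. integral (chart_image c) (\<lambda>x. loc d c x * \<Theta> c c x))"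
      using finite_F int c by (intro integral_sum) auto
    also have "\<dots> = (\<Sum>d\<in>F. integral (chart_image d) (\<lambda>x. loc d d x * \<Theta> c d x))"
      by (intro sum.cong refl integral_\<Theta>_transition c)
    finally show ?thesis .
  qed
  then have "(\<Sum>c\<in>F. integral (chart_image c) (\<Theta> c c))
      = (\<Sum>c\<in>F. \<Sum>d\<in>F. integral (chart_image d) (\<lambda>x. loc d d x * \<Theta> c d x))"
    by (rule sum.cong[OF refl])
  also have "\<dots> = (\<Sum>d\<in>F. integral (chart_image d) (\<lambda>x. \<Sum>c\<in>F. loc d d x * \<Theta> c d x))"
    using finite_F int by (subst sum.swap) (simp add: integral_sum)
  also have "\<dots> = (\<Sum>d\<in>F. 0)"
    using \<Theta>_sum F_atlas
    by (intro sum.cong refl) (simp add: sum_distrib_left[symmetric] cong: integral_cong)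
  finally show ?thesis
    by simp
qed

end
end

context partitioned_manifold
begin

lemma wedge_d_coeff_continuous:
  assumes "\<alpha> \<in> forms M p" "\<beta> \<in> forms M p" "c \<in> atlas M"
  shows "continuous_on (chart_image c) (wedge_d_coeff p \<alpha> \<beta> c)"
  unfolding wedge_d_coeff_def using form_continuous assms
  by (intro continuous_intros) auto

definition wedge_d_integral :: "('a, 'n) form \<Rightarrow> ('a, 'n) form \<Rightarrow> real" where
  "wedge_d_integral \<alpha> \<beta> = (\<Sum>c\<in>F. integral (chart_image c) (\<lambda>x. loc c c x * wedge_d_coeff p \<alpha> \<beta> c x))"

lemma wedge_d_integrable:
  assumes "\<alpha> \<in> forms M p" "\<beta> \<in> forms M p" "c \<in> F"
  shows "(\<lambda>x. loc c c x * wedge_d_coeff p \<alpha> \<beta> c x) integrable_on chart_image c"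
  using loc_zero(1)[OF F_atlas[OF assms(3)] assms(3)]
  by (intro set_lebesgue_integral_eq_integral(1) absolutely_integrable_chart continuous_intros
      loc_continuous wedge_d_coeff_continuous assms F_atlas) auto

text \<open>Chart by chart, the symmetrized integral is minus the integral of
  \<open>\<Theta>\<close>; \<open>sum_integral_\<Theta>\<close> disposes of the sum over the
  charts.\<close>

lemma wedge_d_integral_skew:
  assumes \<alpha>: "\<alpha> \<in> forms M p" and \<beta>: "\<beta> \<in> forms M p" and p: "even p"
  shows "wedge_d_integral \<alpha> \<beta> + wedge_d_integral \<beta> \<alpha> = 0"
proof -
  have chart: "integral (chart_image c) (\<lambda>x. loc c c x * wedge_d_coeff p \<alpha> \<beta> c x)
      + integral (chart_image c) (\<lambda>x. loc c c x * wedge_d_coeff p \<beta> \<alpha> c x)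
      = - integral (chart_image c) (\<Theta> \<alpha> \<beta> c c)" if c: "c \<in> F" for c
  proof -
    note ca = F_atlas[OF c]
    let ?U = "chart_image c" and ?P = "{\<pi>. \<pi> permutes {..<p + p + 1}}"
    let ?a = "\<lambda>\<pi> y. \<alpha> c y (map (frame_vec \<circ> \<pi>) [0..<p])"
      and ?b = "\<lambda>\<pi> y. \<beta> c y (map (frame_vec \<circ> \<pi>) [p + 1..<p + p + 1])"
    define h where "h \<pi> y = ?a \<pi> y * ?b \<pi> y" for \<pi> y
    define h' where "h' \<pi> x v = frechet_derivative (h \<pi>) (at x) v" for \<pi> x v
    have h: "C_on m ?U (h \<pi>)" for m \<pi>
      unfolding h_def using form_smooth \<alpha> \<beta> ca by (intro C_on_mult open_chart_image) auto
    have h'c: "continuous_on ?U (\<lambda>x. h' \<pi> x v)" for \<pi> v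
      unfolding h'_def using h[of 1 \<pi>] by simp
    have hc: "continuous_on ?U (h \<pi>)" for \<pi>
      using h[of 0 \<pi>] by simp
    have hd: "(h \<pi> has_derivative h' \<pi> x) (at x)" if "x \<in> ?U" for \<pi> x
      unfolding h'_def by (rule C_on_has_derivative[OF open_chart_image[OF ca] h that])
    \<comment> \<open>The derivative of \<open>loc c c\<close> times \<open>h \<pi>\<close>, a
      function with compact support in the chart, so its integral vanishes in every fixed
      direction.\<close>
    let ?D = "\<lambda>\<pi> x v. loc c c x * h' \<pi> x v + dloc c c x v * h \<pi> x"
    have D: "((\<lambda>x. loc c c x * h \<pi> x) has_derivative ?D \<pi> x) (at x)" if "x \<in> ?U" for \<pi> x
      using that hd loc_has_derivative[OF c ca] by (intro has_derivative_mult) auto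
    have Dc: "continuous_on ?U (\<lambda>x. ?D \<pi> x v)" for \<pi> v
      by (intro continuous_intros loc_continuous dloc_continuous c ca h'c hc)
    let ?K = "snd c ` supp c"
    have K: "compact ?K" "?K \<subseteq> ?U"
      using compact_chart_support[OF ca closed_supp supp_subset[OF c]] by auto
    have off: "chart_inv c x \<notin> supp c" if "x \<in> ?U - ?K" for x
      using that chart_chart_inv[OF ca, of x] image_eqI[of x "snd c" "chart_inv c x" "supp c"] by auto
    have D0: "integral ?U (\<lambda>x. ?D \<pi> x v) = 0" for \<pi> v
    proof (rule integral_derivative_compact_support[OF open_chart_image[OF ca] K _ D Dc])
      show "loc c c x * h \<pi> x = 0" if "x \<in> ?U - ?K" for x
        using loc_zero(1)[OF ca c _ off[OF that]] that by simp
    qed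
    have Dint: "(\<lambda>x. ?D \<pi> x v) integrable_on ?U" for \<pi> v
      by (rule set_lebesgue_integral_eq_integral(1)[OF absolutely_integrable_chart[OF c Dc]])
         (simp add: loc_zero[OF ca c])
    \<comment> \<open>Of the two product-rule terms in \<open>?D\<close>, the one with
      \<open>h'\<close> yields the symmetrized coefficient and the one with \<open>dloc\<close>
      yields \<open>\<Theta>\<close>.\<close>
    have eq: "loc c c x * wedge_d_coeff p \<alpha> \<beta> c x + loc c c x * wedge_d_coeff p \<beta> \<alpha> c x + \<Theta> \<alpha> \<beta> c c x
        = (\<Sum>\<pi>\<in>?P. of_int (sign \<pi>) * ?D \<pi> x (frame_vec (\<pi> p)))" if x: "x \<in> ?U" for x
    proof -
      have "(\<lambda>y. \<alpha> c y vs) differentiable (at x)" "(\<lambda>y. \<beta> c y vs) differentiable (at x)" for vs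
        using form_has_derivative \<alpha> \<beta> ca x by (blast intro: differentiableI)+
      then have "wedge_d_coeff p \<alpha> \<beta> c x + wedge_d_coeff p \<beta> \<alpha> c x
          = (\<Sum>\<pi>\<in>?P. of_int (sign \<pi>) * h' \<pi> x (frame_vec (\<pi> p)))"
        unfolding h'_def h_def[abs_def] by (intro wedge_d_coeff_symmetrized p)
      moreover have "\<Theta> \<alpha> \<beta> c c x = (\<Sum>\<pi>\<in>?P. of_int (sign \<pi>) * (dloc c c x (frame_vec (\<pi> p)) * h \<pi> x))"
        unfolding \<Theta>_def[OF \<alpha> \<beta>] theta_def h_def by simp
      ultimately show ?thesis
        by (simp only: distrib_left[symmetric]) (simp only: distrib_left sum.distrib sum_distrib_left mult.left_commute)
    qed
    have int: "(\<lambda>x. loc c c x * wedge_d_coeff p \<alpha> \<beta> c x) integrable_on ?U"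
      "(\<lambda>x. loc c c x * wedge_d_coeff p \<beta> \<alpha> c x) integrable_on ?U"
      using wedge_d_integrable \<alpha> \<beta> c by auto
    have int\<Theta>: "\<Theta> \<alpha> \<beta> c c integrable_on ?U"
      by (rule set_lebesgue_integral_eq_integral(1)[OF absolutely_integrable_chart[OF c \<Theta>_continuous[OF \<alpha> \<beta> c ca]]])
         (rule \<Theta>_zero[OF \<alpha> \<beta> ca c])
    have "integral ?U (\<lambda>x. loc c c x * wedge_d_coeff p \<alpha> \<beta> c x)
        + integral ?U (\<lambda>x. loc c c x * wedge_d_coeff p \<beta> \<alpha> c x) + integral ?U (\<Theta> \<alpha> \<beta> c c)
        = integral ?U (\<lambda>x. \<Sum>\<pi>\<in>?P. of_int (sign \<pi>) * ?D \<pi> x (frame_vec (\<pi> p)))"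
      using int int\<Theta> eq by (simp add: integral_add[symmetric] integrable_add cong: integral_cong)
    also have "\<dots> = (\<Sum>\<pi>\<in>?P. of_int (sign \<pi>) * integral ?U (\<lambda>x. ?D \<pi> x (frame_vec (\<pi> p))))"
      using Dint by (subst integral_sum) (auto intro!: finite_permutations integrable_on_mult_right)
    also have "\<dots> = 0"
      by (simp add: D0)
    finally show ?thesis
      by linarith
  qed
  show ?thesis
    unfolding wedge_d_integral_def sum.distrib[symmetric]
    using sum_integral_\<Theta>[OF \<alpha> \<beta>] by (simp add: chart sum_negf)
qed

lemma wedge_d_integral_add:
  assumes "\<alpha> \<in> forms M p" "\<alpha>' \<in> forms M p" "\<beta> \<in> forms M p"
  shows "wedge_d_integral (\<alpha> + \<alpha>') \<beta> = wedge_d_integral \<alpha> \<beta> + wedge_d_integral \<alpha>' \<beta>"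
proof -
  have "loc c c x * wedge_d_coeff p (\<alpha> + \<alpha>') \<beta> c x
      = loc c c x * wedge_d_coeff p \<alpha> \<beta> c x + loc c c x * wedge_d_coeff p \<alpha>' \<beta> c x" for c x
    by (simp add: wedge_d_coeff_def distrib_left distrib_right sum.distrib)
  then show ?thesis
    unfolding wedge_d_integral_def sum.distrib[symmetric]
    using assms by (intro sum.cong refl) (simp add: integral_add wedge_d_integrable)
qed

lemma wedge_d_integral_scale:
  "wedge_d_integral (\<lambda>c x vs. t * \<alpha> c x vs) \<beta> = t * wedge_d_integral \<alpha> \<beta>"
proof -
  have "loc c c x * wedge_d_coeff p (\<lambda>c x vs. t * \<alpha> c x vs) \<beta> c x
      = t * (loc c c x * wedge_d_coeff p \<alpha> \<beta> c x)" for c x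
    by (simp add: wedge_d_coeff_def sum_distrib_left mult_ac)
  then show ?thesis
    unfolding wedge_d_integral_def by (simp only: integral_mult_right sum_distrib_left)
qed

end

section \<open>Forms as a real vector space\<close>

context closed_manifold
begin

lemma forms_zero: "0 \<in> forms M p"
proof -
  have "linear (\<lambda>v. 0 :: real)"
    by (simp add: linear_iff)
  then show ?thesis
    by (auto simp: forms_def on_charts_def alternating_def smooth_on_def fun_eq_iff
        intro!: C_on_const open_chart_image)
qed

lemma forms_add:
  assumes "\<alpha> \<in> forms M p" "\<beta> \<in> forms M p"
  shows "\<alpha> + \<beta> \<in> forms M p"
proof -
  have "on_charts M (\<alpha> + \<beta>) = \<alpha> + \<beta>"
  proof -
    have "on_charts M (\<alpha> + \<beta>) = on_charts M \<alpha> + on_charts M \<beta>"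
      by (auto simp: on_charts_def fun_eq_iff)
    then show ?thesis
      using assms by (simp add: forms_def)
  qed
  moreover have "alternating p ((\<alpha> + \<beta>) c x)" if "c \<in> atlas M" "x \<in> chart_image c" for c x
  proof -
    have "alternating p (\<alpha> c x)" "alternating p (\<beta> c x)"
      using assms that by (auto simp: forms_def)
    then show ?thesis
      by (auto simp: alternating_def intro: linear_compose_add)
  qed
  moreover have "smooth_on (chart_image c) (\<lambda>x. (\<alpha> + \<beta>) c x vs)" if "c \<in> atlas M" for c vs
    using assms that by (auto simp: forms_def smooth_on_def intro!: C_on_add open_chart_image)
  moreover have "(\<alpha> + \<beta>) c x vs = (\<alpha> + \<beta>) c' (transition c c' x) (map (jacobian_map c c' x) vs)"
    if "c \<in> atlas M" "c' \<in> atlas M" "x \<in> overlap c c'" for c c' x vs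
  proof -
    have "\<alpha> c x vs = \<alpha> c' (transition c c' x) (map (jacobian_map c c' x) vs)"
      "\<beta> c x vs = \<beta> c' (transition c c' x) (map (jacobian_map c c' x) vs)"
      using that assms unfolding forms_def by blast+
    then show ?thesis
      by simp
  qed
  ultimately show ?thesis
    unfolding forms_def by blast
qed

lemma forms_scale:
  assumes "\<alpha> \<in> forms M p"
  shows "(\<lambda>c x vs. t * \<alpha> c x vs) \<in> forms M p"
proof -
  let ?\<omega> = "\<lambda>c x vs. t * \<alpha> c x vs"
  have "on_charts M ?\<omega> = (\<lambda>c x vs. t * on_charts M \<alpha> c x vs)"
    by (auto simp: on_charts_def fun_eq_iff)
  then have "on_charts M ?\<omega> = ?\<omega>"
    using assms by (simp add: forms_def)
  moreover have "alternating p (?\<omega> c x)" if "c \<in> atlas M" "x \<in> chart_image c" for c x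
  proof -
    have "alternating p (\<alpha> c x)"
      using assms that by (auto simp: forms_def)
    then show ?thesis
      using linear_compose_scale_right[where c = t and 'b = real, unfolded real_scaleR_def] by (auto simp: alternating_def)
  qed
  moreover have "smooth_on (chart_image c) (\<lambda>x. ?\<omega> c x vs)" if "c \<in> atlas M" for c vs
    using assms that by (auto simp: forms_def smooth_on_def intro!: C_on_mult C_on_const open_chart_image)
  moreover have "?\<omega> c x vs = ?\<omega> c' (transition c c' x) (map (jacobian_map c c' x) vs)"
    if "c \<in> atlas M" "c' \<in> atlas M" "x \<in> overlap c c'" for c c' x vs
    using that assms unfolding forms_def by auto
  ultimately show ?thesis
    unfolding forms_def by blast
qed

lemma forms_uminus: "\<alpha> \<in> forms M p \<Longrightarrow> - \<alpha> \<in> forms M p"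
  using forms_scale[of \<alpha> p "- 1"] by (simp add: fun_Compl_def)

lemma zero_closed_integral: "0 \<in> closed_integral_forms M p"
proof -
  have "ext_deriv M 0 = 0"
    by (auto simp: ext_deriv_def on_charts_def fun_eq_iff)
  moreover have "singular_cocycle (mtop M) p (\<lambda>_. 0 :: int)" "singular_cocycle (mtop M) p (\<lambda>_. 0 :: real)"
    by (simp_all add: singular_cocycle_def)
  moreover have "simplex_integral M p 0 \<sigma> = 0" for \<sigma>
    by (simp add: simplex_integral_def set_lebesgue_integral_def)
  ultimately show ?thesis
    unfolding closed_integral_forms_def de_Rham_represented_by_def
    using forms_zero by (auto intro!: exI[of _ "\<lambda>_. 0"])
qed

end

section \<open>The representation of the group of forms\<close>

text \<open>The choice inside \<open>form_integral\<close> does not mention the form, so a single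
  partition serves all forms. Additivity and skew symmetry then refer to the same weights.\<close>

lemma form_integral_partition:
  fixes M :: "('a, 'n::{finite,wellorder}) riem_manifold"
  assumes "closed_oriented_riemannian_manifold M"
  obtains F \<rho> where "partition_of_unity M F \<rho>"
    "\<And>\<omega>. form_integral M \<omega> = (\<Sum>c\<in>F. integral (chart_image c) (\<lambda>x. \<rho> c (chart_inv c x) * \<omega> c x std_frame))"
proof -
  interpret closed_manifold M
    by unfold_locales (fact assms)
  obtain F \<rho> where F: "(F, \<rho>) = (SOME (F, \<rho>). partition_of_unity M F \<rho>)"
    by (metis surj_pair)
  have "\<exists>P. case P of (F, \<rho>) \<Rightarrow> partition_of_unity M F \<rho>"
    using partition_of_unity_exists by simp
  from someI_ex[OF this] have "partition_of_unity M F \<rho>"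
    unfolding F[symmetric] by simp
  then show ?thesis
    by (rule that) (simp add: form_integral_def F[symmetric])
qed

theorem lemma1p1:
  fixes k :: nat and M :: "('a, 'n::{finite,wellorder}) riem_manifold"
  assumes "closed_oriented_riemannian_manifold M"
    and "CARD('n) = 4 * k + 1"
  shows "\<forall>l \<in> harmonic_characters M k.
    \<exists>(H :: (('a, 'n) form set \<Rightarrow> complex) cinner_space) \<rho>.
      projective_unitary_rep (G0 M k) (\<lambda>f g. exp_2pi_i (S_form M k f g)) H \<rho> \<and>
      irreducible_rep (G0 M k) H \<rho>"
proof
  fix l
  obtain F \<rho> where F: "partition_of_unity M F \<rho>"
    and int: "\<And>\<omega>. form_integral M \<omega> =
      (\<Sum>c\<in>F. integral (chart_image c) (\<lambda>x. \<rho> c (chart_inv c x) * \<omega> c x std_frame))"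
    using form_integral_partition[OF assms(1)] by blast
  interpret partitioned_manifold M F \<rho> "2 * k"
    using assms F by unfold_locales auto
  \<comment> \<open>The real lift of \<open>S_form\<close>: radical and isotropic subsets are taken
    before reduction modulo integers.\<close>
  define s where "s \<alpha> \<beta> = form_integral M (wedge (2 * k) (2 * k + 1) \<alpha> (ext_deriv M \<beta>))" for \<alpha> \<beta>
  have s: "s \<alpha> \<beta> = wedge_d_integral \<alpha> \<beta> / (fact (2 * k))\<^sup>2" for \<alpha> \<beta>
  proof -
    have "integral (chart_image c) (\<lambda>x. \<rho> c (chart_inv c x) * wedge (2 * k) (2 * k + 1) \<alpha> (ext_deriv M \<beta>) c x std_frame)
        = integral (chart_image c) (\<lambda>x. loc c c x * wedge_d_coeff (2 * k) \<alpha> \<beta> c x) / (fact (2 * k))\<^sup>2"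
      if "c \<in> F" for c
    proof -
      have "integral (chart_image c) (\<lambda>x. \<rho> c (chart_inv c x) * wedge (2 * k) (2 * k + 1) \<alpha> (ext_deriv M \<beta>) c x std_frame)
          = integral (chart_image c) (\<lambda>x. loc c c x * wedge_d_coeff (2 * k) \<alpha> \<beta> c x / (fact (2 * k))\<^sup>2)"
        using wedge_ext_deriv_frame[OF dim F_atlas[OF that]]
        by (intro integral_cong) (simp add: loc_def)
      then show ?thesis
        by simp
    qed
    then show ?thesis
      by (simp add: s_def int wedge_d_integral_def sum_divide_distrib)
  qed
  interpret skew_form "forms M (2 * k)" s "\<lambda>t \<omega> c x vs. t * \<omega> c x vs"
  proof
    fix \<alpha> \<beta> \<gamma> and t :: real
    assume \<alpha>: "\<alpha> \<in> forms M (2 * k)"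
    show "(\<lambda>c x vs. t * \<alpha> c x vs) \<in> forms M (2 * k)" "- \<alpha> \<in> forms M (2 * k)"
      using \<alpha> by (rule forms_scale forms_uminus)+
    assume \<beta>: "\<beta> \<in> forms M (2 * k)"
    show "\<alpha> + \<beta> \<in> forms M (2 * k)"
      using \<alpha> \<beta> by (rule forms_add)
    have "wedge_d_integral \<alpha> \<beta> = - wedge_d_integral \<beta> \<alpha>"
      using wedge_d_integral_skew[OF \<alpha> \<beta>] by simp
    then show "s \<alpha> \<beta> = - s \<beta> \<alpha>"
      by (simp add: s)
    show "s (\<lambda>c x vs. t * \<alpha> c x vs) \<beta> = t * s \<alpha> \<beta>"
      by (simp add: s wedge_d_integral_scale)
    assume \<gamma>: "\<gamma> \<in> forms M (2 * k)"
    show "s (\<alpha> + \<beta>) \<gamma> = s \<alpha> \<gamma> + s \<beta> \<gamma>"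
      by (simp add: s wedge_d_integral_add[OF \<alpha> \<beta> \<gamma>] add_divide_distrib)
  qed (rule forms_zero)
  \<comment> \<open>Closedness makes the integral 0 at once when the closed form stands second,
    under d; skew symmetry moves it to the first slot, where
    \<open>projective_rep_of_quotient\<close> expects it.\<close>
  have "s \<alpha> \<beta> = 0" if \<alpha>: "\<alpha> \<in> closed_integral_forms M (2 * k)" and \<beta>: "\<beta> \<in> forms M (2 * k)" for \<alpha> \<beta>
  proof -
    have "ext_deriv M \<alpha> = 0" "\<alpha> \<in> forms M (2 * k)"
      using \<alpha> by (auto simp: closed_integral_forms_def)
    moreover have "wedge (2 * k) (2 * k + 1) \<beta> 0 c x vs = 0" for c x vs
      unfolding wedge_def zero_fun_def by simp
    ultimately have "s \<beta> \<alpha> = 0"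
      by (simp add: s_def int)
    then show ?thesis
      using s_skew[OF \<open>\<alpha> \<in> forms M (2 * k)\<close> \<beta>] by simp
  qed
  moreover have "closed_integral_forms M (2 * k) \<subseteq> forms M (2 * k)"
    by (auto simp: closed_integral_forms_def)
  moreover have "closed_integral_forms M (2 * k) \<noteq> {}"
    using zero_closed_integral by blast
  ultimately show "\<exists>(H :: (('a, 'n) form set \<Rightarrow> complex) cinner_space) \<rho>.
      projective_unitary_rep (G0 M k) (\<lambda>f g. exp_2pi_i (S_form M k f g)) H \<rho> \<and>
      irreducible_rep (G0 M k) H \<rho>"
    unfolding G0_def S_form_def s_def[symmetric] by (intro projective_rep_of_quotient)
qed

end
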